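(* Let $\overline{\varepsilon}\in\mathbb{R}$, $\hbar>0$, and let $v=\{V_k\}_{k=1}^\infty$ be a sequence of complex numbers with $\sum_{k=1}^\infty|V_k|^2/k<\infty$. If $\lambda$ is sampled from the Jack measure $M(v,v)$, then the size $|\lambda|=\sum_{i=1}^\infty\lambda_i$ has expected value $$\mathbb{E}[|\lambda|]=\frac1\hbar\sum_{k=1}^\infty|V_k|^2,$$ which is directly proportional to $\sum_{k=1}^\infty |V_k|^2$, inversely proportional to $\hbar$, and independent of $\overline{\varepsilon}$.
   Context: Let $\varepsilon_2<0<\varepsilon_1$ be the unique reals with $\varepsilon_1+\varepsilon_2=\overline{\varepsilon}$, $-\varepsilon_1\varepsilon_2=\hbar$. On $\mathbb{C}[\rho_1,\rho_2,\ldots]$ let $\langle\cdot,\cdot\rangle_\hbar$ be the Hermitian inner product for which the monomials $\rho_1^{d_1}\rho_2^{d_2}\cdots$ are orthogonal with squared norm $\prod_k(\hbar k)^{d_k}d_k!$. For a partition $\lambda$, the Jack polynomial $P_\lambda(\rho_1,\rho_2,\ldots|\overline{\varepsilon},\hbar)$ is, up to a scalar, Macdonald's Jack symmetric function with parameter $\alpha=\varepsilon_1/(-\varepsilon_2)$, with power sums $p_k=\rho_k/(-\varepsilon_2)$; put $P^{\rm norm}_\lambda=P_\lambda/\|P_\lambda\|_\hbar$. The Jack measure $M(v,v)$ is the probability measure on the set of all partitions with $\mathrm{Prob}(\lambda)=|P^{\rm norm}_\lambda(V_1,V_2,\ldots|\overline{\varepsilon},\hbar)|^2\exp(-\frac1\hbar\sum_k|V_k|^2/k)$.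 Both sides of the identity may be $+\infty$. *)

theory Defs
  imports "HOL-Probability.Probability" "HOL-Library.Poly_Mapping"
begin

section \<open>Partitions\<close>

text \<open>A partition is a weakly decreasing, finitely supported sequence of naturals. Sequences are
  indexed from 0, so \<^term>\<open>part l i\<close> is the part usually written with index \<open>i + 1\<close>.\<close>

typedef partition = "{l :: nat \<Rightarrow>\<^sub>0 nat. antimono (Poly_Mapping.lookup l)}"
  morphisms parts Abs_partition
  by (rule exI[of _ 0]) (simp add: antimono_def)

definition part :: "partition \<Rightarrow> nat \<Rightarrow> nat" where
  "part l i = Poly_Mapping.lookup (parts l) i"

definition psize :: "partition \<Rightarrow> nat" where
  "psize l = (\<Sum>i\<in>Poly_Mapping.keys (parts l). part l i)"

definition dominated :: "partition \<Rightarrow> partition \<Rightarrow> bool" where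
  "dominated m l \<longleftrightarrow> psize m = psize l \<and> (\<forall>n. (\<Sum>i<n. part m i) \<le> (\<Sum>i<n. part l i))"


section \<open>Polynomials\<close>

text \<open>Polynomials in countably many variables, as finitely supported functions from exponent
  vectors to coefficients. For polynomials in power sums (the \<open>p\<^sub>k\<close>, or the \<open>\<rho>\<^sub>k\<close>,
  with \<open>k \<ge> 1\<close>), the variable with index \<open>j\<close> stands for \<open>p\<^sub>k\<close> or \<open>\<rho>\<^sub>k\<close> with
  \<open>k = j + 1\<close>.\<close>

type_synonym 'a mpoly = "(nat \<Rightarrow>\<^sub>0 nat) \<Rightarrow>\<^sub>0 'a"

definition mconst :: "'a::zero \<Rightarrow> 'a mpoly" where
  "mconst c = Poly_Mapping.single 0 c"

definition mvar :: "nat \<Rightarrow> 'a::zero_neq_one mpoly" where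
  "mvar j = Poly_Mapping.single (Poly_Mapping.single j 1) 1"

text \<open>Apply \<open>c\<close> to the coefficients and substitute \<open>X j\<close> for the variable with index \<open>j\<close>.\<close>

definition msubst :: "('a::zero \<Rightarrow> 'b::comm_semiring_1) \<Rightarrow> (nat \<Rightarrow> 'b) \<Rightarrow> 'a mpoly \<Rightarrow> 'b" where
  "msubst c X f = (\<Sum>d\<in>Poly_Mapping.keys f. c (Poly_Mapping.lookup f d) * (\<Prod>j\<in>Poly_Mapping.keys d. X j ^ Poly_Mapping.lookup d j))"

text \<open>For \<open>d\<close> the exponent vector of a power-sum monomial, \<open>mon_norm c d\<close> is
  \<open>\<Prod>\<^sub>k (c k)^(d\<^sub>k) d\<^sub>k!\<close>. In terms of the partition \<open>\<mu>\<close> having \<open>d\<^sub>k\<close> parts equal to \<open>k\<close>, this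
  is \<open>z\<^sub>\<mu> c^(\<ell>(\<mu>))\<close>, so it gives both the norms of Macdonald's form (\<open>c = \<alpha>\<close>) and those of
  the Hermitian product (\<open>c = \<hbar>\<close>).\<close>

definition mon_norm :: "real \<Rightarrow> (nat \<Rightarrow>\<^sub>0 nat) \<Rightarrow> real" where
  "mon_norm c d = (\<Prod>j\<in>Poly_Mapping.keys d. (c * real (Suc j)) ^ Poly_Mapping.lookup d j * fact (Poly_Mapping.lookup d j))"


section \<open>Macdonald's Jack symmetric functions\<close>

text \<open>The ring of symmetric functions with real coefficients is the polynomial ring in the power
  sums. Its image in the symmetric polynomials in the first \<open>N\<close> variables \<open>x\<^sub>0, \<dots>, x\<^sub>(N-1)\<close> is
  given by \<open>expand N\<close>; a symmetric function is determined by these images for all \<open>N\<close>.\<close>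

definition power_sum :: "nat \<Rightarrow> nat \<Rightarrow> real mpoly" where
  "power_sum N k = (\<Sum>i<N. mvar i ^ k)"

definition expand :: "nat \<Rightarrow> real mpoly \<Rightarrow> real mpoly" where
  "expand N f = msubst mconst (\<lambda>j. power_sum N (Suc j)) f"

text \<open>The monomial symmetric polynomial in \<open>N\<close> variables: the sum of the distinct monomials whose
  exponent vector is a rearrangement of \<open>l\<close>; it is 0 if \<open>l\<close> has more than \<open>N\<close> nonzero parts.\<close>

definition monomial_sym :: "nat \<Rightarrow> partition \<Rightarrow> real mpoly" where
  "monomial_sym N l =
     (\<Sum>a\<in>{a. Poly_Mapping.keys a \<subseteq> {..<N} \<and> (\<exists>\<pi>. bij \<pi> \<and> Poly_Mapping.lookup a = part l \<circ> \<pi>)}. Poly_Mapping.single a 1)"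

definition macdonald_form :: "real \<Rightarrow> real mpoly \<Rightarrow> real mpoly \<Rightarrow> real" where
  "macdonald_form \<alpha> f g = (\<Sum>d\<in>Poly_Mapping.keys f. Poly_Mapping.lookup f d * Poly_Mapping.lookup g d * mon_norm \<alpha> d)"

definition is_jack_family :: "real \<Rightarrow> (partition \<Rightarrow> real mpoly) \<Rightarrow> bool" where
  "is_jack_family \<alpha> J \<longleftrightarrow>
     (\<forall>l. \<exists>u. \<forall>N. expand N (J l) =
        monomial_sym N l + (\<Sum>m | dominated m l \<and> m \<noteq> l. mconst (u m) * monomial_sym N m)) \<and>
     (\<forall>l m. l \<noteq> m \<longrightarrow> macdonald_form \<alpha> (J l) (J m) = 0)"

definition macdonald_jack :: "real \<Rightarrow> partition \<Rightarrow> real mpoly" where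
  "macdonald_jack \<alpha> = (THE J. is_jack_family \<alpha> J)"


section \<open>Jack polynomials and the Jack measure\<close>

text \<open>The parameters \<open>(\<epsilon>\<^sub>1, \<epsilon>\<^sub>2)\<close> determined by \<open>e\<close> (the \<open>\<epsilon>\<close> with a bar) and \<open>h\<close> (the \<open>\<hbar>\<close>).\<close>

definition eps_pair :: "real \<Rightarrow> real \<Rightarrow> real \<times> real" where
  "eps_pair e h = (THE (e1, e2). e2 < 0 \<and> 0 < e1 \<and> e1 + e2 = e \<and> - (e1 * e2) = h)"

abbreviation eps1 :: "real \<Rightarrow> real \<Rightarrow> real" where
  "eps1 e h \<equiv> fst (eps_pair e h)"

abbreviation eps2 :: "real \<Rightarrow> real \<Rightarrow> real" where
  "eps2 e h \<equiv> snd (eps_pair e h)"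

definition herm :: "real \<Rightarrow> complex mpoly \<Rightarrow> complex mpoly \<Rightarrow> complex" where
  "herm h f g = (\<Sum>d\<in>Poly_Mapping.keys f. Poly_Mapping.lookup f d * cnj (Poly_Mapping.lookup g d) * complex_of_real (mon_norm h d))"

definition herm_norm :: "real \<Rightarrow> complex mpoly \<Rightarrow> real" where
  "herm_norm h f = sqrt (Re (herm h f f))"

text \<open>The scalar left free in \<open>P\<^sub>\<lambda>\<close> is fixed by Macdonald's normalization; it disappears
  from \<open>\<bar>P\<^sub>\<lambda>\<bar>\<^sup>2 / \<parallel>P\<^sub>\<lambda>\<parallel>\<^sup>2\<close>.\<close>

definition jack_poly :: "real \<Rightarrow> real \<Rightarrow> partition \<Rightarrow> complex mpoly" where
  "jack_poly e h l =
     msubst (\<lambda>c. mconst (complex_of_real c))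
       (\<lambda>j. mconst (complex_of_real (1 / (- eps2 e h))) * mvar j)
       (macdonald_jack (eps1 e h / (- eps2 e h)) l)"

definition jack_poly_norm :: "real \<Rightarrow> real \<Rightarrow> partition \<Rightarrow> complex mpoly" where
  "jack_poly_norm e h l =
     mconst (complex_of_real (1 / herm_norm h (jack_poly e h l))) * jack_poly e h l"

text \<open>A sequence \<open>(V\<^sub>k)\<close> with \<open>k \<ge> 1\<close> is a function on \<^typ>\<open>nat\<close> whose value at 0 is
  ignored.\<close>

definition jack_prob :: "real \<Rightarrow> real \<Rightarrow> (nat \<Rightarrow> complex) \<Rightarrow> partition \<Rightarrow> real" where
  "jack_prob e h V l =
     (cmod (msubst (\<lambda>c. c) (\<lambda>j. V (Suc j)) (jack_poly_norm e h l)))\<^sup>2 *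
     exp (- (1 / h) * suminf (\<lambda>k. (cmod (V (Suc k)))\<^sup>2 / real (Suc k)))"

text \<open>\<^const>\<open>embed_pmf\<close> is meaningful only for nonnegative weights of total mass 1, so statements
  about \<open>jack_measure\<close> rest on \<^const>\<open>jack_prob\<close> being such a weight function.\<close>

definition jack_measure :: "real \<Rightarrow> real \<Rightarrow> (nat \<Rightarrow> complex) \<Rightarrow> partition pmf" where
  "jack_measure e h V = embed_pmf (jack_prob e h V)"

end

theory Submission
  imports Defs "HOL-Computational_Algebra.Polynomial_FPS"
begin

text \<open>The Jack functions of degree \<open>n\<close>, rescaled to the variables \<open>\<rho>\<^sub>k\<close>, form an orthogonal basis of
  the degree \<open>n\<close> part for the Hermitian product, as the power sum monomials do. Hence the sum of
  \<open>\<bar>P\<^bsup>norm\<^esup>(V)\<bar>\<^sup>2\<close> over the partitions of \<open>n\<close> is the reproducing kernel, which in the monomial basis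
  is a Poisson weight: the law of \<open>\<bar>\<lambda>\<bar>\<close> is that of \<open>\<Sum>\<^sub>k k d\<^sub>k\<close> with independent Poisson
  variables \<open>d\<^sub>k\<close> of mean \<open>\<bar>V\<^sub>k\<bar>\<^sup>2 / (\<hbar> k)\<close>, and the expectation follows.

  The existence of the Jack family, for the partial dominance order, comes from an operator that is
  self-adjoint, triangular on monomial functions, and has distinct eigenvalues. It is a
  generic combination of the vacuum moments of the Nazarov--Sklyanin Lax matrix: self-adjointness is
  visible in power sums because multiplication by \<open>p\<^sub>k\<close> is adjoint to \<open>\<alpha> k \<partial>/\<partial>p\<^sub>k\<close>, while in the
  variables \<open>x\<^sub>i\<close> the Lax matrix is the Heckman operator \<open>\<alpha> x\<^sub>0 \<partial>\<^sub>0 + \<Sum>\<^sub>j x\<^sub>0 / (x\<^sub>0 - x\<^sub>j) (1 - s\<^sub>0\<^sub>j)\<close>, which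
  is triangular for dominance.\<close>

text \<open>Gram-Schmidt along a linear order refining dominance would give orthogonality without
  triangularity for dominance itself. The classical second order operator is triangular, but it does
  not separate incomparable partitions: (4,1,1) and (3,3) have equal eigenvalues for every \<alpha>,
  so orthogonality of its eigenvectors cannot be concluded there. Hence the whole hierarchy of
  moments. Encoded in one power series, its eigenvalues amount to the ratio of the products of 1 - X
  (s_i + 1) and of 1 - X s_i with s_i = \<alpha> \<lambda>_i + N - i, parts counted from 1, and this
  ratio determines the partition. In a fixed degree only finitely many pairs are to be separated, so
  one combination with coefficients t^k is enough, for t off a finite set.

  Self-adjointness and triangularity are visible in different coordinates; \<open>expand N\<close>
  connects them, and with N = n + 1 variables it is injective in degree n.

  The parameter \<open>eps_bar\<close> drops out because \<alpha> = h a^2 for a = 1 /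
  (-\<epsilon>_2): the rescaling p_k = a \<rho>_k turns Macdonald's norms into the Hermitian
  ones.\<close>

abbreviation coef :: "('a \<Rightarrow>\<^sub>0 'b::zero) \<Rightarrow> 'a \<Rightarrow> 'b" where
  "coef \<equiv> Poly_Mapping.lookup"

abbreviation supp :: "('a \<Rightarrow>\<^sub>0 'b::zero) \<Rightarrow> 'a set" where
  "supp \<equiv> Poly_Mapping.keys"

abbreviation unit_exp :: "nat \<Rightarrow> nat \<Rightarrow>\<^sub>0 nat" where
  "unit_exp j \<equiv> Poly_Mapping.single j (Suc 0)"

abbreviation mon :: "(nat \<Rightarrow>\<^sub>0 nat) \<Rightarrow> real mpoly" where
  "mon a \<equiv> Poly_Mapping.single a 1"

section \<open>Linear maps between polynomial rings\<close>

lemma mconst_hom: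
  "mconst (0::'a::comm_ring_1) = 0" "mconst (1::'a) = 1" "mconst (a + b::'a) = mconst a + mconst b"
  "mconst (a * b::'a) = mconst a * mconst b" "mconst (- a::'a) = - mconst a"
  "mconst (a - b::'a) = mconst a - mconst b"
  by (auto simp: mconst_def single_add mult_single single_uminus single_diff)

lemma mconst_of_nat: "mconst (of_nat n :: 'a::comm_ring_1) = of_nat n"
  by (simp add: mconst_def)

lemma coef_mconst_mult [simp]:
  fixes f :: "'a::comm_ring_1 mpoly"
  shows "coef (mconst c * f) d = c * coef f d"
proof -
  have "mconst c * f = Poly_Mapping.map ((*) c) f"
    by (simp add: mconst_def mult_map_scale_conv_mult)
  thus ?thesis by (simp add: map.rep_eq when_def)
qed

lemma coef_single: "coef (Poly_Mapping.single a c) b = (if a = b then c else 0)"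
  by (simp add: lookup_single when_def)

lemma supp_mconst_mult: "supp (mconst c * f) \<subseteq> supp (f :: 'a::comm_ring_1 mpoly)"
  by (auto simp: in_keys_iff)

lemma mpoly_eq_sum_superset:
  fixes f :: "'a::comm_ring_1 mpoly"
  assumes "finite S" "supp f \<subseteq> S"
  shows "f = (\<Sum>d\<in>S. mconst (coef f d) * Poly_Mapping.single d 1)"
proof (rule poly_mapping_eqI)
  fix k
  show "coef f k = coef (\<Sum>d\<in>S. mconst (coef f d) * Poly_Mapping.single d 1) k"
    using assms by (auto simp: lookup_sum coef_single if_distrib sum.delta in_keys_iff cong: if_cong)
qed

lemma mpoly_eq_sum:
  fixes f :: "'a::comm_ring_1 mpoly"
  shows "f = (\<Sum>d\<in>supp f. mconst (coef f d) * Poly_Mapping.single d 1)"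
  by (rule mpoly_eq_sum_superset) auto

definition lin :: "(real mpoly \<Rightarrow> real mpoly) \<Rightarrow> bool" where
  "lin T \<longleftrightarrow> (\<forall>f g. T (f + g) = T f + T g) \<and> (\<forall>c f. T (mconst c * f) = mconst c * T f)"

lemma linI:
  assumes "\<And>f g. T (f + g) = T f + T g" "\<And>c f. T (mconst c * f) = mconst c * T f"
  shows "lin T"
  using assms by (simp add: lin_def)

lemma lin_add: "lin T \<Longrightarrow> T (f + g) = T f + T g"
  by (simp add: lin_def)

lemma lin_scale: "lin T \<Longrightarrow> T (mconst c * f) = mconst c * T f"
  by (simp add: lin_def)

lemma lin_zero: "lin T \<Longrightarrow> T 0 = 0"
  using lin_scale[of T 0 0] by (simp add: mconst_hom)

lemma lin_diff: "lin T \<Longrightarrow> T (f - g) = T f - T g"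
  by (metis add_diff_cancel diff_add_cancel lin_add)

lemma lin_sum: "lin T \<Longrightarrow> T (\<Sum>i\<in>A. f i) = (\<Sum>i\<in>A. T (f i))"
  by (induction A rule: infinite_finite_induct) (auto simp: lin_zero lin_add)

named_theorems lin_intros

lemma lin_basic [lin_intros]:
  "lin (\<lambda>f. f)"
  "lin (\<lambda>f. 0)"
  "lin S \<Longrightarrow> lin T \<Longrightarrow> lin (\<lambda>f. S f + T f)"
  "lin S \<Longrightarrow> lin T \<Longrightarrow> lin (\<lambda>f. S f - T f)"
  "lin T \<Longrightarrow> lin (\<lambda>f. g * T f)"
  "lin T \<Longrightarrow> lin (\<lambda>f. T f * g)"
  by (auto intro!: linI simp: lin_add lin_scale distrib_left distrib_right right_diff_distrib
      mult.assoc mult.left_commute)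

lemma lin_comp: "lin S \<Longrightarrow> lin T \<Longrightarrow> lin (\<lambda>f. S (T f))"
  by (simp add: lin_def)

lemma lin_sum_intro [lin_intros]: "(\<And>i. i \<in> A \<Longrightarrow> lin (T i)) \<Longrightarrow> lin (\<lambda>f. \<Sum>i\<in>A. T i f)"
  by (intro linI) (simp_all add: lin_add lin_scale sum.distrib sum_distrib_left cong: sum.cong)

text \<open>Only monomials in the support of \<open>f\<close> are compared, so that a bound on the
  variables of \<open>f\<close> remains available for them, as in
  \<open>euler0_expand\<close>.\<close>

lemma lin_eqI:
  assumes "lin S" "lin T" "\<And>d. d \<in> supp f \<Longrightarrow> S (mon d) = T (mon d)"
  shows "S f = T f"
proof -
  have "S f = S (\<Sum>d\<in>supp f. mconst (coef f d) * mon d)" by (simp flip: mpoly_eq_sum)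
  also have "\<dots> = (\<Sum>d\<in>supp f. mconst (coef f d) * S (mon d))"
    using assms by (simp add: lin_sum lin_scale)
  also have "\<dots> = (\<Sum>d\<in>supp f. mconst (coef f d) * T (mon d))"
    using assms by simp
  also have "\<dots> = T (\<Sum>d\<in>supp f. mconst (coef f d) * mon d)"
    using assms by (simp add: lin_sum lin_scale)
  finally show ?thesis by (simp flip: mpoly_eq_sum)
qed

text \<open>Prescribing values on monomials makes linearity automatic; expansion, derivations,
  exchanges and divided differences all arise in this way.\<close>

definition lin_ext :: "((nat \<Rightarrow>\<^sub>0 nat) \<Rightarrow> real mpoly) \<Rightarrow> real mpoly \<Rightarrow> real mpoly" where
  "lin_ext g f = (\<Sum>d\<in>supp f. mconst (coef f d) * g d)"

lemma lin_ext_superset: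
  "finite S \<Longrightarrow> supp f \<subseteq> S \<Longrightarrow> lin_ext g f = (\<Sum>d\<in>S. mconst (coef f d) * g d)"
  unfolding lin_ext_def by (intro sum.mono_neutral_left) (auto simp: in_keys_iff mconst_hom)

lemma lin_lin_ext: "lin (lin_ext g)"
proof (rule linI)
  fix f h :: "real mpoly" and c
  let ?S = "supp f \<union> supp h"
  have "lin_ext g (f + h) = (\<Sum>d\<in>?S. mconst (coef (f + h) d) * g d)"
    by (rule lin_ext_superset) (auto simp: in_keys_iff lookup_add)
  also have "\<dots> = (\<Sum>d\<in>?S. mconst (coef f d) * g d) + (\<Sum>d\<in>?S. mconst (coef h d) * g d)"
    by (simp add: lookup_add mconst_hom algebra_simps sum.distrib)
  also have "\<dots> = lin_ext g f + lin_ext g h"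
    by (subst (1 2) lin_ext_superset[of ?S]) auto
  finally show "lin_ext g (f + h) = lin_ext g f + lin_ext g h" .
  have "lin_ext g (mconst c * f) = (\<Sum>d\<in>supp f. mconst (coef (mconst c * f) d) * g d)"
    using supp_mconst_mult by (intro lin_ext_superset) auto
  thus "lin_ext g (mconst c * f) = mconst c * lin_ext g f"
    by (simp add: mconst_hom lin_ext_def sum_distrib_left mult.assoc)
qed

lemma lin_ext_mon [simp]: "lin_ext g (mon d) = g d"
  by (simp add: lin_ext_def mconst_hom)

lemma mon_add: "mon (a + b) = mon a * mon b"
  by (simp add: mult_single)

lemma mvar_eq_mon: "mvar j = mon (unit_exp j)"
  by (simp add: mvar_def)

lemma mvar_power: "mvar j ^ k = mon (Poly_Mapping.single j k)"
  by (induction k) (simp_all add: mvar_def mult_single flip: single_add)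

lemma exponent_induct [case_names zero add]:
  fixes d :: "nat \<Rightarrow>\<^sub>0 nat"
  assumes "P 0" "\<And>d j. P d \<Longrightarrow> P (d + unit_exp j)"
  shows "P d"
proof (induction "\<Sum>j\<in>supp d. coef d j" arbitrary: d)
  case 0
  hence "d = 0" by (intro poly_mapping_eqI) (auto simp: in_keys_iff)
  thus ?case using assms by simp
next
  case (Suc n)
  hence "\<exists>j\<in>supp d. coef d j \<noteq> 0" by (metis sum.neutral nat.distinct(1))
  then obtain j where j: "coef d j \<noteq> 0" by auto
  define e where "e = d - unit_exp j"
  have d: "d = e + unit_exp j"
    using j by (intro poly_mapping_eqI) (auto simp: e_def lookup_add lookup_minus coef_single)
  have sub: "supp e \<subseteq> supp d" by (auto simp: e_def in_keys_iff lookup_minus)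
  have "(\<Sum>i\<in>supp d. coef d i) = (\<Sum>i\<in>supp d. coef e i) + (\<Sum>i\<in>supp d. coef (unit_exp j) i)"
    by (simp add: d lookup_add sum.distrib)
  also have "(\<Sum>i\<in>supp d. coef (unit_exp j) i) = 1"
    using j by (simp add: coef_single in_keys_iff)
  also have "(\<Sum>i\<in>supp d. coef e i) = (\<Sum>i\<in>supp e. coef e i)"
    using sub by (intro sum.mono_neutral_right) (auto simp: in_keys_iff)
  finally have "n = (\<Sum>i\<in>supp e. coef e i)" using Suc.hyps(2) by simp
  from Suc.hyps(1)[OF this] show ?case unfolding d by (rule assms(2))
qed

lemma supp_add_exp: "supp (d + e) = supp d \<union> supp (e :: nat \<Rightarrow>\<^sub>0 nat)"
  by (auto simp: in_keys_iff lookup_add)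

section \<open>Expansion in variables\<close>

definition exp_eval :: "(nat \<Rightarrow> 'b::comm_semiring_1) \<Rightarrow> (nat \<Rightarrow>\<^sub>0 nat) \<Rightarrow> 'b" where
  "exp_eval X d = (\<Prod>j\<in>supp d. X j ^ coef d j)"

lemma exp_eval_superset:
  "finite S \<Longrightarrow> supp d \<subseteq> S \<Longrightarrow> exp_eval X d = (\<Prod>j\<in>S. X j ^ coef d j)"
  unfolding exp_eval_def by (intro prod.mono_neutral_left) (auto simp: in_keys_iff)

lemma exp_eval_add: "exp_eval X (d + e) = exp_eval X d * exp_eval X e"
proof -
  have "exp_eval X (d + e) = (\<Prod>j\<in>supp d \<union> supp e. X j ^ coef (d + e) j)"
    by (simp add: exp_eval_def supp_add_exp)
  also have "\<dots> = exp_eval X d * exp_eval X e"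
    by (subst (1 2) exp_eval_superset[of "supp d \<union> supp e"])
       (auto simp: lookup_add power_add prod.distrib)
  finally show ?thesis .
qed

lemma exp_eval_0 [simp]: "exp_eval X 0 = 1"
  by (simp add: exp_eval_def)

lemma exp_eval_unit [simp]: "exp_eval X (unit_exp j) = X j"
  by (simp add: exp_eval_def)

lemma msubst_eq: "msubst c X f = (\<Sum>d\<in>supp f. c (coef f d) * exp_eval X d)"
  by (simp add: msubst_def exp_eval_def)

lemma expand_eq_lin_ext: "expand N = lin_ext (exp_eval (\<lambda>j. power_sum N (Suc j)))"
  by (intro ext) (simp add: expand_def msubst_eq lin_ext_def)

lemma lin_expand: "lin (expand N)"
  by (simp add: expand_eq_lin_ext lin_lin_ext)

lemmas [lin_intros] = lin_expand lin_comp[OF lin_expand]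

lemma expand_mon: "expand N (mon d) = exp_eval (\<lambda>j. power_sum N (Suc j)) d"
  by (simp add: expand_eq_lin_ext)

lemma expand_mult: "expand N (f * g) = expand N f * expand N g"
proof (rule lin_eqI[of "\<lambda>f. expand N (f * g)" "\<lambda>f. expand N f * expand N g"])
  fix d
  show "expand N (mon d * g) = expand N (mon d) * expand N g"
    by (rule lin_eqI[of "\<lambda>g. expand N (mon d * g)" "\<lambda>g. expand N (mon d) * expand N g"])
       (auto intro!: lin_intros simp: expand_mon exp_eval_add simp flip: mon_add)
qed (auto intro!: lin_intros)

lemma expand_mvar: "expand N (mvar j) = power_sum N (Suc j)"
  by (simp add: expand_mon mvar_eq_mon)

lemma power_sum_eq: "power_sum N k = (\<Sum>i<N. mon (Poly_Mapping.single i k))"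
  by (simp add: power_sum_def mvar_power)

section \<open>Derivations, exchanges and divided differences\<close>

text \<open>If the variable is absent, the truncated subtraction leaves the exponent unchanged, and
  the coefficient 0 removes the term.\<close>

definition pder :: "nat \<Rightarrow> real mpoly \<Rightarrow> real mpoly" where
  "pder j = lin_ext (\<lambda>d. mconst (real (coef d j)) * mon (d - unit_exp j))"

definition euler0 :: "real mpoly \<Rightarrow> real mpoly" where
  "euler0 = lin_ext (\<lambda>a. mconst (real (coef a 0)) * mon a)"

lemma lin_pder: "lin (pder j)" and lin_euler0: "lin euler0"
  by (simp_all add: pder_def euler0_def lin_lin_ext)

lemmas [lin_intros] = lin_pder lin_comp[OF lin_pder] lin_euler0 lin_comp[OF lin_euler0]

lemma pder_mon: "pder j (mon d) = mconst (real (coef d j)) * mon (d - unit_exp j)"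
  by (simp add: pder_def)

lemma euler0_mon: "euler0 (mon d) = mconst (real (coef d 0)) * mon d"
  by (simp add: euler0_def)

lemma euler0_mult: "euler0 (f * g) = euler0 f * g + f * euler0 g"
proof (rule lin_eqI[of "\<lambda>f. euler0 (f * g)" "\<lambda>f. euler0 f * g + f * euler0 g"])
  fix d
  show "euler0 (mon d * g) = euler0 (mon d) * g + mon d * euler0 g"
  proof (rule lin_eqI[of "\<lambda>g. euler0 (mon d * g)"])
    fix e
    have "euler0 (mon d * mon e) = mconst (real (coef d 0) + real (coef e 0)) * (mon d * mon e)"
      using euler0_mon[of "d + e"] by (simp only: mon_add lookup_add of_nat_add)
    thus "euler0 (mon d * mon e) = euler0 (mon d) * mon e + mon d * euler0 (mon e)"
      unfolding euler0_mon mconst_hom by (simp only: algebra_simps)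
  qed (auto intro!: lin_intros)
qed (auto intro!: lin_intros)

lemma pder_mon_mvar: "pder i (mon d * mvar j) = pder i (mon d) * mvar j + (if i = j then mon d else 0)"
proof -
  have "pder i (mon d * mvar j) = pder i (mon (d + unit_exp j))"
    by (simp add: mon_add mvar_eq_mon)
  also have "\<dots> = mconst (real (coef d i)) * mon (d + unit_exp j - unit_exp i)
      + mconst (if i = j then 1 else 0) * mon (d + unit_exp j - unit_exp i)"
    by (simp add: pder_mon lookup_add coef_single mconst_hom algebra_simps)
  also have "mconst (real (coef d i)) * mon (d + unit_exp j - unit_exp i) = pder i (mon d) * mvar j"
  proof (cases "coef d i = 0")
    case False
    hence "d + unit_exp j - unit_exp i = d - unit_exp i + unit_exp j"
      by (intro poly_mapping_eqI) (auto simp: lookup_add lookup_minus coef_single)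
    thus ?thesis by (simp add: pder_mon mon_add mvar_eq_mon mult.assoc)
  qed (simp add: pder_mon mconst_hom)
  also have "mconst (if i = j then 1 else 0) * mon (d + unit_exp j - unit_exp i)
      = (if i = j then mon d else 0)"
    by (auto simp: mconst_hom)
  finally show ?thesis .
qed

section \<open>Transpositions of \<open>x\<^sub>0\<close> with another variable\<close>

definition exch_exp :: "nat \<Rightarrow> (nat \<Rightarrow>\<^sub>0 nat) \<Rightarrow> nat \<Rightarrow>\<^sub>0 nat" where
  "exch_exp j a = Poly_Mapping.map_key (Transposition.transpose 0 j) a"

lemma coef_exch_exp [simp]: "coef (exch_exp j a) i = coef a (Transposition.transpose 0 j i)"
  by (simp add: exch_exp_def map_key.rep_eq)

definition exch :: "nat \<Rightarrow> real mpoly \<Rightarrow> real mpoly" where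
  "exch j = lin_ext (\<lambda>a. mon (exch_exp j a))"

lemma lin_exch: "lin (exch j)"
  by (simp add: exch_def lin_lin_ext)

lemmas [lin_intros] = lin_exch lin_comp[OF lin_exch]

lemma exch_mon: "exch j (mon a) = mon (exch_exp j a)"
  by (simp add: exch_def)

lemma exch_exp_add: "exch_exp j (a + b) = exch_exp j a + exch_exp j b"
  by (intro poly_mapping_eqI) (simp add: lookup_add)

lemma exch_exp_exch_exp [simp]: "exch_exp j (exch_exp j a) = a"
  by (intro poly_mapping_eqI) simp

lemma coef_exch: "coef (exch j f) a = coef f (exch_exp j a)"
proof -
  have "exch j f = (\<Sum>d\<in>supp f. mconst (coef f d) * mon (exch_exp j d))"
    by (simp add: exch_def lin_ext_def)
  also have "coef \<dots> a = (\<Sum>d\<in>supp f. if d = exch_exp j a then coef f d else 0)"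
    unfolding lookup_sum by (intro sum.cong) (auto simp: coef_single)
  finally show ?thesis by (simp add: in_keys_iff)
qed

lemma exch_mult: "exch j (f * g) = exch j f * exch j g"
proof (rule lin_eqI[of "\<lambda>f. exch j (f * g)" "\<lambda>f. exch j f * exch j g"])
  fix d
  show "exch j (mon d * g) = exch j (mon d) * exch j g"
    by (rule lin_eqI[of "\<lambda>g. exch j (mon d * g)"])
       (auto intro!: lin_intros simp: exch_mon exch_exp_add simp flip: mon_add)
qed (auto intro!: lin_intros)

lemma exch_exp_single: "exch_exp j (Poly_Mapping.single i k) = Poly_Mapping.single (Transposition.transpose 0 j i) k"
  by (intro poly_mapping_eqI) (auto simp: coef_single Transposition.transpose_def)

lemma exch_power_sum:
  assumes "j < N"
  shows "exch j (power_sum N k) = power_sum N k"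
proof -
  have "exch j (power_sum N k) = (\<Sum>i<N. mon (Poly_Mapping.single (Transposition.transpose 0 j i) k))"
    by (simp add: power_sum_eq lin_sum lin_exch exch_mon exch_exp_single)
  also have "\<dots> = (\<Sum>i<N. mon (Poly_Mapping.single i k))"
    using assms
    by (intro sum.reindex_bij_witness[of _ "Transposition.transpose 0 j" "Transposition.transpose 0 j"]) (auto simp: Transposition.transpose_def)
  finally show ?thesis by (simp add: power_sum_eq)
qed

lemma exch_expand:
  assumes "j < N"
  shows "exch j (expand N f) = expand N f"
proof (rule lin_eqI[of "\<lambda>f. exch j (expand N f)" "expand N"])
  fix d
  show "exch j (expand N (mon d)) = expand N (mon d)"
  proof (induction d rule: exponent_induct)
    case zero
    have "exch_exp j 0 = 0" by (intro poly_mapping_eqI) simp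
    thus ?case using exch_mon[of j 0] by (simp add: expand_mon[of N 0, simplified])
  next
    case (add d i)
    thus ?case using assms
      by (simp add: mon_add expand_mult exch_mult exch_power_sum expand_mon)
  qed
qed (auto intro!: lin_intros)

text \<open>\<open>divdiff j f\<close> is \<open>x\<^sub>0 (f - exch j f) / (x\<^sub>0 - x\<^sub>j)\<close>, written out on monomials.\<close>

definition put :: "nat \<Rightarrow> (nat \<Rightarrow>\<^sub>0 nat) \<Rightarrow> nat \<Rightarrow> nat \<Rightarrow> nat \<Rightarrow>\<^sub>0 nat" where
  "put j a x y = Poly_Mapping.update j y (Poly_Mapping.update 0 x a)"

lemma coef_put: "coef (put j a x y) i = (if i = j then y else if i = 0 then x else coef a i)"
  by (simp add: put_def lookup_update)

definition divdiff :: "nat \<Rightarrow> real mpoly \<Rightarrow> real mpoly" where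
  "divdiff j = lin_ext (\<lambda>a.
     (\<Sum>b\<in>{coef a j<..coef a 0}. mon (put j a b (coef a 0 + coef a j - b)))
     - (\<Sum>b\<in>{coef a 0<..coef a j}. mon (put j a b (coef a 0 + coef a j - b))))"

lemma lin_divdiff: "lin (divdiff j)"
  by (simp add: divdiff_def lin_lin_ext)

lemmas [lin_intros] = lin_divdiff lin_comp[OF lin_divdiff]

lemma divdiff_mon: "divdiff j (mon a) =
     (\<Sum>b\<in>{coef a j<..coef a 0}. mon (put j a b (coef a 0 + coef a j - b)))
     - (\<Sum>b\<in>{coef a 0<..coef a j}. mon (put j a b (coef a 0 + coef a j - b)))"
  by (simp add: divdiff_def)

text \<open>A geometric sum: multiplication by the difference of the two variables raises either
  exponent by one, and neighbouring products cancel. The bound \<open>n \<le> s\<close> keeps the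
  truncated subtractions exact.\<close>

lemma put_telescope:
  assumes "j \<noteq> 0" "s = coef a 0 + coef a j" "m \<le> n" "n \<le> s"
  shows "(mvar 0 - mvar j) * (\<Sum>b\<in>{m<..n}. mon (put j a b (s - b)))
    = mon (put j a (Suc n) (s - n)) - mon (put j a (Suc m) (s - m))"
proof -
  have "(mvar 0 - mvar j) * mon (put j a b (s - b))
      = mon (put j a (Suc b) (s - b)) - mon (put j a b (Suc s - b))" if "b \<in> {m<..n}" for b
  proof -
    have "unit_exp 0 + put j a b (s - b) = put j a (Suc b) (s - b)"
      "unit_exp j + put j a b (s - b) = put j a b (Suc s - b)"
      using that assms by (auto intro!: poly_mapping_eqI simp: lookup_add coef_put coef_single)
    thus ?thesis by (simp add: left_diff_distrib mvar_eq_mon flip: mon_add)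
  qed
  hence "(mvar 0 - mvar j) * (\<Sum>b\<in>{m<..n}. mon (put j a b (s - b)))
     = (\<Sum>b\<in>{m<..n}. mon (put j a (Suc b) (s - b)) - mon (put j a b (Suc s - b)))"
    by (simp add: sum_distrib_left)
  also have "\<dots> = (\<Sum>b\<in>{m<..n}. mon (put j a (Suc b) (Suc s - Suc b)) - mon (put j a b (Suc s - b)))"
    by simp
  also have "\<dots> = (\<Sum>b\<in>{Suc m..<Suc n}. mon (put j a (Suc b) (Suc s - Suc b)) - mon (put j a b (Suc s - b)))"
    by (intro sum.cong) auto
  also have "\<dots> = mon (put j a (Suc n) (Suc s - Suc n)) - mon (put j a (Suc m) (Suc s - Suc m))"
    by (rule sum_Suc_diff') (use assms in auto)
  finally show ?thesis by simp
qed

lemma divdiff_eq: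
  assumes "j \<noteq> 0"
  shows "(mvar 0 - mvar j) * divdiff j f = mvar 0 * (f - exch j f)"
proof (rule lin_eqI[of "\<lambda>f. (mvar 0 - mvar j) * divdiff j f" "\<lambda>f. mvar 0 * (f - exch j f)"])
  fix a :: "nat \<Rightarrow>\<^sub>0 nat"
  let ?s = "coef a 0 + coef a j"
  have 1: "unit_exp 0 + a = put j a (Suc (coef a 0)) (?s - coef a 0)"
    "unit_exp 0 + exch_exp j a = put j a (Suc (coef a j)) (?s - coef a j)"
    using assms by (auto intro!: poly_mapping_eqI simp: lookup_add coef_put coef_single Transposition.transpose_def)
  have "(mvar 0 - mvar j) * divdiff j (mon a)
     = mon (put j a (Suc (coef a 0)) (?s - coef a 0)) - mon (put j a (Suc (coef a j)) (?s - coef a j))"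
  proof (cases "coef a 0 \<le> coef a j")
    case True
    then show ?thesis using put_telescope[OF assms refl, of "coef a 0" "coef a j" a]
      by (simp add: divdiff_mon)
  next
    case False
    then show ?thesis using put_telescope[OF assms refl, of "coef a j" "coef a 0" a]
      by (simp add: divdiff_mon)
  qed
  also have "\<dots> = mvar 0 * (mon a - exch j (mon a))"
    by (simp add: right_diff_distrib exch_mon mvar_eq_mon 1 flip: mon_add)
  finally show "(mvar 0 - mvar j) * divdiff j (mon a) = mvar 0 * (mon a - exch j (mon a))" .
qed (auto intro!: lin_intros)

text \<open>By \<open>divdiff_eq\<close> both sides agree after multiplication by
  \<open>mvar 0 - mvar j\<close>, which is nonzero and can be cancelled.\<close>

lemma divdiff_mult_sym:
  assumes "j \<noteq> 0" "exch j g = g"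
  shows "divdiff j (f * g) = divdiff j f * g"
proof -
  have "(mvar 0 - mvar j) * divdiff j (f * g) = (mvar 0 - mvar j) * (divdiff j f * g)"
    unfolding divdiff_eq[OF assms(1)] mult.assoc[symmetric] exch_mult assms(2)
    by (simp only: algebra_simps)
  moreover have "mvar 0 - mvar j \<noteq> (0 :: real mpoly)"
  proof
    assume "mvar 0 - mvar j = (0 :: real mpoly)"
    hence "coef (mvar 0 :: real mpoly) (unit_exp 0) = coef (mvar j) (unit_exp 0)" by simp
    moreover have "unit_exp j \<noteq> unit_exp 0"
      using assms by (metis lookup_single_eq lookup_single_not_eq nat.distinct(1))
    ultimately show False by (simp add: mvar_def coef_single)
  qed
  ultimately show ?thesis by simp
qed

lemma divdiff_power:
  assumes "j \<noteq> 0"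
  shows "divdiff j (mvar 0 ^ k) = (\<Sum>b\<in>{0<..k}. mvar 0 ^ b * mvar j ^ (k - b))"
proof -
  have "put j (Poly_Mapping.single 0 k) b (k - b) = Poly_Mapping.single 0 b + Poly_Mapping.single j (k - b)" for b
    using assms by (intro poly_mapping_eqI) (auto simp: coef_put lookup_add coef_single)
  thus ?thesis using assms by (simp add: mvar_power divdiff_mon coef_single mon_add)
qed

section \<open>Shapes of exponents and dominance\<close>

text \<open>One weighted degree with several roles. Weight 1 gives the degree of an x-monomial, but
  the number of factors of a power sum monomial; weight \<open>Suc j\<close> gives the degree of the
  latter as a symmetric function; squared weights appear in \<open>sumsq\<close>.\<close>

definition esum :: "(nat \<Rightarrow> nat) \<Rightarrow> (nat \<Rightarrow>\<^sub>0 nat) \<Rightarrow> nat" where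
  "esum w d = (\<Sum>j\<in>supp d. w j * coef d j)"

abbreviation deg :: "(nat \<Rightarrow>\<^sub>0 nat) \<Rightarrow> nat" where
  "deg \<equiv> esum (\<lambda>_. Suc 0)"

abbreviation wt :: "(nat \<Rightarrow>\<^sub>0 nat) \<Rightarrow> nat" where
  "wt \<equiv> esum Suc"

lemma esum_superset: "finite S \<Longrightarrow> supp d \<subseteq> S \<Longrightarrow> esum w d = (\<Sum>j\<in>S. w j * coef d j)"
  unfolding esum_def by (intro sum.mono_neutral_left) (auto simp: in_keys_iff)

lemma esum_add: "esum w (d + e) = esum w d + esum w e"
proof -
  have "esum w (d + e) = (\<Sum>j\<in>supp d \<union> supp e. w j * coef (d + e) j)"
    by (simp add: esum_def supp_add_exp)
  also have "\<dots> = esum w d + esum w e"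
    by (subst (1 2) esum_superset[of "supp d \<union> supp e"])
       (auto simp: lookup_add sum.distrib algebra_simps)
  finally show ?thesis .
qed

lemma esum_0 [simp]: "esum w 0 = 0"
  by (simp add: esum_def)

lemma esum_single [simp]: "esum w (Poly_Mapping.single j k) = w j * k"
  by (simp add: esum_def)

lemma deg_le_wt: "deg d \<le> wt d"
  unfolding esum_def by (intro sum_mono) auto

lemma esum_ge: "j \<in> supp d \<Longrightarrow> w j * coef d j \<le> esum w d"
  unfolding esum_def by (rule member_le_sum) auto

lemma supp_lt_wt: "supp d \<subseteq> {..<wt d}"
proof
  fix j assume j: "j \<in> supp d"
  hence "0 < coef d j" by (auto simp: in_keys_iff)
  hence "Suc j * 1 \<le> Suc j * coef d j" by (intro mult_le_mono2) simp
  with esum_ge[OF j, of Suc] show "j \<in> {..<wt d}" by simp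
qed

lemma finite_exponents: "finite {a. supp a \<subseteq> {..<N} \<and> deg a \<le> n}"
proof (rule finite_imageD)
  let ?f = "\<lambda>a. restrict (coef a) {..<N}"
  have "coef a i \<le> n" if "deg a \<le> n" for a i
    using esum_ge[of i a "\<lambda>_. Suc 0"] that by (cases "i \<in> supp a") (auto simp: in_keys_iff)
  hence "?f ` {a. supp a \<subseteq> {..<N} \<and> deg a \<le> n} \<subseteq> {..<N} \<rightarrow>\<^sub>E {..n}"
    by (auto simp: PiE_def extensional_def)
  thus "finite (?f ` {a. supp a \<subseteq> {..<N} \<and> deg a \<le> n})"
    by (rule finite_subset) (auto intro!: finite_PiE)
  show "inj_on ?f {a. supp a \<subseteq> {..<N} \<and> deg a \<le> n}"
  proof (rule inj_onI, rule poly_mapping_eqI)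
    fix a b i
    assume *: "a \<in> {a. supp a \<subseteq> {..<N} \<and> deg a \<le> n}" "b \<in> {a. supp a \<subseteq> {..<N} \<and> deg a \<le> n}" "?f a = ?f b"
    show "coef a i = coef b i"
    proof (cases "i < N")
      case True
      thus ?thesis using fun_cong[OF *(3), of i] by simp
    next
      case False
      hence "i \<notin> supp a" "i \<notin> supp b" using * by auto
      thus ?thesis by (simp add: in_keys_iff)
    qed
  qed
qed

lemma finite_wt: "finite {d. wt d = n}"
  by (rule finite_subset[OF _ finite_exponents[of n n]])
     (use supp_lt_wt deg_le_wt in auto)

text \<open>The number of parts of size \<open>j + 1\<close> is stored at \<open>j\<close>, so shapes of \<open>x\<close>-exponents are exponents
  of power sum monomials.\<close>

definition shape :: "(nat \<Rightarrow>\<^sub>0 nat) \<Rightarrow> nat \<Rightarrow>\<^sub>0 nat" where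
  "shape a = (\<Sum>i\<in>supp a. unit_exp (coef a i - 1))"

lemma coef_shape: "coef (shape a) j = card {i. coef a i = Suc j}"
proof -
  have "coef (shape a) j = (\<Sum>i\<in>supp a. if coef a i = Suc j then 1 else 0)"
    unfolding shape_def lookup_sum by (intro sum.cong) (auto simp: coef_single in_keys_iff)
  also have "\<dots> = card {i\<in>supp a. coef a i = Suc j}"
    by (subst sum.If_cases) (auto simp: Int_def)
  also have "{i\<in>supp a. coef a i = Suc j} = {i. coef a i = Suc j}"
    by (auto simp: in_keys_iff)
  finally show ?thesis .
qed

lemma esum_sum: "esum w (\<Sum>i\<in>A. f i) = (\<Sum>i\<in>A. esum w (f i))"
  by (induction A rule: infinite_finite_induct) (auto simp: esum_add)

lemma deg_shape: "deg (shape a) = card (supp a)"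
  by (simp add: shape_def esum_sum)

lemma wt_shape: "wt (shape a) = deg a"
proof -
  have "wt (shape a) = (\<Sum>i\<in>supp a. Suc (coef a i - 1))"
    by (simp add: shape_def esum_sum)
  also have "\<dots> = deg a" unfolding esum_def by (intro sum.cong) (auto simp: in_keys_iff)
  finally show ?thesis .
qed

lemma shape_perm:
  assumes "bij \<pi>" "coef a = coef b \<circ> \<pi>"
  shows "shape a = shape b"
proof (rule poly_mapping_eqI)
  fix j
  have "{i. coef b i = Suc j} = \<pi> ` {i. coef a i = Suc j}"
    using assms by (auto simp: image_iff) (metis bij_pointE)
  thus "coef (shape a) j = coef (shape b) j"
    using assms(1) by (simp add: coef_shape card_image bij_def inj_on_def)
qed

text \<open>The shape records the multiplicities of positive values only. Inside a common finite
  window the zeros are equally many as well, so the level sets can be matched one by one; outside,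
  the permutation is the identity.\<close>

lemma shape_eq_perm:
  assumes "shape a = shape b"
  obtains \<pi> where "bij \<pi>" "coef a = coef b \<circ> \<pi>"
proof -
  obtain n where n: "supp a \<union> supp b \<subseteq> {..<n}"
    using finite_nat_iff_bounded[of "supp a \<union> supp b"] by auto
  define A where "A v = {i\<in>{..<n}. coef a i = v}" for v
  define B where "B v = {i\<in>{..<n}. coef b i = v}" for v
  have fin: "finite (A v)" "finite (B v)" for v by (auto simp: A_def B_def)
  have pos: "card (A (Suc j)) = card (B (Suc j))" for j
  proof -
    have "A (Suc j) = {i. coef a i = Suc j}" "B (Suc j) = {i. coef b i = Suc j}"
      using n by (auto simp: A_def B_def in_keys_iff subset_iff)
    thus ?thesis by (metis assms coef_shape)
  qed
  have sz: "card (A 0) = n - card (supp a)" "card (B 0) = n - card (supp b)"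
  proof -
    have "A 0 = {..<n} - supp a" "B 0 = {..<n} - supp b"
      by (auto simp: A_def B_def in_keys_iff)
    thus "card (A 0) = n - card (supp a)" "card (B 0) = n - card (supp b)"
      using n by (simp_all add: card_Diff_subset)
  qed
  have "card (A v) = card (B v)" for v
  proof (cases v)
    case 0
    thus ?thesis using sz assms by (metis deg_shape)
  qed (use pos in auto)
  hence "\<forall>v. \<exists>f. bij_betw f (A v) (B v)" using fin finite_same_card_bij by blast
  then obtain f where f: "\<And>v. bij_betw (f v) (A v) (B v)" by metis
  define \<pi> where "\<pi> i = (if i < n then f (coef a i) i else i)" for i
  have B: "\<pi> i < n \<and> coef b (\<pi> i) = coef a i" if "i < n" for i
  proof -
    have "i \<in> A (coef a i)" using that by (auto simp: A_def)
    hence "f (coef a i) i \<in> B (coef a i)" using f by (auto simp: bij_betw_def)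
    thus ?thesis using that by (auto simp: B_def \<pi>_def)
  qed
  have "inj_on \<pi> {..<n}"
  proof (rule inj_onI)
    fix i j assume ij: "i \<in> {..<n}" "j \<in> {..<n}" "\<pi> i = \<pi> j"
    hence e: "coef a i = coef a j" using B[of i] B[of j] by auto
    hence "i \<in> A (coef a i)" "j \<in> A (coef a i)" "f (coef a i) i = f (coef a i) j"
      using ij by (auto simp: A_def \<pi>_def)
    thus "i = j" using f[of "coef a i"] by (auto simp: bij_betw_def inj_on_def)
  qed
  moreover have "\<pi> ` {..<n} \<subseteq> {..<n}" using B by auto
  ultimately have "\<pi> permutes {..<n}"
    by (intro bij_imp_permutes) (simp_all add: bij_betw_def endo_inj_surj, simp add: \<pi>_def)
  hence "bij \<pi>" by (rule permutes_bij)
  moreover have "coef a = coef b \<circ> \<pi>"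
  proof
    fix i show "coef a i = (coef b \<circ> \<pi>) i"
    proof (cases "i < n")
      case False
      hence "i \<notin> supp a" "i \<notin> supp b" using n by auto
      thus ?thesis using False by (simp add: \<pi>_def in_keys_iff)
    qed (use B in auto)
  qed
  ultimately show ?thesis using that by blast
qed

text \<open>Dominance for unsorted vectors: partial sums of the decreasing rearrangement are
  replaced by sums over arbitrary finite sets of positions. Divided differences produce unsorted
  exponents, and this form avoids sorting them.\<close>

definition dom_le :: "(nat \<Rightarrow>\<^sub>0 nat) \<Rightarrow> (nat \<Rightarrow>\<^sub>0 nat) \<Rightarrow> bool" where
  "dom_le a b \<longleftrightarrow> deg a = deg b \<and>
     (\<forall>S. finite S \<longrightarrow> (\<exists>S'. finite S' \<and> card S' = card S \<and> sum (coef a) S \<le> sum (coef b) S'))"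

lemma dom_le_trans: "dom_le a b \<Longrightarrow> dom_le b c \<Longrightarrow> dom_le a c"
  unfolding dom_le_def by (metis order_trans)

lemma dom_le_shape:
  assumes "shape a = shape b"
  shows "dom_le a b"
proof -
  obtain \<pi> where \<pi>: "bij \<pi>" "coef a = coef b \<circ> \<pi>" using shape_eq_perm[OF assms] .
  have "\<exists>S'. finite S' \<and> card S' = card S \<and> sum (coef a) S \<le> sum (coef b) S'" if "finite S" for S
    using that \<pi> by (intro exI[of _ "\<pi> ` S"]) (auto simp: card_image bij_def inj_on_def sum.reindex)
  moreover have "deg a = deg b" using assms by (metis wt_shape)
  ultimately show ?thesis by (simp add: dom_le_def)
qed

text \<open>The largest element of \<open>S\<close> is at least \<open>card S - 1\<close>, so its
  value is at most the last term of the initial segment; the other elements are covered by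
  induction.\<close>

lemma sum_antimono_le:
  fixes f :: "nat \<Rightarrow> nat"
  assumes "antimono f" "finite S"
  shows "sum f S \<le> sum f {..<card S}"
  using assms(2)
proof (induction "card S" arbitrary: S)
  case 0 thus ?case by simp
next
  case (Suc n)
  define m where "m = Max S"
  have S: "S \<noteq> {}" using Suc by auto
  have m: "m \<in> S" using S Suc by (auto simp: m_def)
  have "S \<subseteq> {..m}" using Suc.prems by (auto simp: m_def)
  hence "card S \<le> Suc m" by (metis card_atMost card_mono finite_atMost)
  hence "n \<le> m" using Suc.hyps by simp
  have c: "card (S - {m}) = n" using m Suc.hyps(2) Suc.prems by simp
  have "sum f S = f m + sum f (S - {m})" using m Suc.prems by (simp add: sum.remove)
  also have "\<dots> \<le> f n + sum f {..<n}"
    using Suc.hyps(1)[of "S - {m}"] Suc.prems c antimonoD[OF assms(1) \<open>n \<le> m\<close>]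
    by (intro add_mono) auto
  also have "\<dots> = sum f {..<card S}" by (simp flip: Suc.hyps(2))
  finally show ?case .
qed

section \<open>Partitions as sorted representatives of shapes\<close>

lemma antimono_parts: "antimono (coef (parts l))"
  using parts[of l] by simp

lemma psize_eq_deg: "psize l = deg (parts l)"
  by (simp add: psize_def esum_def part_def)

lemma dominated_iff: "dominated m l \<longleftrightarrow> dom_le (parts m) (parts l)"
proof
  assume d: "dominated m l"
  show "dom_le (parts m) (parts l)"
    unfolding dom_le_def
  proof (intro conjI allI impI)
    fix S :: "nat set" assume "finite S"
    hence "sum (coef (parts m)) S \<le> sum (coef (parts m)) {..<card S}"
      by (intro sum_antimono_le antimono_parts)
    also have "\<dots> \<le> sum (coef (parts l)) {..<card S}"
      using d by (auto simp: dominated_def part_def)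
    finally show "\<exists>S'. finite S' \<and> card S' = card S \<and> sum (coef (parts m)) S \<le> sum (coef (parts l)) S'"
      by (intro exI[of _ "{..<card S}"]) auto
  qed (use d in \<open>simp add: dominated_def psize_eq_deg\<close>)
next
  assume d: "dom_le (parts m) (parts l)"
  have "(\<Sum>i<n. part m i) \<le> (\<Sum>i<n. part l i)" for n
  proof -
    obtain S' where S': "finite S'" "card S' = n" "sum (coef (parts m)) {..<n} \<le> sum (coef (parts l)) S'"
      using d[unfolded dom_le_def] by (metis card_lessThan finite_lessThan)
    with sum_antimono_le[OF antimono_parts, of S' l] show ?thesis by (simp add: part_def)
  qed
  thus "dominated m l" using d by (simp add: dominated_def psize_eq_deg dom_le_def)
qed

lemma dominated_antisym:
  assumes "dominated m l" "dominated l m"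
  shows "m = l"
proof -
  have "(\<Sum>i<n. part m i) = (\<Sum>i<n. part l i)" for n
    using assms by (auto simp: dominated_def intro: antisym)
  hence "part m n = part l n" for n
    by (metis add_left_cancel sum.lessThan_Suc)
  hence "parts m = parts l" by (intro poly_mapping_eqI) (simp add: part_def)
  thus ?thesis by (simp add: parts_inject)
qed

lemma dominated_trans: "dominated k m \<Longrightarrow> dominated m l \<Longrightarrow> dominated k l"
  unfolding dominated_iff by (rule dom_le_trans)

lemma shape_parts_inj: "shape (parts l) = shape (parts m) \<longleftrightarrow> l = m"
  by (metis dom_le_shape dominated_antisym dominated_iff)

text \<open>Take \<open>coef d j\<close> copies of each \<open>Suc j\<close>, list them in
  decreasing order and pad with zeros.\<close>

lemma ex_partition_shape: "\<exists>l. shape (parts l) = d"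
proof -
  define M where "M = (\<Sum>j\<in>supp d. replicate_mset (coef d j) (Suc j))"
  define xs where "xs = rev (sorted_list_of_multiset M)"
  have cM: "count M (Suc j) = coef d j" for j
  proof -
    have "count M (Suc j) = (\<Sum>i\<in>supp d. if i = j then coef d i else 0)"
      unfolding M_def count_sum by (intro sum.cong) auto
    thus ?thesis by (simp add: in_keys_iff)
  qed
  have nd: "nth_default 0 xs i \<ge> nth_default 0 xs j" if "i \<le> j" for i j
  proof (cases "j < length xs")
    case True
    have "sorted (rev xs)" by (simp add: xs_def)
    hence "rev xs ! (length xs - 1 - j) \<le> rev xs ! (length xs - 1 - i)"
      using that True by (intro sorted_nth_mono) auto
    thus ?thesis using that True by (simp add: nth_default_def rev_nth)
  qed (simp add: nth_default_def)
  have "antimono (coef (Poly_Mapping.nth xs))"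
    using nd by (auto simp: monotone_on_def)
  then obtain l where l: "parts l = Poly_Mapping.nth xs"
    using Abs_partition_inverse by blast
  have "coef (shape (parts l)) j = coef d j" for j
  proof -
    have "{i. coef (parts l) i = Suc j} = {i. i < length xs \<and> Suc j = xs ! i}"
      by (auto simp: l nth_default_def split: if_splits)
    hence "coef (shape (parts l)) j = length (filter ((=) (Suc j)) xs)"
      by (simp add: coef_shape length_filter_conv_card)
    also have "\<dots> = count (mset xs) (Suc j)" by (simp add: count_mset count_list_eq_length_filter)
    finally show ?thesis by (simp add: xs_def cM)
  qed
  thus ?thesis by (intro exI[of _ l] poly_mapping_eqI)
qed

text \<open>The choice is unique by \<open>shape_parts_inj\<close>, so this is the inverse of the
  passage from partitions to shapes.\<close>

definition of_shape :: "(nat \<Rightarrow>\<^sub>0 nat) \<Rightarrow> partition" where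
  "of_shape d = (SOME l. shape (parts l) = d)"

lemma shape_of_shape [simp]: "shape (parts (of_shape d)) = d"
  unfolding of_shape_def by (rule someI_ex) (rule ex_partition_shape)

lemma of_shape_shape [simp]: "of_shape (shape (parts l)) = l"
  by (simp flip: shape_parts_inj)

lemma dom_le_antisym:
  assumes "dom_le a b" "dom_le b a"
  shows "shape a = shape b"
proof -
  let ?l = "of_shape (shape a)" and ?m = "of_shape (shape b)"
  have "dominated ?l ?m" "dominated ?m ?l"
    unfolding dominated_iff
    by (rule dom_le_trans[OF dom_le_trans[OF dom_le_shape assms(1)] dom_le_shape]; simp)
       (rule dom_le_trans[OF dom_le_trans[OF dom_le_shape assms(2)] dom_le_shape]; simp)
  hence "?l = ?m" by (rule dominated_antisym)
  thus ?thesis by (metis shape_of_shape)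
qed

lemma supp_parts: "supp (parts l) \<subseteq> {..<card (supp (parts l))}"
proof
  fix i assume i: "i \<in> supp (parts l)"
  have "{..i} \<subseteq> supp (parts l)"
  proof
    fix j assume "j \<in> {..i}"
    hence "coef (parts l) i \<le> coef (parts l) j" using antimono_parts by (auto dest: antimonoD)
    thus "j \<in> supp (parts l)" using i by (auto simp: in_keys_iff)
  qed
  hence "card {..i} \<le> card (supp (parts l))" by (intro card_mono) auto
  thus "i \<in> {..<card (supp (parts l))}" by simp
qed

lemma card_supp_le_deg: "card (supp a) \<le> deg a"
  by (metis deg_le_wt deg_shape wt_shape)

lemma supp_parts_psize: "supp (parts l) \<subseteq> {..<psize l}"
  using supp_parts[of l] card_supp_le_deg[of "parts l"] by (auto simp: psize_eq_deg)

lemma psize_eq_wt: "psize l = wt (shape (parts l))"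
  by (simp add: psize_eq_deg wt_shape)

lemma psize_of_shape: "psize (of_shape d) = wt d"
  by (simp add: psize_eq_wt)

lemma finite_psize: "finite {l. psize l = n}"
proof (rule finite_subset)
  show "{l. psize l = n} \<subseteq> of_shape ` {d. wt d = n}"
    by (auto simp: image_iff psize_eq_wt) (metis of_shape_shape)
qed (simp add: finite_wt)

lemma finite_dominated: "finite {m. dominated m l}"
  by (rule finite_subset[OF _ finite_psize[of "psize l"]]) (auto simp: dominated_def)

section \<open>Power sums and monomial symmetric functions\<close>

lemma coef_monomial_sym:
  "coef (monomial_sym N l) a = (if supp a \<subseteq> {..<N} \<and> shape a = shape (parts l) then 1 else 0)"
proof -
  let ?A = "{a. supp a \<subseteq> {..<N} \<and> (\<exists>\<pi>. bij \<pi> \<and> coef a = part l \<circ> \<pi>)}"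
  have part: "part l = coef (parts l)" by (simp add: part_def fun_eq_iff)
  have A: "?A = {a. supp a \<subseteq> {..<N} \<and> shape a = shape (parts l)}"
    unfolding part using shape_perm shape_eq_perm by metis
  have "deg a = psize l" if "shape a = shape (parts l)" for a
    using that by (metis psize_eq_wt wt_shape)
  hence "finite ?A"
    unfolding A by (intro finite_subset[OF _ finite_exponents[of N "psize l"]]) auto
  hence "coef (monomial_sym N l) a = (if a \<in> ?A then 1 else 0)"
    by (simp add: monomial_sym_def lookup_sum coef_single sum.delta)
  thus ?thesis unfolding A by simp
qed

lemma coef_mult_mon:
  "coef (f * mon e) a = (if \<forall>i. coef e i \<le> coef a i then coef f (a - e) else 0)"
proof -
  have eq: "d + e = a \<longleftrightarrow> (\<forall>i. coef e i \<le> coef a i) \<and> d = a - e" for d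
    by (auto simp: lookup_add lookup_minus intro!: poly_mapping_eqI)
  have "f * mon e = (\<Sum>d\<in>supp f. mconst (coef f d) * mon d) * mon e"
    by (simp flip: mpoly_eq_sum)
  also have "\<dots> = (\<Sum>d\<in>supp f. mconst (coef f d) * mon (d + e))"
    by (simp only: sum_distrib_right mon_add mult.assoc)
  also have "coef \<dots> a = (\<Sum>d\<in>supp f. if d = a - e then (if \<forall>i. coef e i \<le> coef a i then coef f d else 0) else 0)"
    unfolding lookup_sum by (intro sum.cong refl) (auto simp: coef_single eq)
  finally show ?thesis by (simp add: in_keys_iff)
qed

lemma coef_mult_power_sum:
  "coef (f * power_sum N k) a = (\<Sum>i | i < N \<and> k \<le> coef a i. coef f (a - Poly_Mapping.single i k))"
proof -
  have "coef (f * power_sum N k) a = (\<Sum>i<N. coef (f * mon (Poly_Mapping.single i k)) a)"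
    by (simp add: power_sum_eq sum_distrib_left lookup_sum)
  also have "\<dots> = (\<Sum>i<N. if k \<le> coef a i then coef f (a - Poly_Mapping.single i k) else 0)"
    by (intro sum.cong) (auto simp: coef_mult_mon coef_single)
  also have "\<dots> = (\<Sum>i\<in>{..<N} \<inter> {i. k \<le> coef a i}. coef f (a - Poly_Mapping.single i k))"
    by (simp add: sum.If_cases)
  finally show ?thesis by (simp add: Int_def)
qed

lemma expand_mon_add:
  "expand N (mon (d + unit_exp j)) = expand N (mon d) * power_sum N (Suc j)"
  by (simp add: expand_mon exp_eval_add)

lemma expand_1: "expand N 1 = 1"
  using expand_mon[of N 0] by simp

text \<open>Describes the removal of one power sum factor from an x-monomial. The support shrinks
  only when the whole exponent at \<open>i\<close> is removed, and exactly then the shape loses one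
  part.\<close>

lemma sub_single_cases:
  assumes "Suc j \<le> coef a i"
  defines "a' \<equiv> a - Poly_Mapping.single i (Suc j)"
  shows "supp a = insert i (supp a')" "deg a = deg a' + Suc j"
    "i \<notin> supp a' \<Longrightarrow> shape a = shape a' + unit_exp j" "i \<notin> supp a' \<longleftrightarrow> coef a i = Suc j"
proof -
  have a: "a = a' + Poly_Mapping.single i (Suc j)"
    using assms by (intro poly_mapping_eqI) (auto simp: lookup_add lookup_minus coef_single)
  have "supp a = supp a' \<union> supp (Poly_Mapping.single i (Suc j))"
    by (subst a) (rule supp_add_exp)
  thus s: "supp a = insert i (supp a')" by simp
  show "deg a = deg a' + Suc j" by (subst a) (simp add: esum_add)
  show "i \<notin> supp a' \<longleftrightarrow> coef a i = Suc j"
    using assms(1) by (auto simp: a'_def in_keys_iff lookup_minus)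
  assume i: "i \<notin> supp a'"
  hence "coef a' i = 0" by (simp add: in_keys_iff)
  hence "coef a i = Suc j" by (subst a) (simp add: lookup_add)
  moreover have "coef a k = coef a' k" if "k \<in> supp a'" for k
    using that i by (subst a) (auto simp: lookup_add coef_single)
  ultimately show "shape a = shape a' + unit_exp j"
    using i by (simp add: shape_def s add.commute)
qed

lemma coef_expand_mon_nonneg: "0 \<le> coef (expand N (mon d)) a"
proof (induction d arbitrary: a rule: exponent_induct)
  case zero
  show ?case by (simp add: expand_1 lookup_one when_def)
qed (simp add: expand_mon_add coef_mult_power_sum sum_nonneg)

text \<open>Each power sum factor puts its exponent on one variable, so no more variables occur than
  factors. Equality means that no two factors meet, and then the exponents are the factors
  themselves. This is the triangularity of power sums against monomial functions.\<close>

lemma coef_expand_mon_nz: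
  assumes "coef (expand N (mon d)) a \<noteq> 0"
  shows "supp a \<subseteq> {..<N} \<and> deg a = wt d \<and> card (supp a) \<le> deg d \<and> (card (supp a) = deg d \<longrightarrow> shape a = d)"
  using assms
proof (induction d arbitrary: a rule: exponent_induct)
  case zero
  hence "a = 0" by (simp add: expand_1 lookup_one when_def split: if_splits)
  thus ?case by (simp add: shape_def)
next
  case (add d j)
  let ?a = "\<lambda>i. a - Poly_Mapping.single i (Suc j)"
  obtain i where i: "i < N" "Suc j \<le> coef a i" "coef (expand N (mon d)) (?a i) \<noteq> 0"
    using add.prems unfolding expand_mon_add coef_mult_power_sum
    by (smt (verit) mem_Collect_eq sum.neutral)
  note IH = add.IH[OF i(3)] and s = sub_single_cases[OF i(2)]
  have *: "card (supp a) \<le> Suc (card (supp (?a i)))"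
    by (simp add: s(1) card_insert_if)
  have "i \<notin> supp (?a i) \<and> card (supp (?a i)) = deg d" if "card (supp a) = deg (d + unit_exp j)"
  proof -
    have "card (supp a) = Suc (deg d)" using that by (simp add: esum_add)
    hence "card (supp a) \<noteq> card (supp (?a i))" using IH by auto
    hence "i \<notin> supp (?a i)" using s(1) by (metis insert_absorb)
    thus ?thesis using IH \<open>card (supp a) = Suc (deg d)\<close> s(1) by auto
  qed
  hence "card (supp a) = deg (d + unit_exp j) \<longrightarrow> shape a = d + unit_exp j"
    using IH s(3) by auto
  thus ?case using IH * i s(1,2) by (auto simp: esum_add)
qed

text \<open>All coefficients are nonnegative, so a single positive summand is enough: remove a
  variable whose exponent is exactly the new factor.\<close>

lemma coef_expand_mon_pos:
  assumes "shape a = d" "supp a \<subseteq> {..<N}"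
  shows "0 < coef (expand N (mon d)) a"
  using assms
proof (induction d arbitrary: a rule: exponent_induct)
  case zero
  have "card (supp a) = 0" using zero(1) by (metis deg_shape esum_0)
  hence "a = 0" by (intro poly_mapping_eqI) (auto simp: in_keys_iff)
  thus ?case by (simp add: expand_1)
next
  case (add d j)
  let ?a = "\<lambda>i. a - Poly_Mapping.single i (Suc j)"
  have "coef (shape a) j \<noteq> 0" using add.prems by (simp add: lookup_add)
  then obtain i where i: "coef a i = Suc j"
    unfolding coef_shape by (metis (mono_tags, lifting) Collect_empty_eq card.empty)
  note s = sub_single_cases[of j a i]
  have sh: "shape (?a i) = d" "supp (?a i) \<subseteq> {..<N}" "i < N"
    using s i add.prems by (auto simp: in_keys_iff)
  have "0 < coef (expand N (mon d)) (?a i)" using sh by (intro add.IH)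
  also have "\<dots> \<le> (\<Sum>i | i < N \<and> Suc j \<le> coef a i. coef (expand N (mon d)) (?a i))"
    using i sh by (intro member_le_sum) (auto simp: coef_expand_mon_nonneg)
  finally show ?case by (simp add: expand_mon_add coef_mult_power_sum)
qed

text \<open>Symmetry and stability in one statement: the numbers of variables on the two sides may
  differ as long as the supports fit.\<close>

lemma coef_expand_mon_perm:
  assumes "bij \<pi>" "coef a = coef b \<circ> \<pi>" "supp a \<subseteq> {..<N}" "supp b \<subseteq> {..<M}"
  shows "coef (expand N (mon d)) a = coef (expand M (mon d)) b"
  using assms(2-)
proof (induction d arbitrary: a b rule: exponent_induct)
  case zero
  have "a = 0 \<longleftrightarrow> b = 0"
    using zero(1) assms(1) by (auto simp: poly_mapping_eq_iff fun_eq_iff) (metis bij_pointE)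
  thus ?case by (auto simp: expand_1 lookup_one when_def)
next
  case (add d j)
  let ?s = "\<lambda>i. Poly_Mapping.single i (Suc j)"
  have inj: "inj \<pi>" using assms(1) by (simp add: bij_def)
  have "{i. i < M \<and> Suc j \<le> coef b i} = \<pi> ` {i. i < N \<and> Suc j \<le> coef a i}"
  proof (intro equalityI subsetI)
    fix i assume i: "i \<in> {i. i < M \<and> Suc j \<le> coef b i}"
    obtain k where k: "i = \<pi> k" using assms(1) by (metis bij_pointE)
    hence "coef a k = coef b i" using add.prems by simp
    moreover from this have "k < N" using i add.prems(2) by (auto simp: in_keys_iff subset_iff)
    ultimately show "i \<in> \<pi> ` {i. i < N \<and> Suc j \<le> coef a i}" using i k by auto
  next
    fix i assume "i \<in> \<pi> ` {i. i < N \<and> Suc j \<le> coef a i}"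
    then obtain k where k: "i = \<pi> k" "Suc j \<le> coef a k" by auto
    hence "coef b i = coef a k" using add.prems by simp
    thus "i \<in> {i. i < M \<and> Suc j \<le> coef b i}" using k add.prems(3) by (auto simp: in_keys_iff subset_iff)
  qed
  hence "(\<Sum>i | i < M \<and> Suc j \<le> coef b i. coef (expand M (mon d)) (b - ?s i))
    = (\<Sum>i | i < N \<and> Suc j \<le> coef a i. coef (expand M (mon d)) (b - ?s (\<pi> i)))"
    using inj by (simp add: sum.reindex inj_on_def)
  also have "\<dots> = (\<Sum>i | i < N \<and> Suc j \<le> coef a i. coef (expand N (mon d)) (a - ?s i))"
  proof (intro sum.cong refl)
    fix i
    have "coef (a - ?s i) = coef (b - ?s (\<pi> i)) \<circ> \<pi>"
      using add.prems(1) inj by (auto simp: fun_eq_iff lookup_minus coef_single inj_eq)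
    moreover have "supp (a - ?s i) \<subseteq> {..<N}" "supp (b - ?s (\<pi> i)) \<subseteq> {..<M}"
      using add.prems by (auto simp: in_keys_iff lookup_minus subset_iff)
    ultimately show "coef (expand M (mon d)) (b - ?s (\<pi> i)) = coef (expand N (mon d)) (a - ?s i)"
      using add.IH by metis
  qed
  finally show ?case by (simp add: expand_mon_add coef_mult_power_sum)
qed

lemma coef_expand: "coef (expand N f) a = (\<Sum>d\<in>supp f. coef f d * coef (expand N (mon d)) a)"
  by (simp add: expand_eq_lin_ext lin_ext_def lookup_sum)

lemma coef_expand_shape:
  assumes "shape a = shape b" "supp a \<subseteq> {..<N}" "supp b \<subseteq> {..<M}"
  shows "coef (expand N f) a = coef (expand M f) b"
proof -
  obtain \<pi> where "bij \<pi>" "coef a = coef b \<circ> \<pi>" using shape_eq_perm[OF assms(1)] .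
  hence "coef (expand N (mon d)) a = coef (expand M (mon d)) b" for d
    using assms(2,3) by (rule coef_expand_mon_perm)
  thus ?thesis unfolding coef_expand[of N f] coef_expand[of M f] by simp
qed

definition homog :: "nat \<Rightarrow> real mpoly \<Rightarrow> bool" where
  "homog n f \<longleftrightarrow> (\<forall>d\<in>supp f. wt d = n)"

lemma coef_expand_nz:
  assumes "coef (expand N f) a \<noteq> 0" "homog n f"
  shows "supp a \<subseteq> {..<N} \<and> deg a = n"
proof -
  obtain d where d: "d \<in> supp f" "coef f d * coef (expand N (mon d)) a \<noteq> 0"
    using assms(1) unfolding coef_expand[of N f] by (rule sum.not_neutral_contains_not_neutral)
  hence "coef (expand N (mon d)) a \<noteq> 0" by simp
  from coef_expand_mon_nz[OF this] d(1) assms(2) show ?thesis by (simp add: homog_def)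
qed

text \<open>The coefficients are read off in \<open>M\<close> variables, where every partition of
  \<open>n\<close> fits, and so do not depend on \<open>N\<close>. For small \<open>N\<close> the
  surplus monomial functions vanish.\<close>

lemma expand_eq_sum_monomial_sym:
  assumes "homog n f" "M \<ge> n"
  shows "expand N f = (\<Sum>l | psize l = n. mconst (coef (expand M f) (parts l)) * monomial_sym N l)"
proof (rule poly_mapping_eqI)
  fix a
  have e: "shape a = shape (parts l) \<longleftrightarrow> l = of_shape (shape a)" for l
    by (metis shape_of_shape of_shape_shape)
  have *: "coef (\<Sum>l | psize l = n. mconst (coef (expand M f) (parts l)) * monomial_sym N l) a
    = (\<Sum>l | psize l = n. if l = of_shape (shape a) then
         (if supp a \<subseteq> {..<N} then coef (expand M f) (parts l) else 0) else 0)"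
    unfolding lookup_sum
    by (intro sum.cong refl) (auto simp: coef_monomial_sym e)
  have "coef (expand N f) a = (if deg a = n \<and> supp a \<subseteq> {..<N} then coef (expand M f) (parts (of_shape (shape a))) else 0)"
  proof (cases "deg a = n \<and> supp a \<subseteq> {..<N}")
    case True
    have "supp (parts (of_shape (shape a))) \<subseteq> {..<M}"
      using supp_parts_psize[of "of_shape (shape a)"] True assms by (auto simp: psize_of_shape wt_shape)
    thus ?thesis using True coef_expand_shape[of a "parts (of_shape (shape a))" N M f] by simp
  next
    case False
    thus ?thesis using coef_expand_nz[OF _ assms(1), of N a] by auto
  qed
  also have "\<dots> = coef (\<Sum>l | psize l = n. mconst (coef (expand M f) (parts l)) * monomial_sym N l) a"
    unfolding * by (subst sum.delta) (simp_all add: finite_psize psize_of_shape wt_shape)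
  finally show "coef (expand N f) a = coef (\<Sum>l | psize l = n. mconst (coef (expand M f) (parts l)) * monomial_sym N l) a" .
qed

text \<open>Choose \<open>d\<close> in the support with the most factors. At an exponent of shape
  \<open>d\<close> every other monomial of \<open>f\<close> contributes 0 by
  \<open>coef_expand_mon_nz\<close>, so the coefficient of \<open>d\<close> must vanish. The bound
  on weights ensures that such an exponent fits into \<open>N\<close> variables.\<close>

lemma expand_eq_0D:
  assumes "expand N f = 0" "\<And>d. d \<in> supp f \<Longrightarrow> wt d \<le> N"
  shows "f = 0"
proof (rule ccontr)
  assume "f \<noteq> 0"
  hence ne: "deg ` supp f \<noteq> {}" by simp
  have "Max (deg ` supp f) \<in> deg ` supp f" by (rule Max_in) (use ne in auto)
  then obtain d where d: "d \<in> supp f" "Max (deg ` supp f) = deg d" by auto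
  hence d: "d \<in> supp f" "\<And>e. e \<in> supp f \<Longrightarrow> deg e \<le> deg d"
    by (metis Max_ge finite_imageI finite_keys image_eqI)+
  let ?a = "parts (of_shape d)"
  have c: "card (supp ?a) = deg d" by (metis deg_shape shape_of_shape)
  have sa: "supp ?a \<subseteq> {..<N}"
    using supp_parts_psize[of "of_shape d"] assms(2)[OF d(1)] by (auto simp: psize_of_shape)
  have "coef (expand N (mon e)) ?a = 0" if "e \<in> supp f" "e \<noteq> d" for e
    using coef_expand_mon_nz[of N e ?a] d(2)[OF that(1)] that(2) c by auto
  hence "coef (expand N f) ?a = (\<Sum>e\<in>supp f. if e = d then coef f d * coef (expand N (mon d)) ?a else 0)"
    unfolding coef_expand[of N f] by (intro sum.cong) auto
  also have "\<dots> = coef f d * coef (expand N (mon d)) ?a" using d by simp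
  finally have "coef f d * coef (expand N (mon d)) ?a = 0" using assms(1) by simp
  moreover have "0 < coef (expand N (mon d)) ?a" using sa by (intro coef_expand_mon_pos) auto
  ultimately show False using d(1) by (auto simp: in_keys_iff)
qed

lemma expand_inj:
  assumes "\<And>N. expand N f = expand N g"
  shows "f = g"
proof -
  have "finite (wt ` supp (f - g))" by simp
  then obtain N where "\<And>d. d \<in> supp (f - g) \<Longrightarrow> wt d \<le> N"
    by (metis finite_nat_set_iff_bounded_le imageI)
  moreover have "expand N (f - g) = 0" using assms by (simp add: lin_diff lin_expand)
  ultimately have "f - g = 0" by (rule expand_eq_0D[rotated])
  thus ?thesis by simp
qed

section \<open>Homogeneous elements and monomial functions in the power sum ring\<close>

lemma homog_mon: "wt d = n \<Longrightarrow> homog n (mon d)"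
  by (simp add: homog_def)

lemma homog_add: "homog n f \<Longrightarrow> homog n g \<Longrightarrow> homog n (f + g)"
  unfolding homog_def using keys_add[of f g] by auto

lemma homog_scale: "homog n f \<Longrightarrow> homog n (mconst c * f)"
  unfolding homog_def using supp_mconst_mult by auto

lemma homog_0 [simp]: "homog n 0"
  by (simp add: homog_def)

lemma homog_sum: "(\<And>i. i \<in> A \<Longrightarrow> homog n (f i)) \<Longrightarrow> homog n (\<Sum>i\<in>A. f i)"
  by (induction A rule: infinite_finite_induct) (auto intro: homog_add)

lemma homog_diff: "homog n f \<Longrightarrow> homog n g \<Longrightarrow> homog n (f - g)"
  unfolding homog_def using keys_diff[of f g] by auto

text \<open>Inverts the triangular relation by induction on the number of parts: the power sum
  monomial of shape \<open>l\<close> contains the monomial function of \<open>l\<close> with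
  positive coefficient, and otherwise only those of partitions with fewer parts.\<close>

lemma ex_monomial_symmetric_function:
  "\<exists>f. homog (psize l) f \<and> (\<forall>N. expand N f = monomial_sym N l)"
proof (induction "card (supp (parts l))" arbitrary: l rule: less_induct)
  case less
  let ?n = "psize l" and ?d = "shape (parts l)"
  define c where "c m = coef (expand ?n (mon ?d)) (parts m)" for m
  have hd: "homog ?n (mon ?d)" by (intro homog_mon) (simp add: psize_eq_wt)
  define A where "A = {m. psize m = ?n \<and> m \<noteq> l \<and> c m \<noteq> 0}"
  have "finite A" by (rule finite_subset[OF _ finite_psize[of ?n]]) (auto simp: A_def)
  have "card (supp (parts m)) < card (supp (parts l))" if "m \<in> A" for m
  proof -
    have "card (supp (parts m)) \<le> deg ?d \<and> (card (supp (parts m)) = deg ?d \<longrightarrow> shape (parts m) = ?d)"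
      using that coef_expand_mon_nz[of ?n ?d "parts m"] by (auto simp: A_def c_def)
    thus ?thesis using that by (auto simp: A_def deg_shape shape_parts_inj)
  qed
  with less have "\<forall>m\<in>A. \<exists>f. homog ?n f \<and> (\<forall>N. expand N f = monomial_sym N m)"
    by (fastforce simp: A_def)
  then obtain F where F: "\<And>m. m \<in> A \<Longrightarrow> homog ?n (F m)" "\<And>m N. m \<in> A \<Longrightarrow> expand N (F m) = monomial_sym N m"
    by metis
  have cl: "c l > 0"
    unfolding c_def by (intro coef_expand_mon_pos) (use supp_parts_psize in auto)
  define f where "f = mconst (1 / c l) * (mon ?d - (\<Sum>m\<in>A. mconst (c m) * F m))"
  have "expand N f = monomial_sym N l" for N
  proof -
    have "expand N (mon ?d) = (\<Sum>m | psize m = ?n. mconst (c m) * monomial_sym N m)"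
      unfolding c_def by (rule expand_eq_sum_monomial_sym[OF hd order.refl])
    also have "\<dots> = (\<Sum>m\<in>insert l A. mconst (c m) * monomial_sym N m)"
      using finite_psize by (intro sum.mono_neutral_right) (auto simp: A_def mconst_hom)
    also have "\<dots> = mconst (c l) * monomial_sym N l + (\<Sum>m\<in>A. mconst (c m) * monomial_sym N m)"
      using \<open>finite A\<close> by (subst sum.insert) (auto simp: A_def)
    finally have "expand N f = mconst (1 / c l) * (mconst (c l) * monomial_sym N l)"
      unfolding f_def using F(2) by (simp add: lin_diff lin_expand lin_scale lin_sum)
    also have "\<dots> = mconst (1 / c l * c l) * monomial_sym N l"
      by (simp only: mconst_hom mult.assoc)
    finally show ?thesis using cl by (simp add: mconst_hom)
  qed
  moreover have "homog ?n f"
    unfolding f_def using F(1) by (intro homog_scale homog_diff hd homog_sum) auto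
  ultimately show ?case by blast
qed

text \<open>The monomial functions as elements of the power sum ring, free of the number of
  variables; \<open>expand_inj\<close> makes the choice unique.\<close>

definition msym :: "partition \<Rightarrow> real mpoly" where
  "msym l = (SOME f. homog (psize l) f \<and> (\<forall>N. expand N f = monomial_sym N l))"

lemma homog_msym: "homog (psize l) (msym l)" and expand_msym: "expand N (msym l) = monomial_sym N l"
  using someI_ex[OF ex_monomial_symmetric_function[of l]] by (auto simp: msym_def)

lemma eq_sum_msym:
  assumes "homog n f" "N \<ge> n"
  shows "f = (\<Sum>l | psize l = n. mconst (coef (expand N f) (parts l)) * msym l)"
proof (rule expand_inj)
  fix M
  show "expand M f = expand M (\<Sum>l | psize l = n. mconst (coef (expand N f) (parts l)) * msym l)"
    unfolding lin_sum[OF lin_expand] lin_scale[OF lin_expand] expand_msym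
    by (rule expand_eq_sum_monomial_sym[OF assms])
qed

section \<open>The scalar product\<close>

lemma mform_superset:
  assumes "finite S" "supp f \<inter> supp g \<subseteq> S"
  shows "macdonald_form \<alpha> f g = (\<Sum>d\<in>S. coef f d * coef g d * mon_norm \<alpha> d)"
proof -
  have "(\<Sum>d\<in>S. coef f d * coef g d * mon_norm \<alpha> d)
    = (\<Sum>d\<in>supp f \<inter> supp g. coef f d * coef g d * mon_norm \<alpha> d)"
    using assms by (intro sum.mono_neutral_right) (auto simp: in_keys_iff)
  also have "\<dots> = macdonald_form \<alpha> f g"
    unfolding macdonald_form_def by (intro sum.mono_neutral_left) (auto simp: in_keys_iff)
  finally show ?thesis by simp
qed

lemma mform_sym: "macdonald_form \<alpha> f g = macdonald_form \<alpha> g f"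
  using mform_superset[of "supp f \<union> supp g" f g \<alpha>] mform_superset[of "supp f \<union> supp g" g f \<alpha>]
  by (simp add: le_infI1 mult.commute mult.left_commute)

lemma mform_add: "macdonald_form \<alpha> f (g + h) = macdonald_form \<alpha> f g + macdonald_form \<alpha> f h"
  unfolding macdonald_form_def by (simp add: lookup_add algebra_simps sum.distrib)

lemma mform_scale: "macdonald_form \<alpha> f (mconst c * g) = c * macdonald_form \<alpha> f g"
  unfolding macdonald_form_def coef_mconst_mult sum_distrib_left
  by (intro sum.cong refl) (simp only: mult_ac)

lemma mform_0: "macdonald_form \<alpha> f 0 = 0"
  by (simp add: macdonald_form_def)

lemma mform_sum: "macdonald_form \<alpha> f (\<Sum>i\<in>A. g i) = (\<Sum>i\<in>A. macdonald_form \<alpha> f (g i))"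
  by (induction A rule: infinite_finite_induct) (simp_all add: mform_0 mform_add)

lemma mform_diff: "macdonald_form \<alpha> f (g - h) = macdonald_form \<alpha> f g - macdonald_form \<alpha> f h"
  using mform_add[of \<alpha> f "g - h" h] by simp

lemma mform_sum_left: "macdonald_form \<alpha> (\<Sum>i\<in>A. g i) f = (\<Sum>i\<in>A. macdonald_form \<alpha> (g i) f)"
  unfolding mform_sym[of _ _ f] by (rule mform_sum)

lemma mon_norm_superset:
  "finite S \<Longrightarrow> supp d \<subseteq> S \<Longrightarrow>
   mon_norm c d = (\<Prod>j\<in>S. (c * real (Suc j)) ^ coef d j * fact (coef d j))"
  unfolding mon_norm_def by (intro prod.mono_neutral_left) (auto simp: in_keys_iff)

lemma mon_norm_add_unit:
  "mon_norm c (d + unit_exp j) = c * real (Suc j) * real (Suc (coef d j)) * mon_norm c d"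
proof -
  define S where "S = insert j (supp d)"
  have S: "finite S" "j \<in> S" by (auto simp: S_def)
  let ?t = "\<lambda>d i. (c * real (Suc i)) ^ coef d i * fact (coef d i) :: real"
  have "mon_norm c (d + unit_exp j) = (\<Prod>i\<in>S. ?t (d + unit_exp j) i)"
    by (intro mon_norm_superset) (auto simp: S_def supp_add_exp)
  also have "\<dots> = ?t (d + unit_exp j) j * (\<Prod>i\<in>S - {j}. ?t (d + unit_exp j) i)"
    using S by (rule prod.remove)
  also have "(\<Prod>i\<in>S - {j}. ?t (d + unit_exp j) i) = (\<Prod>i\<in>S - {j}. ?t d i)"
    by (intro prod.cong) (auto simp: lookup_add coef_single)
  also have "?t (d + unit_exp j) j = c * real (Suc j) * real (Suc (coef d j)) * ?t d j"
    by (simp add: lookup_add)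
  also have "\<dots> * (\<Prod>i\<in>S - {j}. ?t d i) = c * real (Suc j) * real (Suc (coef d j)) * (\<Prod>i\<in>S. ?t d i)"
    using S by (simp add: prod.remove)
  also have "(\<Prod>i\<in>S. ?t d i) = mon_norm c d"
    by (intro mon_norm_superset[symmetric]) (auto simp: S_def)
  finally show ?thesis .
qed

lemma mon_norm_pos: "c > 0 \<Longrightarrow> mon_norm c d > 0"
  unfolding mon_norm_def by (intro prod_pos) auto

lemma mform_pos:
  assumes "\<alpha> > 0" "f \<noteq> 0"
  shows "macdonald_form \<alpha> f f > 0"
proof -
  have "supp f \<noteq> {}" using assms by simp
  thus ?thesis unfolding macdonald_form_def
    using assms by (intro sum_pos) (auto simp: in_keys_iff mon_norm_pos zero_less_mult_iff)
qed

lemma coef_pder: "coef (pder j g) d = real (Suc (coef d j)) * coef g (d + unit_exp j)"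
proof -
  have eq: "real (coef a j) * coef g a * coef (mon (a - unit_exp j)) d
     = (if a = d + unit_exp j then real (Suc (coef d j)) * coef g (d + unit_exp j) else 0)" for a
  proof (cases "coef a j = 0")
    case True
    hence "a \<noteq> d + unit_exp j" by (auto simp: lookup_add)
    with True show ?thesis by simp
  next
    case False
    hence "a - unit_exp j = d \<longleftrightarrow> a = d + unit_exp j"
      by (auto simp: lookup_add lookup_minus coef_single intro!: poly_mapping_eqI)
    thus ?thesis using False by (auto simp: coef_single lookup_add)
  qed
  have "coef (pder j g) d = (\<Sum>a\<in>supp g. real (coef a j) * coef g a * coef (mon (a - unit_exp j)) d)"
    by (simp add: pder_def lin_ext_def lookup_sum mult_ac)
  thus ?thesis unfolding eq by (simp add: in_keys_iff)
qed

text \<open>Raising the exponent of the variable by one multiplies the norm by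
  \<open>\<alpha> * Suc j\<close> times the new exponent, and the new exponent is the factor that
  differentiation produces.\<close>

lemma mform_mvar:
  "macdonald_form \<alpha> (mvar j * f) g = macdonald_form \<alpha> f (mconst (\<alpha> * real (Suc j)) * pder j g)"
proof -
  let ?sh = "\<lambda>d. d + unit_exp j"
  have inj: "inj_on ?sh (supp f)" by (auto intro!: inj_onI)
  have c: "coef (mvar j * f) (?sh d) = coef f d" for d
    using coef_mult_mon[of f "unit_exp j" "?sh d"]
    by (auto simp: mult.commute mvar_eq_mon lookup_add)
  have "supp (mvar j * f) \<subseteq> ?sh ` supp f"
  proof
    fix a assume "a \<in> supp (mvar j * f)"
    hence *: "\<forall>i. coef (unit_exp j) i \<le> coef a i" "coef f (a - unit_exp j) \<noteq> 0"
      using coef_mult_mon[of f "unit_exp j" a]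
      by (auto simp: mult.commute mvar_eq_mon in_keys_iff split: if_splits)
    hence "a = ?sh (a - unit_exp j)"
      by (intro poly_mapping_eqI) (auto simp: lookup_add lookup_minus)
    with * show "a \<in> ?sh ` supp f" by (auto simp: in_keys_iff)
  qed
  hence "macdonald_form \<alpha> (mvar j * f) g
      = (\<Sum>a\<in>?sh ` supp f. coef (mvar j * f) a * coef g a * mon_norm \<alpha> a)"
    by (intro mform_superset) auto
  also have "\<dots> = (\<Sum>d\<in>supp f. coef f d * coef g (?sh d) * mon_norm \<alpha> (?sh d))"
    using inj by (simp add: sum.reindex c)
  also have "\<dots> = macdonald_form \<alpha> f (mconst (\<alpha> * real (Suc j)) * pder j g)"
    unfolding macdonald_form_def coef_mconst_mult coef_pder mon_norm_add_unit
    by (intro sum.cong refl) (simp only: mult_ac)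
  finally show ?thesis .
qed

section \<open>The Lax matrix and its self-adjoint vacuum moments\<close>

text \<open>The Nazarov--Sklyanin Lax matrix, truncated to the indices \<open>1, \<dots>, n\<close> and without its vacuum row
  and column. On a vector of coefficients of powers of \<open>x\<^sub>0\<close> it is the Heckman operator of \<open>N\<close>
  variables, see \<open>heck_xvec\<close>; the term \<open>real N\<close> on the diagonal makes this exact.\<close>

definition lax_entry :: "real \<Rightarrow> nat \<Rightarrow> nat \<Rightarrow> nat \<Rightarrow> real mpoly \<Rightarrow> real mpoly" where
  "lax_entry \<alpha> N m l f =
     (if m < l then mvar (l - m - 1) * f
      else if l < m then mconst (\<alpha> * real (m - l)) * pder (m - l - 1) f
      else mconst ((\<alpha> - 1) * real m + real N) * f)"

definition lax :: "real \<Rightarrow> nat \<Rightarrow> nat \<Rightarrow> (nat \<Rightarrow> real mpoly) \<Rightarrow> nat \<Rightarrow> real mpoly" where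
  "lax \<alpha> N n F m = (\<Sum>l\<in>{1..n}. lax_entry \<alpha> N m l (F l))"

text \<open>The vacuum column of the Lax matrix: entry \<open>m\<close> is adjoint to multiplication
  by the power sum of index m, the entry of the vacuum row.\<close>

definition lax_source :: "real \<Rightarrow> real mpoly \<Rightarrow> nat \<Rightarrow> real mpoly" where
  "lax_source \<alpha> f m = mconst (\<alpha> * real m) * pder (m - 1) f"

text \<open>Vacuum row, \<open>k\<close> steps with the reduced matrix, vacuum column: the
  excursions from the vacuum to itself that avoid it in between.\<close>

definition lax_op :: "real \<Rightarrow> nat \<Rightarrow> nat \<Rightarrow> nat \<Rightarrow> real mpoly \<Rightarrow> real mpoly" where
  "lax_op \<alpha> N n k f = (\<Sum>m\<in>{1..n}. mvar (m - 1) * (lax \<alpha> N n ^^ k) (lax_source \<alpha> f) m)"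

lemma lax_entry_adjoint:
  "macdonald_form \<alpha> (lax_entry \<alpha> N m l f) g = macdonald_form \<alpha> f (lax_entry \<alpha> N l m g)"
proof -
  consider "m < l" | "l < m" | "m = l" by linarith
  thus ?thesis
  proof cases
    case 1
    thus ?thesis using mform_mvar[of \<alpha> "l - m - 1" f g] by (simp add: lax_entry_def)
  next
    case 2
    thus ?thesis using mform_mvar[of \<alpha> "m - l - 1" g f]
      by (simp add: lax_entry_def mform_sym)
  next
    case 3
    thus ?thesis
      using mform_scale[of \<alpha> f _ g] mform_scale[of \<alpha> g _ f] by (simp add: lax_entry_def mform_sym[of _ _ g])
  qed
qed

definition vform :: "real \<Rightarrow> nat \<Rightarrow> (nat \<Rightarrow> real mpoly) \<Rightarrow> (nat \<Rightarrow> real mpoly) \<Rightarrow> real" where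
  "vform \<alpha> n F G = (\<Sum>m\<in>{1..n}. macdonald_form \<alpha> (F m) (G m))"

lemma lax_adjoint: "vform \<alpha> n (lax \<alpha> N n F) G = vform \<alpha> n F (lax \<alpha> N n G)"
proof -
  have "vform \<alpha> n (lax \<alpha> N n F) G
    = (\<Sum>m\<in>{1..n}. \<Sum>l\<in>{1..n}. macdonald_form \<alpha> (F l) (lax_entry \<alpha> N l m (G m)))"
    by (simp add: vform_def lax_def mform_sum_left lax_entry_adjoint)
  also have "\<dots> = (\<Sum>l\<in>{1..n}. \<Sum>m\<in>{1..n}. macdonald_form \<alpha> (F l) (lax_entry \<alpha> N l m (G m)))"
    by (rule sum.swap)
  also have "\<dots> = vform \<alpha> n F (lax \<alpha> N n G)"
    by (simp add: vform_def lax_def mform_sum)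
  finally show ?thesis .
qed

lemma lax_pow_adjoint: "vform \<alpha> n ((lax \<alpha> N n ^^ k) F) G = vform \<alpha> n F ((lax \<alpha> N n ^^ k) G)"
proof (induction k arbitrary: F)
  case (Suc k)
  have "vform \<alpha> n ((lax \<alpha> N n ^^ Suc k) F) G = vform \<alpha> n ((lax \<alpha> N n ^^ k) (lax \<alpha> N n F)) G"
    by (simp only: funpow_Suc_right o_apply)
  thus ?case using Suc by (simp add: lax_adjoint)
qed simp

text \<open>Moving the vacuum row across the form turns it into the vacuum column applied to
  \<open>g\<close>. The right side is symmetric in \<open>f\<close> and \<open>g\<close> because the
  reduced matrix is self-adjoint.\<close>

lemma mform_lax_op:
  "macdonald_form \<alpha> (lax_op \<alpha> N n k f) g
    = vform \<alpha> n ((lax \<alpha> N n ^^ k) (lax_source \<alpha> f)) (lax_source \<alpha> g)"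
  unfolding lax_op_def vform_def mform_sum_left mform_mvar lax_source_def
  by (intro sum.cong refl) simp

lemma lax_op_adjoint:
  "macdonald_form \<alpha> (lax_op \<alpha> N n k f) g = macdonald_form \<alpha> f (lax_op \<alpha> N n k g)"
proof -
  have "vform \<alpha> n F G = vform \<alpha> n G F" for F G
    unfolding vform_def by (intro sum.cong refl mform_sym)
  thus ?thesis by (metis mform_lax_op lax_pow_adjoint mform_sym)
qed

lemma lin_lax_entry: "lin (lax_entry \<alpha> N m l)"
  unfolding lax_entry_def by (cases "m < l"; cases "l < m") (auto intro!: lin_intros)

lemma lax_pow_Suc:
  "(lax \<alpha> N n ^^ Suc k) F m = (\<Sum>l\<in>{1..n}. lax_entry \<alpha> N m l ((lax \<alpha> N n ^^ k) F l))"
  by (simp only: funpow.simps o_apply lax_def[of \<alpha> N n "(lax \<alpha> N n ^^ k) F" m])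

lemma lin_lax_pow: "lin (\<lambda>f. (lax \<alpha> N n ^^ k) (lax_source \<alpha> f) m)"
proof (induction k arbitrary: m)
  case 0
  show ?case by (auto simp: lax_source_def intro!: lin_intros)
next
  case (Suc k)
  thus ?case unfolding lax_pow_Suc
    by (intro lin_sum_intro lin_comp[OF lin_lax_entry])
qed

lemma lin_lax_op: "lin (lax_op \<alpha> N n k)"
  unfolding lax_op_def by (intro lin_sum_intro lin_basic lin_lax_pow)

lemma homog_mvar_mult:
  assumes "homog n f"
  shows "homog (n + Suc j) (mvar j * f)"
  unfolding homog_def
proof
  fix a assume "a \<in> supp (mvar j * f)"
  hence *: "\<forall>i. coef (unit_exp j) i \<le> coef a i" "coef f (a - unit_exp j) \<noteq> 0"
    using coef_mult_mon[of f "unit_exp j" a]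
    by (auto simp: mult.commute mvar_eq_mon in_keys_iff split: if_splits)
  hence a: "a = (a - unit_exp j) + unit_exp j"
    by (intro poly_mapping_eqI) (auto simp: lookup_add lookup_minus)
  have "wt (a - unit_exp j) = n" using * assms by (auto simp: homog_def in_keys_iff)
  thus "wt a = n + Suc j" by (subst a) (simp only: esum_add, simp)
qed

lemma homog_pder:
  assumes "homog n f"
  shows "homog (n - Suc j) (pder j f)"
  unfolding homog_def
proof
  fix d assume "d \<in> supp (pder j f)"
  hence "d + unit_exp j \<in> supp f" by (auto simp: in_keys_iff coef_pder)
  hence "wt (d + unit_exp j) = n" using assms by (auto simp: homog_def)
  thus "wt d = n - Suc j" by (simp add: esum_add)
qed

text \<open>Component \<open>m\<close> of a vector has degree \<open>n - m\<close>, so that its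
  product with the m-th power of \<open>x\<^sub>0\<close> has degree \<open>n\<close>. Truncation at
  \<open>n\<close> is compatible with this grading.\<close>

lemma homog_lax_entry:
  assumes "homog (n - l) f" "1 \<le> m" "m \<le> n" "1 \<le> l" "l \<le> n"
  shows "homog (n - m) (lax_entry \<alpha> N m l f)"
proof -
  consider "m < l" | "l < m" | "m = l" by linarith
  thus ?thesis
  proof cases
    case 1
    hence eq: "n - m = n - l + Suc (l - m - 1)" using assms by simp
    have "homog (n - m) (mvar (l - m - 1) * f)"
      unfolding eq by (rule homog_mvar_mult[OF assms(1)])
    thus ?thesis using 1 by (simp add: lax_entry_def)
  next
    case 2
    hence "n - m = n - l - Suc (m - l - 1)" using assms by simp
    thus ?thesis using 2 homog_pder[OF assms(1), of "m - l - 1"]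
      by (simp add: lax_entry_def homog_scale)
  next
    case 3
    thus ?thesis using assms by (simp add: lax_entry_def homog_scale)
  qed
qed

lemma homog_lax_pow:
  assumes "homog n f" "m \<in> {1..n}"
  shows "homog (n - m) ((lax \<alpha> N n ^^ k) (lax_source \<alpha> f) m)"
  using assms(2)
proof (induction k arbitrary: m)
  case 0
  thus ?case using homog_pder[OF assms(1), of "m - 1"] by (simp add: lax_source_def homog_scale)
next
  case (Suc k)
  show ?case unfolding lax_pow_Suc
    by (intro homog_sum homog_lax_entry) (use Suc in auto)
qed

lemma homog_lax_op:
  assumes "homog n f"
  shows "homog n (lax_op \<alpha> N n k f)"
  unfolding lax_op_def
proof (rule homog_sum)
  fix m assume m: "m \<in> {1..n}"
  thus "homog n (mvar (m - 1) * (lax \<alpha> N n ^^ k) (lax_source \<alpha> f) m)"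
    using homog_mvar_mult[OF homog_lax_pow[OF assms m], where j = "m - 1"] by simp
qed

section \<open>The Heckman operator\<close>

definition heck :: "real \<Rightarrow> nat \<Rightarrow> real mpoly \<Rightarrow> real mpoly" where
  "heck \<alpha> N f = mconst \<alpha> * euler0 f + (\<Sum>j\<in>{1..<N}. divdiff j f)"

lemma lin_heck: "lin (heck \<alpha> N)"
  unfolding heck_def by (intro lin_basic lin_sum_intro lin_divdiff lin_euler0)

lemma euler0_power_sum:
  assumes "0 < N"
  shows "euler0 (power_sum N k) = mconst (real k) * mvar 0 ^ k"
proof -
  have "euler0 (power_sum N k) = (\<Sum>i<N. euler0 (mon (Poly_Mapping.single i k)))"
    by (simp add: power_sum_eq lin_sum lin_euler0)
  also have "\<dots> = (\<Sum>i<N. if i = 0 then mconst (real k) * mvar 0 ^ k else 0)"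
    by (intro sum.cong) (auto simp: euler0_mon coef_single mvar_power mconst_hom)
  finally show ?thesis using assms by simp
qed

text \<open>The chain rule: the Euler operator in \<open>x\<^sub>0\<close> sends the power sum of
  index k to k times the k-th power of \<open>x\<^sub>0\<close>. The bound \<open>K\<close> only has
  to cover the power sums occurring in \<open>f\<close>.\<close>

lemma euler0_expand:
  assumes "0 < N" "\<And>d. d \<in> supp f \<Longrightarrow> supp d \<subseteq> {..<K}"
  shows "euler0 (expand N f)
    = (\<Sum>j<K. mconst (real (Suc j)) * (mvar 0 ^ Suc j * expand N (pder j f)))"
proof (rule lin_eqI[of "\<lambda>f. euler0 (expand N f)"
    "\<lambda>f. \<Sum>j<K. mconst (real (Suc j)) * (mvar 0 ^ Suc j * expand N (pder j f))"])
  fix d assume "d \<in> supp f"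
  hence "supp d \<subseteq> {..<K}" using assms by blast
  thus "euler0 (expand N (mon d))
    = (\<Sum>j<K. mconst (real (Suc j)) * (mvar 0 ^ Suc j * expand N (pder j (mon d))))"
  proof (induction d rule: exponent_induct)
    case zero
    have "pder j 1 = 0" for j using pder_mon[of j 0] by (simp add: mconst_hom)
    moreover have "euler0 1 = 0" using euler0_mon[of 0] by (simp add: mconst_hom)
    ultimately show ?case by (simp add: expand_1 lin_zero lin_expand)
  next
    case (add d i)
    have i: "i < K" "supp d \<subseteq> {..<K}" using add.prems by (auto simp: supp_add_exp)
    let ?x = "\<lambda>j. mconst (real (Suc j)) * mvar 0 ^ Suc j :: real mpoly"
    have e: "expand N (pder j (mon (d + unit_exp i)))
      = expand N (pder j (mon d)) * power_sum N (Suc i) + (if j = i then expand N (mon d) else 0)" for j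
      using pder_mon_mvar[of j d i]
      by (simp add: mon_add mvar_eq_mon[symmetric] lin_add[OF lin_expand] expand_mult expand_mvar
          lin_zero[OF lin_expand])
    have "(\<Sum>j<K. ?x j * expand N (pder j (mon (d + unit_exp i))))
      = (\<Sum>j<K. ?x j * expand N (pder j (mon d)) * power_sum N (Suc i)
          + (if j = i then ?x i * expand N (mon d) else 0))"
      unfolding e by (intro sum.cong refl) (simp add: distrib_left mult.assoc)
    also have "\<dots> = (\<Sum>j<K. ?x j * expand N (pder j (mon d))) * power_sum N (Suc i)
        + ?x i * expand N (mon d)"
      using i by (simp add: sum.distrib sum_distrib_right)
    also have "(\<Sum>j<K. ?x j * expand N (pder j (mon d))) = euler0 (expand N (mon d))"
      using add.IH[OF i(2)] by (simp only: mult.assoc)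
    also have "euler0 (expand N (mon d)) * power_sum N (Suc i) + ?x i * expand N (mon d)
       = euler0 (expand N (mon (d + unit_exp i)))"
      unfolding expand_mon_add euler0_mult euler0_power_sum[OF assms(1)] by (simp only: mult_ac)
    finally show ?case by (simp only: mult.assoc)
  qed
next
  show "lin (\<lambda>f. \<Sum>j<K. mconst (real (Suc j)) * (mvar 0 ^ Suc j * expand N (pder j f)))"
    by (intro lin_sum_intro lin_basic lin_comp[OF lin_expand] lin_pder)
qed (auto intro!: lin_intros)

definition xvec :: "nat \<Rightarrow> nat \<Rightarrow> (nat \<Rightarrow> real mpoly) \<Rightarrow> real mpoly" where
  "xvec N n F = (\<Sum>m\<in>{1..n}. mvar 0 ^ m * expand N (F m))"

lemma expand_mconst_mult: "expand N (mconst c * f) = mconst c * expand N f"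
  by (simp add: lin_scale lin_expand)

lemma homog_supp: "homog n f \<Longrightarrow> d \<in> supp f \<Longrightarrow> supp d \<subseteq> {..<n}"
  using supp_lt_wt[of d] by (simp add: homog_def)

lemma euler0_expand_homog:
  assumes "0 < N" "homog n f"
  shows "euler0 (expand N f)
    = (\<Sum>j<n. mconst (real (Suc j)) * (mvar 0 ^ Suc j * expand N (pder j f)))"
  using assms(1) by (rule euler0_expand) (rule homog_supp[OF assms(2)])

text \<open>Divided differences annihilate symmetric polynomials, so only the Euler term survives,
  and by the chain rule it is the vacuum column.\<close>

lemma heck_expand:
  assumes "0 < N" "homog n f"
  shows "heck \<alpha> N (expand N f) = xvec N n (lax_source \<alpha> f)"
proof -
  have "divdiff j (expand N f) = 0" if "j \<in> {1..<N}" for j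
  proof -
    have "divdiff j (1 * expand N f) = divdiff j 1 * expand N f"
      using that by (intro divdiff_mult_sym exch_expand) auto
    moreover have "divdiff j 1 = 0" using divdiff_power[of j 0] that by simp
    ultimately show ?thesis by simp
  qed
  hence "heck \<alpha> N (expand N f) = mconst \<alpha> * euler0 (expand N f)"
    by (simp add: heck_def)
  also have "\<dots> = (\<Sum>j<n. mvar 0 ^ Suc j * expand N (lax_source \<alpha> f (Suc j)))"
    unfolding euler0_expand_homog[OF assms(1,2)] sum_distrib_left
    unfolding lax_source_def expand_mconst_mult unfolding mconst_hom(4)
    by (intro sum.cong refl) (simp only: mult_ac diff_Suc_1)
  also have "\<dots> = (\<Sum>m\<in>Suc ` {..<n}. mvar 0 ^ m * expand N (lax_source \<alpha> f m))"
    by (simp add: sum.reindex del: image_Suc_lessThan)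
  also have "Suc ` {..<n} = {1..n}" by (rule image_Suc_lessThan)
  finally show ?thesis by (simp only: xvec_def)
qed

lemma sum_other_powers:
  assumes "0 < N"
  shows "(\<Sum>j\<in>{1..<N}. mvar j ^ k) = power_sum N k - (mvar 0 ^ k :: real mpoly)"
proof -
  have "{..<N} = insert 0 {1..<N}" using assms by auto
  thus ?thesis by (simp add: power_sum_def)
qed

text \<open>One column of the Lax matrix. The Euler operator gives the entries \<open>l > m\<close>
  from the symmetric factor and \<open>\<alpha> m\<close> from the power. Divided differences act on
  the power only; the sum over the other variables is a power sum minus a power of
  \<open>x\<^sub>0\<close>, which gives the entries \<open>l < m\<close> and costs one diagonal unit
  for each of these \<open>m - 1\<close> rows. The term \<open>b = m\<close> counts
  \<open>N - 1\<close> variables. The diagonal is thus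
  \<open>\<alpha> m + (N - 1) - (m - 1)\<close>.\<close>

lemma heck_power_mult:
  assumes "0 < N" "homog (n - m) f" "1 \<le> m" "m \<le> n"
  shows "heck \<alpha> N (mvar 0 ^ m * expand N f) = (\<Sum>l\<in>{1..n}. mvar 0 ^ l * expand N (lax_entry \<alpha> N l m f))"
proof -
  let ?x = "mvar 0 :: real mpoly" and ?e = "expand N f"
  let ?t = "\<lambda>l. ?x ^ l * expand N (lax_entry \<alpha> N l m f)"
  have up: "lax_entry \<alpha> N (m + Suc j) m f = mconst (\<alpha> * real (Suc j)) * pder j f" for j
    by (simp add: lax_entry_def)
  have ones: "(\<Sum>j\<in>{1..<N}. mvar j ^ (m - m)) = (mconst (real N - 1) :: real mpoly)"
    using assms(1) by (simp add: mconst_hom mconst_of_nat of_nat_diff)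
  have "euler0 (?x ^ m) = mconst (real m) * ?x ^ m"
    using euler0_mon[of "Poly_Mapping.single 0 m"] by (simp add: mvar_power)
  hence "mconst \<alpha> * euler0 (?x ^ m * ?e) = mconst (\<alpha> * real m) * ?x ^ m * ?e
      + (\<Sum>j<n-m. mconst \<alpha> * ?x ^ m * (mconst (real (Suc j)) * (?x ^ Suc j * expand N (pder j f))))"
    unfolding euler0_mult euler0_expand_homog[OF assms(1,2)] sum_distrib_left mconst_hom
    by (simp only: distrib_left sum_distrib_left mult_ac)
  also have "(\<Sum>j<n-m. mconst \<alpha> * ?x ^ m * (mconst (real (Suc j)) * (?x ^ Suc j * expand N (pder j f))))
     = (\<Sum>j<n-m. ?t (m + Suc j))"
    unfolding up expand_mconst_mult unfolding mconst_hom(4) power_add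
    by (intro sum.cong refl) (simp only: mult_ac)
  also have "\<dots> = (\<Sum>l\<in>{m<..n}. ?t l)"
    by (rule sum.reindex_bij_witness[of "{..<n-m}" "\<lambda>l. l - m - 1" "\<lambda>j. m + Suc j"])
       auto
  finally have 1: "mconst \<alpha> * euler0 (?x ^ m * ?e)
      = mconst (\<alpha> * real m) * ?x ^ m * ?e + (\<Sum>l\<in>{m<..n}. ?t l)" .
  have "(\<Sum>j\<in>{1..<N}. divdiff j (?x ^ m * ?e))
      = (\<Sum>j\<in>{1..<N}. (\<Sum>b\<in>{0<..m}. ?x ^ b * mvar j ^ (m - b)) * ?e)"
  proof (intro sum.cong refl)
    fix j assume "j \<in> {1..<N}"
    hence "j \<noteq> 0" "exch j ?e = ?e" by (auto intro: exch_expand)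
    thus "divdiff j (?x ^ m * ?e) = (\<Sum>b\<in>{0<..m}. ?x ^ b * mvar j ^ (m - b)) * ?e"
      by (simp only: divdiff_mult_sym divdiff_power not_False_eq_True)
  qed
  also have "\<dots> = (\<Sum>b\<in>{0<..m}. ?x ^ b * (\<Sum>j\<in>{1..<N}. mvar j ^ (m - b)) * ?e)"
    unfolding sum_distrib_left sum_distrib_right by (rule sum.swap)
  also have "{0<..m} = insert m {1..<m}" using assms by auto
  also have "(\<Sum>b\<in>insert m {1..<m}. ?x ^ b * (\<Sum>j\<in>{1..<N}. mvar j ^ (m - b)) * ?e)
    = mconst (real N - 1) * ?x ^ m * ?e + (\<Sum>b\<in>{1..<m}. ?x ^ b * (\<Sum>j\<in>{1..<N}. mvar j ^ (m - b)) * ?e)"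
    by (subst sum.insert) (simp_all only: ones mult_ac finite_atLeastLessThan atLeastLessThan_iff, simp)
  also have "(\<Sum>b\<in>{1..<m}. ?x ^ b * (\<Sum>j\<in>{1..<N}. mvar j ^ (m - b)) * ?e)
    = (\<Sum>b\<in>{1..<m}. ?t b - ?x ^ m * ?e)"
  proof (intro sum.cong refl)
    fix b assume b: "b \<in> {1..<m}"
    hence "?x ^ m = ?x ^ b * ?x ^ (m - b)" by (simp flip: power_add)
    moreover have "?t b = ?x ^ b * power_sum N (m - b) * ?e"
      using b by (simp add: lax_entry_def expand_mult expand_mvar mult.assoc Suc_diff_Suc)
    ultimately show "?x ^ b * (\<Sum>j\<in>{1..<N}. mvar j ^ (m - b)) * ?e = ?t b - ?x ^ m * ?e"
      unfolding sum_other_powers[OF assms(1)] by (simp only: algebra_simps)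
  qed
  also have "\<dots> = (\<Sum>b\<in>{1..<m}. ?t b) - mconst (real m - 1) * ?x ^ m * ?e"
    using assms(3) by (simp add: sum_subtractf mconst_hom mconst_of_nat of_nat_diff mult.assoc)
  finally have 2: "(\<Sum>j\<in>{1..<N}. divdiff j (?x ^ m * ?e))
     = mconst (real N - 1) * ?x ^ m * ?e + ((\<Sum>b\<in>{1..<m}. ?t b) - mconst (real m - 1) * ?x ^ m * ?e)" .
  have "?t m = mconst ((\<alpha> - 1) * real m + real N) * ?x ^ m * ?e"
    by (simp add: lax_entry_def expand_mconst_mult mult.left_commute mult.assoc)
  also have "(\<alpha> - 1) * real m + real N = \<alpha> * real m + (real N - 1) - (real m - 1)"
    by (simp add: algebra_simps)
  finally have 3: "?t m = mconst (\<alpha> * real m) * ?x ^ m * ?e + mconst (real N - 1) * ?x ^ m * ?e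
       - mconst (real m - 1) * ?x ^ m * ?e"
    unfolding mconst_hom(3,6) by (simp only: algebra_simps)
  have "{1..n} = insert m ({1..<m} \<union> {m<..n})" using assms by auto
  hence "(\<Sum>l\<in>{1..n}. ?t l) = ?t m + ((\<Sum>b\<in>{1..<m}. ?t b) + (\<Sum>l\<in>{m<..n}. ?t l))"
    by simp (intro sum.union_disjoint, auto)
  thus ?thesis unfolding heck_def 1 2 3 by (simp only: algebra_simps)
qed

lemma heck_xvec:
  assumes "0 < N" "\<And>m. m \<in> {1..n} \<Longrightarrow> homog (n - m) (F m)"
  shows "heck \<alpha> N (xvec N n F) = xvec N n (lax \<alpha> N n F)"
proof -
  have "heck \<alpha> N (xvec N n F) = (\<Sum>m\<in>{1..n}. \<Sum>l\<in>{1..n}. mvar 0 ^ l * expand N (lax_entry \<alpha> N l m (F m)))"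
    unfolding xvec_def lin_sum[OF lin_heck] using assms by (intro sum.cong refl heck_power_mult) auto
  also have "\<dots> = (\<Sum>l\<in>{1..n}. \<Sum>m\<in>{1..n}. mvar 0 ^ l * expand N (lax_entry \<alpha> N l m (F m)))"
    by (rule sum.swap)
  also have "\<dots> = xvec N n (lax \<alpha> N n F)"
    by (simp add: xvec_def lax_def lin_sum[OF lin_expand] sum_distrib_left)
  finally show ?thesis .
qed

text \<open>The exponents differ by one because the first Heckman step leaves the symmetric
  polynomials and produces the vacuum column.\<close>

lemma heck_pow_expand:
  assumes "0 < N" "homog n f"
  shows "(heck \<alpha> N ^^ Suc k) (expand N f) = xvec N n ((lax \<alpha> N n ^^ k) (lax_source \<alpha> f))"
proof (induction k)
  case 0
  thus ?case using heck_expand[OF assms] by simp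
next
  case (Suc k)
  have "(heck \<alpha> N ^^ Suc (Suc k)) (expand N f) = heck \<alpha> N ((heck \<alpha> N ^^ Suc k) (expand N f))"
    by simp
  also have "\<dots> = xvec N n (lax \<alpha> N n ((lax \<alpha> N n ^^ k) (lax_source \<alpha> f)))"
    unfolding Suc by (intro heck_xvec assms homog_lax_pow)
  finally show ?case by simp
qed

text \<open>Exchange with \<open>i\<close> replaces powers of \<open>x\<^sub>0\<close> by powers of
  the i-th variable and fixes the symmetric coefficients; summation over \<open>i\<close> then turns
  the powers into power sums, the vacuum row.\<close>

lemma expand_lax_op:
  assumes "0 < N" "homog n f"
  shows "expand N (lax_op \<alpha> N n k f) = (\<Sum>i<N. exch i ((heck \<alpha> N ^^ Suc k) (expand N f)))"
proof -
  let ?F = "(lax \<alpha> N n ^^ k) (lax_source \<alpha> f)"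
  have "exch i (mvar 0 ^ m) = mvar i ^ m" for i m
    unfolding mvar_power exch_mon by (simp add: exch_exp_single)
  hence "exch i (xvec N n ?F) = (\<Sum>m\<in>{1..n}. mvar i ^ m * expand N (?F m))" if "i < N" for i
    unfolding xvec_def lin_sum[OF lin_exch] exch_mult using that by (simp add: exch_expand)
  hence "(\<Sum>i<N. exch i (xvec N n ?F)) = (\<Sum>i<N. \<Sum>m\<in>{1..n}. mvar i ^ m * expand N (?F m))"
    by simp
  also have "\<dots> = (\<Sum>m\<in>{1..n}. \<Sum>i<N. mvar i ^ m * expand N (?F m))"
    by (rule sum.swap)
  also have "\<dots> = expand N (lax_op \<alpha> N n k f)"
    unfolding lax_op_def lin_sum[OF lin_expand] expand_mult expand_mvar
    by (intro sum.cong refl) (simp add: power_sum_def sum_distrib_right)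
  finally show ?thesis by (simp add: heck_pow_expand[OF assms] del: funpow.simps)
qed

section \<open>Triangularity in dominance order\<close>

lemma esum_put:
  assumes "j \<noteq> 0" "w j = w 0" "x + y = coef a 0 + coef a j"
  shows "esum w (put j a x y) = esum w a"
proof -
  have "put j a x y + (Poly_Mapping.single 0 (coef a 0) + Poly_Mapping.single j (coef a j))
      = a + (Poly_Mapping.single 0 x + Poly_Mapping.single j y)"
    using assms(1) by (intro poly_mapping_eqI) (auto simp: lookup_add coef_put coef_single)
  hence "esum w (put j a x y) + (w 0 * coef a 0 + w j * coef a j) = esum w a + (w 0 * x + w j * y)"
    by (metis esum_add esum_single)
  moreover have "w 0 * coef a 0 + w j * coef a j = w 0 * x + w j * y"
    using assms by (simp flip: distrib_left)
  ultimately show ?thesis by simp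
qed

text \<open>Redistribution between two positions that keeps the total and does not exceed the larger
  entry. Sets of positions containing both or neither have unchanged sums; if exactly one lies in
  the set, it is traded for the position \<open>M\<close> of the larger entry of
  \<open>a\<close>.\<close>

lemma dom_le_put:
  assumes "j \<noteq> 0" "x + y = coef a 0 + coef a j"
    "x \<le> max (coef a 0) (coef a j)" "y \<le> max (coef a 0) (coef a j)"
  shows "dom_le (put j a x y) a"
  unfolding dom_le_def
proof (intro conjI allI impI)
  let ?b = "put j a x y"
  show "deg ?b = deg a" using assms by (intro esum_put) auto
  fix S :: "nat set" assume S: "finite S"
  have other: "sum (coef ?b) (S - {0, j}) = sum (coef a) (S - {0, j})"
    by (intro sum.cong) (auto simp: coef_put)
  define M where "M = (if coef a 0 \<le> coef a j then j else 0)"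
  have bM: "coef ?b 0 \<le> coef a M" "coef ?b j \<le> coef a M"
    using assms by (auto simp: M_def coef_put)
  consider "0 \<in> S" "j \<in> S" | "(0 \<in> S) \<noteq> (j \<in> S)" | "0 \<notin> S" "j \<notin> S" by blast
  thus "\<exists>S'. finite S' \<and> card S' = card S \<and> sum (coef ?b) S \<le> sum (coef a) S'"
  proof cases
    case 1
    have "sum f S = sum f (S - {0, j}) + sum f {0, j}" for f :: "nat \<Rightarrow> nat"
      using S 1 by (intro sum.subset_diff) auto
    hence "sum (coef ?b) S = sum (coef a) S"
      using assms(1,2) other by (simp add: coef_put)
    thus ?thesis using S by (intro exI[of _ S]) auto
  next
    case 2
    define i where "i = (if 0 \<in> S then 0 else j)"
    have i: "i \<in> {0, j}" "i \<in> S" "S - {0, j} = S - {i}" using 2 by (auto simp: i_def)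
    note eq = i(3)
    have M: "M \<in> {0, j}" by (simp add: M_def)
    hence nM: "M \<notin> S - {i}" using eq by auto
    have "sum (coef ?b) S = coef ?b i + sum (coef ?b) (S - {i})"
      using S i by (simp add: sum.remove)
    also have "\<dots> \<le> coef a M + sum (coef a) (S - {i})"
      using bM i(1) other unfolding eq by (intro add_mono) auto
    also have "\<dots> = sum (coef a) (insert M (S - {i}))" using S nM by simp
    finally have "sum (coef ?b) S \<le> sum (coef a) (insert M (S - {i}))" .
    moreover have "card (insert M (S - {i})) = Suc (card (S - {i}))"
      using S nM by (intro card_insert_disjoint) auto
    hence "card (insert M (S - {i})) = card S"
      by (simp only: card_Suc_Diff1[OF S i(2)])
    ultimately show ?thesis using S by (intro exI[of _ "insert M (S - {i})"]) simp
  next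
    case 3
    hence "S - {0, j} = S" by auto
    thus ?thesis using other S by (intro exI[of _ S]) simp
  qed
qed

text \<open>Sums of squares are constant on shapes and drop strictly along a divided difference; this
  singles out the diagonal terms.\<close>

definition sumsq :: "(nat \<Rightarrow>\<^sub>0 nat) \<Rightarrow> nat" where
  "sumsq a = esum (\<lambda>j. (Suc j)\<^sup>2) (shape a)"

lemma sumsq_eq: "finite S \<Longrightarrow> supp a \<subseteq> S \<Longrightarrow> sumsq a = (\<Sum>i\<in>S. (coef a i)\<^sup>2)"
proof -
  assume S: "finite S" "supp a \<subseteq> S"
  have "sumsq a = (\<Sum>i\<in>supp a. (Suc (coef a i - 1))\<^sup>2)"
    by (simp add: sumsq_def shape_def esum_sum)
  also have "\<dots> = (\<Sum>i\<in>supp a. (coef a i)\<^sup>2)" by (intro sum.cong) (auto simp: in_keys_iff)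
  also have "\<dots> = (\<Sum>i\<in>S. (coef a i)\<^sup>2)"
    using S by (intro sum.mono_neutral_left) (auto simp: in_keys_iff)
  finally show ?thesis .
qed

text \<open>Strict convexity: for X + Y = p + q, the sum of squares drops by 2 (p - X) (X - q),
  which is positive for X strictly between p and q.\<close>

lemma sumsq_put:
  assumes "j \<noteq> 0" "x + y = coef a 0 + coef a j"
    "min (coef a 0) (coef a j) < x" "x < max (coef a 0) (coef a j)"
  shows "sumsq (put j a x y) < sumsq a"
proof -
  let ?b = "put j a x y" and ?S = "supp a \<union> {0, j}"
  have "supp ?b \<subseteq> ?S" by (auto simp: in_keys_iff coef_put split: if_splits)
  hence b: "sumsq ?b = (\<Sum>i\<in>?S. (coef ?b i)\<^sup>2)" by (intro sumsq_eq) auto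
  have a: "sumsq a = (\<Sum>i\<in>?S. (coef a i)\<^sup>2)" by (intro sumsq_eq) auto
  have split: "(\<Sum>i\<in>?S. f i) = f 0 + f j + (\<Sum>i\<in>?S - {0, j}. f i)" for f :: "nat \<Rightarrow> nat"
    using assms(1) sum.subset_diff[of "{0, j}" ?S f] by simp
  have "x\<^sup>2 + y\<^sup>2 < (coef a 0)\<^sup>2 + (coef a j)\<^sup>2"
  proof -
    define p q X Y where "p = int (coef a 0)" and "q = int (coef a j)" and "X = int x" and "Y = int y"
    have pq: "X + Y = p + q" "(p - X) * (X - q) > 0"
      using assms by (auto simp: p_def q_def X_def Y_def zero_less_mult_iff min_def max_def split: if_splits)
    have "p\<^sup>2 + q\<^sup>2 - (X\<^sup>2 + Y\<^sup>2) = 2 * ((p - X) * (X - q))"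
    proof -
      have Y: "Y = p + q - X" using pq by simp
      show ?thesis unfolding Y by (simp add: power2_eq_square algebra_simps)
    qed
    with pq have "X\<^sup>2 + Y\<^sup>2 < p\<^sup>2 + q\<^sup>2" by linarith
    thus ?thesis unfolding p_def q_def X_def Y_def by (metis of_nat_add of_nat_less_iff of_nat_power)
  qed
  moreover have "(\<Sum>i\<in>?S - {0, j}. (coef ?b i)\<^sup>2) = (\<Sum>i\<in>?S - {0, j}. (coef a i)\<^sup>2)"
    by (intro sum.cong) (auto simp: coef_put)
  ultimately show ?thesis unfolding a b split using assms(1) by (simp add: coef_put)
qed

lemma shape_exch_exp [simp]: "shape (exch_exp j a) = shape a"
proof (rule shape_perm)
  show "bij (Transposition.transpose 0 j)" by simp
  show "coef (exch_exp j a) = coef a \<circ> Transposition.transpose 0 j" by auto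
qed

lemma divdiff_mon_cases:
  assumes "coef (divdiff j (mon a)) b \<noteq> 0"
  obtains x where "min (coef a 0) (coef a j) < x" "x \<le> max (coef a 0) (coef a j)"
    "b = put j a x (coef a 0 + coef a j - x)"
proof -
  have 1: "\<exists>x\<in>{u<..v}. b = put j a x (coef a 0 + coef a j - x)"
    if "coef (\<Sum>x\<in>{u<..v}. mon (put j a x (coef a 0 + coef a j - x))) b \<noteq> 0" for u v
  proof (rule ccontr)
    assume "\<not> ?thesis"
    hence "coef (\<Sum>x\<in>{u<..v}. mon (put j a x (coef a 0 + coef a j - x))) b = 0"
      unfolding lookup_sum by (intro sum.neutral) (auto simp: coef_single)
    with that show False by simp
  qed
  show ?thesis
  proof (cases "coef a j < coef a 0")
    case True
    thus ?thesis using assms 1[of "coef a j" "coef a 0"] that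
      by (fastforce simp: divdiff_mon)
  next
    case False
    thus ?thesis using assms 1[of "coef a 0" "coef a j"] that
      by (fastforce simp: divdiff_mon)
  qed
qed

lemma divdiff_mon_dom_le:
  assumes "j \<noteq> 0" "j < N" "supp a \<subseteq> {..<N}" "coef (divdiff j (mon a)) b \<noteq> 0"
  shows "supp b \<subseteq> {..<N}" "dom_le b a"
proof -
  obtain x where x: "min (coef a 0) (coef a j) < x" "x \<le> max (coef a 0) (coef a j)"
    "b = put j a x (coef a 0 + coef a j - x)" using divdiff_mon_cases[OF assms(4)] .
  show "supp b \<subseteq> {..<N}"
    using assms(1-3) by (auto simp: x(3) in_keys_iff subset_iff coef_put split: if_splits)
  show "dom_le b a" unfolding x(3) using x assms(1) by (intro dom_le_put) auto
qed

text \<open>Inside the summation range \<open>sumsq\<close> drops, so only the upper endpoint keeps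
  the shape. It gives \<open>a\<close> with sign plus if \<open>x\<^sub>0\<close> has the larger
  exponent in \<open>a\<close>, and the exchanged \<open>a\<close> with sign minus if it has the
  smaller one; either way the result has its larger exponent at \<open>x\<^sub>0\<close>.\<close>

lemma coef_divdiff_mon_diagonal:
  assumes "j \<noteq> 0" "shape a = shape b"
  shows "coef (divdiff j (mon a)) b
    = (if coef b j < coef b 0 then (if a = b then 1 else 0) - (if a = exch_exp j b then 1 else 0) else 0)"
proof -
  let ?s = "coef a 0 + coef a j"
  have eqs: "put j a (coef a 0) (coef a j) = a" "put j a (coef a j) (coef a 0) = exch_exp j a"
    using assms(1) by (auto intro!: poly_mapping_eqI simp: coef_put Transposition.transpose_def)
  have c: "coef (mon (put j a x (?s - x))) b
      = (if x = v then (if b = put j a v (?s - v) then 1 else 0) else 0)"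
    if "x \<in> {u<..v}" "{u, v} = {coef a 0, coef a j}" for x u v
  proof (cases "x = v")
    case False
    have "sumsq (put j a x (?s - x)) < sumsq a"
      using assms(1) that False by (intro sumsq_put) (auto simp: doubleton_eq_iff)
    hence "put j a x (?s - x) \<noteq> b" using assms(2) by (auto simp: sumsq_def)
    thus ?thesis using False by (simp add: coef_single)
  qed (auto simp: coef_single)
  have d: "coef (\<Sum>x\<in>{u<..v}. mon (put j a x (?s - x))) b
      = (if u < v \<and> b = put j a v (?s - v) then 1 else 0)" if "{u, v} = {coef a 0, coef a j}" for u v
  proof -
    have "coef (\<Sum>x\<in>{u<..v}. mon (put j a x (?s - x))) b
      = (\<Sum>x\<in>{u<..v}. if x = v then (if b = put j a v (?s - v) then 1 else 0) else 0)"
      unfolding lookup_sum using that by (intro sum.cong refl c) auto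
    thus ?thesis by simp
  qed
  have "coef (divdiff j (mon a)) b = (if coef a j < coef a 0 \<and> b = a then 1 else 0)
      - (if coef a 0 < coef a j \<and> b = exch_exp j a then 1 else 0)"
    unfolding divdiff_mon lookup_minus using d[of "coef a j" "coef a 0"] d[of "coef a 0" "coef a j"]
    by (simp add: eqs insert_commute)
  also have "\<dots> = (if coef b j < coef b 0 then (if a = b then 1 else 0) - (if a = exch_exp j b then 1 else 0) else 0)"
  proof -
    have fx: "coef (exch_exp j b) 0 = coef b j" "coef (exch_exp j b) j = coef b 0" by simp_all
    have "b = exch_exp j a \<longleftrightarrow> a = exch_exp j b" by (metis exch_exp_exch_exp)
    moreover have "b = exch_exp j b \<Longrightarrow> coef b 0 = coef b j" by (metis fx(1))
    ultimately show ?thesis using fx by (cases "a = b"; cases "a = exch_exp j b") auto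
  qed
  finally show ?thesis .
qed

text \<open>Heckman iterates of symmetric polynomials are no longer symmetric, so triangularity is
  tracked on single x-monomials.\<close>

definition below :: "nat \<Rightarrow> partition \<Rightarrow> real mpoly \<Rightarrow> bool" where
  "below N l f \<longleftrightarrow> (\<forall>a\<in>supp f. supp a \<subseteq> {..<N} \<and> dom_le a (parts l))"

lemma divdiff_eq_sum: "divdiff j f = (\<Sum>a\<in>supp f. mconst (coef f a) * divdiff j (mon a))"
  by (simp add: divdiff_def lin_ext_def mconst_hom)

lemma euler0_eq: "coef (euler0 f) b = real (coef b 0) * coef f b"
proof -
  have "coef (euler0 f) b = (\<Sum>a\<in>supp f. if a = b then real (coef b 0) * coef f b else 0)"
    unfolding euler0_def lin_ext_def lookup_sum by (intro sum.cong refl) (auto simp: coef_single)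
  thus ?thesis by (simp add: in_keys_iff)
qed

lemma below_divdiff:
  assumes "below N l f" "j \<noteq> 0" "j < N"
  shows "below N l (divdiff j f)"
  unfolding below_def
proof
  fix b assume "b \<in> supp (divdiff j f)"
  hence "coef (divdiff j f) b \<noteq> 0" by (simp add: in_keys_iff)
  hence "(\<Sum>a\<in>supp f. coef f a * coef (divdiff j (mon a)) b) \<noteq> 0"
    by (subst (asm) divdiff_eq_sum) (simp add: lookup_sum)
  then obtain a where a: "a \<in> supp f" "coef f a * coef (divdiff j (mon a)) b \<noteq> 0"
    by (rule sum.not_neutral_contains_not_neutral)
  hence "supp a \<subseteq> {..<N}" "dom_le a (parts l)" using assms(1) by (auto simp: below_def)
  with divdiff_mon_dom_le[of j N a b] a(2) assms(2,3) dom_le_trans[of b a "parts l"]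
  show "supp b \<subseteq> {..<N} \<and> dom_le b (parts l)" by auto
qed

lemma below_heck:
  assumes "below N l f"
  shows "below N l (heck \<alpha> N f)"
  unfolding below_def
proof
  fix b assume "b \<in> supp (heck \<alpha> N f)"
  hence nz: "\<alpha> * (real (coef b 0) * coef f b) + (\<Sum>j\<in>{1..<N}. coef (divdiff j f) b) \<noteq> 0"
    unfolding in_keys_iff heck_def lookup_add lookup_sum coef_mconst_mult euler0_eq .
  show "supp b \<subseteq> {..<N} \<and> dom_le b (parts l)"
  proof (cases "coef f b = 0")
    case True
    with nz have "(\<Sum>j\<in>{1..<N}. coef (divdiff j f) b) \<noteq> 0" by simp
    then obtain j where "j \<in> {1..<N}" "coef (divdiff j f) b \<noteq> 0"
      by (rule sum.not_neutral_contains_not_neutral)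
    with below_divdiff[OF assms, of j] show ?thesis by (auto simp: below_def in_keys_iff)
  next
    case False
    thus ?thesis using assms by (auto simp: below_def in_keys_iff)
  qed
qed

text \<open>If a monomial \<open>a\<close> dominated by \<open>l\<close> contributes to
  \<open>b\<close> of shape \<open>l\<close>, then \<open>b\<close> is dominated by \<open>a\<close>
  and conversely, so \<open>a\<close> has the same shape. Only the diagonal terms of
  \<open>coef_divdiff_mon_diagonal\<close> remain.\<close>

lemma coef_divdiff_diagonal:
  assumes "below N l f" "j \<noteq> 0" "j < N" "shape b = shape (parts l)"
  shows "coef (divdiff j f) b = (if coef b j < coef b 0 then coef f b - coef f (exch_exp j b) else 0)"
proof -
  let ?c = "\<lambda>a. if coef b j < coef b 0
    then (if a = b then coef f a else 0) - (if a = exch_exp j b then coef f a else 0) else 0"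
  have "coef (divdiff j f) b = (\<Sum>a\<in>supp f. coef f a * coef (divdiff j (mon a)) b)"
    by (subst divdiff_eq_sum) (simp add: lookup_sum)
  also have "\<dots> = (\<Sum>a\<in>supp f. ?c a)"
  proof (intro sum.cong refl)
    fix a assume a: "a \<in> supp f"
    show "coef f a * coef (divdiff j (mon a)) b = ?c a"
    proof (cases "shape a = shape b")
      case True
      thus ?thesis using coef_divdiff_mon_diagonal[OF assms(2) True] by simp
    next
      case False
      have al: "supp a \<subseteq> {..<N}" "dom_le a (parts l)" using a assms(1) by (auto simp: below_def)
      have "coef (divdiff j (mon a)) b = 0"
      proof (rule ccontr)
        assume "coef (divdiff j (mon a)) b \<noteq> 0"
        hence "dom_le b a" by (rule divdiff_mon_dom_le(2)[OF assms(2,3) al(1)])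
        moreover have "dom_le a b"
          using dom_le_trans[OF al(2) dom_le_shape[of "parts l" b]] assms(4) by simp
        ultimately show False using False dom_le_antisym by metis
      qed
      moreover have "a \<noteq> b" "a \<noteq> exch_exp j b" using False by auto
      ultimately show ?thesis by simp
    qed
  qed
  also have "\<dots> = (if coef b j < coef b 0 then coef f b - coef f (exch_exp j b) else 0)"
    by (auto simp: sum_subtractf in_keys_iff)
  finally show ?thesis .
qed

text \<open>\<open>heck_coef \<alpha> N l k c\<close> is the coefficient in the \<open>k\<close>-th Heckman iterate of every monomial of
  shape \<open>l\<close> in which \<open>x\<^sub>0\<close> has exponent \<open>c\<close>.\<close>

primrec heck_coef :: "real \<Rightarrow> nat \<Rightarrow> partition \<Rightarrow> nat \<Rightarrow> nat \<Rightarrow> real" where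
  "heck_coef \<alpha> N l 0 c = 1"
| "heck_coef \<alpha> N l (Suc k) c = \<alpha> * real c * heck_coef \<alpha> N l k c
     + (\<Sum>i | i < N \<and> part l i < c. heck_coef \<alpha> N l k c - heck_coef \<alpha> N l k (part l i))"

text \<open>Subtracting \<open>g 0\<close> leaves a sum over the support, which a permutation
  carries over; the constant \<open>real N * g 0\<close> is common to both sides.\<close>

lemma sum_coef_shape:
  fixes g :: "nat \<Rightarrow> real"
  assumes "shape a = shape b" "supp a \<subseteq> {..<N}" "supp b \<subseteq> {..<N}"
  shows "(\<Sum>i<N. g (coef a i)) = (\<Sum>i<N. g (coef b i))"
proof -
  have *: "(\<Sum>i<N. g (coef d i)) = (\<Sum>i\<in>supp d. g (coef d i) - g 0) + real N * g 0"
    if "supp d \<subseteq> {..<N}" for d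
  proof -
    have "(\<Sum>i\<in>supp d. g (coef d i) - g 0) = (\<Sum>i<N. g (coef d i) - g 0)"
      using that by (intro sum.mono_neutral_left) (auto simp: in_keys_iff)
    thus ?thesis by (simp add: sum_subtractf)
  qed
  obtain \<pi> where \<pi>: "bij \<pi>" "coef a = coef b \<circ> \<pi>" using shape_eq_perm[OF assms(1)] .
  have "supp a = \<pi> -` supp b" using \<pi>(2) by (auto simp: in_keys_iff)
  hence "supp b = \<pi> ` supp a" using \<pi>(1) by (simp add: surj_image_vimage_eq bij_def)
  hence "(\<Sum>i\<in>supp b. g (coef b i) - g 0) = (\<Sum>i\<in>supp a. g (coef a i) - g 0)"
    using \<pi> by (simp add: sum.reindex bij_def inj_on_def)
  thus ?thesis using *[OF assms(2)] *[OF assms(3)] by simp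
qed

text \<open>The recursion closes because the exchange with \<open>j\<close> moves
  \<open>coef b j\<close> to \<open>x\<^sub>0\<close>, so the new coefficient involves only the
  values for the entries of \<open>b\<close>. These entries rearrange the parts of \<open>l\<close>,
  which makes the sum independent of \<open>b\<close> apart from \<open>coef b 0\<close>.\<close>

lemma coef_heck_pow:
  assumes "below N l f" "psize l \<le> N" "\<And>b. shape b = shape (parts l) \<Longrightarrow> supp b \<subseteq> {..<N} \<Longrightarrow> coef f b = 1"
  shows "below N l ((heck \<alpha> N ^^ k) f) \<and> (\<forall>b. shape b = shape (parts l) \<longrightarrow> supp b \<subseteq> {..<N} \<longrightarrow>
    coef ((heck \<alpha> N ^^ k) f) b = heck_coef \<alpha> N l k (coef b 0))"
proof (induction k)
  case 0
  thus ?case using assms by simp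
next
  case (Suc k)
  let ?g = "(heck \<alpha> N ^^ k) f" and ?\<phi> = "heck_coef \<alpha> N l k"
  have g: "below N l ?g" "\<And>b. shape b = shape (parts l) \<Longrightarrow> supp b \<subseteq> {..<N} \<Longrightarrow> coef ?g b = ?\<phi> (coef b 0)"
    using Suc by auto
  have "coef (heck \<alpha> N ?g) b = heck_coef \<alpha> N l (Suc k) (coef b 0)"
    if b: "shape b = shape (parts l)" "supp b \<subseteq> {..<N}" for b
  proof -
    let ?h = "\<lambda>v. if v < coef b 0 then ?\<phi> (coef b 0) - ?\<phi> v else 0"
    have 1: "coef (divdiff j ?g) b = ?h (coef b j)" if j: "j \<in> {1..<N}" for j
    proof -
      have "supp (exch_exp j b) \<subseteq> {..<N}"
        using b j by (auto simp: in_keys_iff subset_iff Transposition.transpose_def split: if_splits)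
      hence "coef ?g (exch_exp j b) = ?\<phi> (coef b j)"
        using g(2)[of "exch_exp j b"] b by simp
      thus ?thesis using coef_divdiff_diagonal[OF g(1), of j b] b j g(2)[OF b] by simp
    qed
    have "(\<Sum>j\<in>{1..<N}. coef (divdiff j ?g) b) = (\<Sum>j\<in>{1..<N}. ?h (coef b j))"
      by (intro sum.cong refl 1)
    \<comment> \<open>The added index 0 contributes nothing, since \<open>coef b 0\<close> is not
      strictly below itself.\<close>
    also have "\<dots> = (\<Sum>j<N. ?h (coef b j))"
      by (intro sum.mono_neutral_left) (auto simp: not_less_eq_eq)
    also have "\<dots> = (\<Sum>j<N. ?h (coef (parts l) j))"
      using b supp_parts_psize[of l] assms(2) by (intro sum_coef_shape) auto
    also have "\<dots> = (\<Sum>i | i < N \<and> part l i < coef b 0. ?\<phi> (coef b 0) - ?\<phi> (part l i))"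
      by (simp add: part_def sum.If_cases Int_def)
    finally have "(\<Sum>j\<in>{1..<N}. coef (divdiff j ?g) b)
      = (\<Sum>i | i < N \<and> part l i < coef b 0. ?\<phi> (coef b 0) - ?\<phi> (part l i))" .
    thus ?thesis using g(2)[OF b] by (simp add: heck_def lookup_add lookup_sum euler0_eq)
  qed
  thus ?case using below_heck[OF g(1)] by simp
qed

text \<open>The sum over \<open>i\<close> is the symmetrization of \<open>expand_lax_op\<close>:
  exchange with \<open>i\<close> puts \<open>part l i\<close> on \<open>x\<^sub>0\<close>. The shift
  to \<open>Suc k\<close> is that of \<open>heck_pow_expand\<close>.\<close>

definition lax_eigenvalue :: "real \<Rightarrow> nat \<Rightarrow> nat \<Rightarrow> partition \<Rightarrow> real" where
  "lax_eigenvalue \<alpha> N k l = (\<Sum>i<N. heck_coef \<alpha> N l (Suc k) (part l i))"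

lemma lax_op_msym:
  assumes "0 < N" "psize l = n" "n \<le> N"
  shows "\<exists>u. lax_op \<alpha> N n k (msym l)
    = mconst (lax_eigenvalue \<alpha> N k l) * msym l + (\<Sum>m | dominated m l \<and> m \<noteq> l. mconst (u m) * msym m)"
proof -
  let ?f = "lax_op \<alpha> N n k (msym l)" and ?g = "(heck \<alpha> N ^^ Suc k) (monomial_sym N l)"
  define u where "u m = coef (expand N ?f) (parts m)" for m
  have hom: "homog n (msym l)" using homog_msym[of l] assms by simp
  have f: "?f = (\<Sum>m | psize m = n. mconst (u m) * msym m)"
    unfolding u_def by (rule eq_sum_msym[OF homog_lax_op[OF hom] assms(3)])
  have ex: "expand N ?f = (\<Sum>i<N. exch i ?g)"
    unfolding expand_lax_op[OF assms(1) hom] expand_msym ..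
  have bel: "below N l (monomial_sym N l)"
    unfolding below_def
    by (auto simp only: in_keys_iff[of _ "monomial_sym N l"] coef_monomial_sym dom_le_shape split: if_splits)
  have g: "below N l ?g" "\<And>b. shape b = shape (parts l) \<Longrightarrow> supp b \<subseteq> {..<N} \<Longrightarrow>
      coef ?g b = heck_coef \<alpha> N l (Suc k) (coef b 0)"
    using coef_heck_pow[OF bel, where \<alpha> = \<alpha> and k = "Suc k"] assms by (auto simp: coef_monomial_sym simp del: funpow.simps)
  have sp: "supp (parts m) \<subseteq> {..<N}" if "psize m = n" for m
    using supp_parts_psize[of m] assms that by auto
  have "u l = (\<Sum>i<N. coef ?g (exch_exp i (parts l)))"
    unfolding u_def ex lookup_sum coef_exch ..
  also have "\<dots> = lax_eigenvalue \<alpha> N k l"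
    unfolding lax_eigenvalue_def
  proof (intro sum.cong refl)
    fix i assume i: "i \<in> {..<N}"
    have "supp (exch_exp i (parts l)) \<subseteq> {..<N}"
      using sp[OF assms(2)] i assms(1)
      by (auto simp: in_keys_iff subset_iff Transposition.transpose_def split: if_splits)
    thus "coef ?g (exch_exp i (parts l)) = heck_coef \<alpha> N l (Suc k) (part l i)"
      by (subst g(2)) (simp_all add: part_def)
  qed
  finally have ul: "u l = lax_eigenvalue \<alpha> N k l" .
  have dom: "dominated m l" if "u m \<noteq> 0" for m
  proof -
    have "(\<Sum>i<N. coef ?g (exch_exp i (parts m))) \<noteq> 0"
      using that unfolding u_def ex lookup_sum coef_exch .
    then obtain i where "coef ?g (exch_exp i (parts m)) \<noteq> 0"
      by (rule sum.not_neutral_contains_not_neutral)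
    hence "exch_exp i (parts m) \<in> supp ?g" by (simp only: in_keys_iff not_False_eq_True)
    hence "dom_le (exch_exp i (parts m)) (parts l)" using g(1) unfolding below_def by blast
    thus ?thesis unfolding dominated_iff
      using dom_le_trans[OF dom_le_shape[of "parts m" "exch_exp i (parts m)"]] by simp
  qed
  have "?f = (\<Sum>m\<in>insert l {m. dominated m l \<and> m \<noteq> l}. mconst (u m) * msym m)"
    unfolding f
  proof (rule sum.mono_neutral_right[OF finite_psize])
    show "insert l {m. dominated m l \<and> m \<noteq> l} \<subseteq> {m. psize m = n}"
      using assms(2) by (auto simp: dominated_def)
    show "\<forall>m\<in>{m. psize m = n} - insert l {m. dominated m l \<and> m \<noteq> l}. mconst (u m) * msym m = 0"
    proof
      fix m assume "m \<in> {m. psize m = n} - insert l {m. dominated m l \<and> m \<noteq> l}"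
      hence "u m = 0" using dom[of m] by blast
      thus "mconst (u m) * msym m = 0" by (simp add: mconst_hom)
    qed
  qed
  also have "\<dots> = mconst (u l) * msym l + (\<Sum>m | dominated m l \<and> m \<noteq> l. mconst (u m) * msym m)"
    using finite_subset[OF _ finite_dominated[of l]] by (subst sum.insert) auto
  finally show ?thesis unfolding ul by blast
qed

section \<open>Separation of partitions\<close>

abbreviation jack_content :: "real \<Rightarrow> nat \<Rightarrow> partition \<Rightarrow> nat \<Rightarrow> real" where
  "jack_content \<alpha> N l i \<equiv> \<alpha> * real (part l i) + real (N - Suc i)"

lemma part_antimono: "i \<le> j \<Longrightarrow> part l j \<le> part l i"
  using antimono_parts[of l] by (auto simp: part_def dest: antimonoD)

text \<open>The sum over strictly smaller parts may be taken over all later rows, as equal parts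
  contribute a zero difference. Collecting the \<open>N - Suc r\<close> equal terms produces the
  shifted part \<open>jack_content\<close>.\<close>

lemma heck_coef_row:
  assumes "r < N"
  shows "heck_coef \<alpha> N l (Suc k) (part l r) = jack_content \<alpha> N l r * heck_coef \<alpha> N l k (part l r)
    - (\<Sum>i\<in>{Suc r..<N}. heck_coef \<alpha> N l k (part l i))"
proof -
  let ?\<phi> = "heck_coef \<alpha> N l k"
  have "(\<Sum>i | i < N \<and> part l i < part l r. ?\<phi> (part l r) - ?\<phi> (part l i))
    = (\<Sum>i\<in>{Suc r..<N}. ?\<phi> (part l r) - ?\<phi> (part l i))"
  proof (rule sum.mono_neutral_left)
    show "{i. i < N \<and> part l i < part l r} \<subseteq> {Suc r..<N}"
      using part_antimono[of _ r l] by (auto simp: Suc_le_eq) (metis leD leI)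
    show "\<forall>i\<in>{Suc r..<N} - {i. i < N \<and> part l i < part l r}. ?\<phi> (part l r) - ?\<phi> (part l i) = 0"
    proof
      fix i assume "i \<in> {Suc r..<N} - {i. i < N \<and> part l i < part l r}"
      hence "part l i = part l r" using part_antimono[of r i l] by auto
      thus "?\<phi> (part l r) - ?\<phi> (part l i) = 0" by simp
    qed
  qed simp
  also have "\<dots> = real (N - Suc r) * ?\<phi> (part l r) - (\<Sum>i\<in>{Suc r..<N}. ?\<phi> (part l i))"
    by (simp add: sum_subtractf)
  finally show ?thesis by (simp add: algebra_simps)
qed

text \<open>Let Y_i be the generating series, s_i the shifted parts and T_r = 1 - X (Y_r + ... +
  Y_(N-1)). \<open>heck_coef_row\<close> says (1 - X s_r) Y_r = T_(r+1); together with T_r = T_(r+1)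
  - X Y_r this gives (1 - X s_r) T_r = (1 - X (s_r + 1)) T_(r+1). The product is stated without
  division.\<close>

lemma fps_heck_prod:
  defines "Y \<equiv> \<lambda>\<alpha> N l i. Abs_fps (\<lambda>k. heck_coef \<alpha> N l k (part l i))"
  assumes "r \<le> N"
  shows "(1 - fps_X * (\<Sum>i\<in>{r..<N}. Y \<alpha> N l i)) * (\<Prod>i\<in>{r..<N}. 1 - fps_X * fps_const (jack_content \<alpha> N l i))
    = (\<Prod>i\<in>{r..<N}. 1 - fps_X * fps_const (jack_content \<alpha> N l i + 1))"
  using assms(2)
proof (induction "N - r" arbitrary: r)
  case 0
  thus ?case by simp
next
  case (Suc n)
  let ?s = "jack_content \<alpha> N l" and ?Y = "Y \<alpha> N l"
  define T where "T r = 1 - fps_X * (\<Sum>i\<in>{r..<N}. ?Y i)" for r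
  have r: "r < N" and ins: "{r..<N} = insert r {Suc r..<N}" using Suc by auto
  have solve_row: "(1 - x * c) * y = 1 - x * z" if "y = 1 + x * (c * y - z)" for x c y z :: "real fps"
    using that by algebra
  have row: "?Y r = 1 + fps_X * (fps_const (?s r) * ?Y r - (\<Sum>i\<in>{Suc r..<N}. ?Y i))"
  proof (rule fps_ext)
    fix k
    show "fps_nth (?Y r) k = fps_nth (1 + fps_X * (fps_const (?s r) * ?Y r - (\<Sum>i\<in>{Suc r..<N}. ?Y i))) k"
    proof (cases k)
      case 0
      thus ?thesis by (simp add: Y_def)
    next
      case (Suc k')
      show ?thesis unfolding Suc using heck_coef_row[OF r, of \<alpha> l k']
        by (simp add: Y_def fps_sum_nth del: heck_coef.simps)
    qed
  qed
  have "(1 - fps_X * fps_const (?s r)) * ?Y r = T (Suc r)"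
    unfolding T_def by (rule solve_row[OF row])
  moreover have "T r = T (Suc r) - fps_X * ?Y r"
    unfolding T_def ins by (simp add: algebra_simps)
  moreover have "(1 - x * c) * w = (1 - x * (c + 1)) * z" if "(1 - x * c) * y = z" "w = z - x * y"
    for x c y z w :: "real fps"
  proof -
    have "(1 - x * c) * w = (1 - x * c) * z - x * ((1 - x * c) * y)"
      unfolding that(2) by (simp add: algebra_simps)
    thus ?thesis unfolding that(1) by (simp add: algebra_simps)
  qed
  ultimately have "(1 - fps_X * fps_const (?s r)) * T r = (1 - fps_X * (fps_const (?s r) + 1)) * T (Suc r)"
    by blast
  hence "(1 - fps_X * fps_const (?s r)) * T r = (1 - fps_X * fps_const (?s r + 1)) * T (Suc r)"
    by (simp flip: fps_const_add)
  from arg_cong[OF this, of "\<lambda>x. x * (\<Prod>i\<in>{Suc r..<N}. 1 - fps_X * fps_const (?s i))"]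
  have "T r * ((1 - fps_X * fps_const (?s r)) * (\<Prod>i\<in>{Suc r..<N}. 1 - fps_X * fps_const (?s i)))
     = (1 - fps_X * fps_const (?s r + 1)) * (T (Suc r) * (\<Prod>i\<in>{Suc r..<N}. 1 - fps_X * fps_const (?s i)))"
    by (simp only: mult_ac)
  hence "T r * (\<Prod>i\<in>{r..<N}. 1 - fps_X * fps_const (?s i))
     = (1 - fps_X * fps_const (?s r + 1)) * (T (Suc r) * (\<Prod>i\<in>{Suc r..<N}. 1 - fps_X * fps_const (?s i)))"
    by (simp only: prod.atLeast_Suc_lessThan[OF r])
  also have "T (Suc r) * (\<Prod>i\<in>{Suc r..<N}. 1 - fps_X * fps_const (?s i))
     = (\<Prod>i\<in>{Suc r..<N}. 1 - fps_X * fps_const (?s i + 1))"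
    unfolding T_def using Suc r by (intro Suc.hyps(1)) auto
  finally show ?case unfolding T_def[symmetric] by (simp only: prod.atLeast_Suc_lessThan[OF r])
qed

text \<open>After cancellation of the common factors let x be the largest element of the symmetric
  difference. The root 1 / (x + 1) of the side containing x must be a root of the other side, which
  would require x to lie in the opposite difference, or x + 1 in the same one. Nonnegativity keeps x
  + 1 nonzero.\<close>

lemma shifted_products_inj:
  fixes A B :: "real set"
  assumes "finite A" "finite B" "\<And>x. x \<in> A \<union> B \<Longrightarrow> x \<ge> 0"
    "(\<Prod>a\<in>A. [:1, - (a + 1):]) * (\<Prod>b\<in>B. [:1, - b:]) = (\<Prod>b\<in>B. [:1, - (b + 1):]) * (\<Prod>a\<in>A. [:1, - a:])"
  shows "A = B"
proof (rule ccontr)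
  assume "A \<noteq> B"
  let ?f = "\<lambda>a. [:1, - (a + 1):] :: real poly" and ?g = "\<lambda>a. [:1, - a:] :: real poly"
  let ?C = "A \<inter> B"
  have "prod ?f ?C * prod ?g ?C * (prod ?f (A - B) * prod ?g (B - A))
      = prod ?f ?C * prod ?g ?C * (prod ?f (B - A) * prod ?g (A - B))"
    using assms(4) prod.Int_Diff[OF assms(1), of ?f B] prod.Int_Diff[OF assms(2), of ?g A]
      prod.Int_Diff[OF assms(1), of ?g B] prod.Int_Diff[OF assms(2), of ?f A]
    by (simp only: Int_commute[of B A] mult_ac)
  moreover have "prod ?f ?C * prod ?g ?C \<noteq> 0" using assms(1) by simp
  ultimately have eq: "prod ?f (A - B) * prod ?g (B - A) = prod ?f (B - A) * prod ?g (A - B)"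
    by (simp only: mult_cancel_left) blast
  define x where "x = Max ((A - B) \<union> (B - A))"
  have ne: "(A - B) \<union> (B - A) \<noteq> {}" using \<open>A \<noteq> B\<close> by auto
  have fin: "finite ((A - B) \<union> (B - A))" using assms by auto
  have mx: "y \<le> x" if "y \<in> (A - B) \<union> (B - A)" for y
    unfolding x_def using that fin by (rule Max_ge[rotated])
  have x: "x \<in> (A - B) \<union> (B - A)" unfolding x_def using fin ne by (rule Max_in)
  have key: False if D: "x \<in> P - Q" "finite P" "finite Q" "x \<ge> 0"
    "\<And>y. y \<in> P - Q \<Longrightarrow> y \<le> x"
    "prod ?f (P - Q) * prod ?g (Q - P) = prod ?f (Q - P) * prod ?g (P - Q)" for P Q
  proof -
    let ?t = "1 / (x + 1)"
    have "poly (?f x) ?t = 0" using D(4) by (simp add: field_simps)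
    hence "poly (prod ?f (P - Q)) ?t = 0"
      unfolding poly_prod using D(1,2) by (intro prod_zero) blast+
    hence "poly (prod ?f (Q - P) * prod ?g (P - Q)) ?t = 0"
      using arg_cong[OF D(6), of "\<lambda>p. poly p ?t"] by simp
    then consider y where "y \<in> Q - P" "poly (?f y) ?t = 0" | y where "y \<in> P - Q" "poly (?g y) ?t = 0"
      using D(2,3) by (auto simp: poly_prod)
    thus False
    proof cases
      case (1 y)
      hence "y = x" using D(4) by (simp add: field_simps)
      thus False using 1 D(1) by auto
    next
      case (2 y)
      hence "y = x + 1" using D(4) by (simp add: field_simps)
      thus False using D(5)[OF 2(1)] by simp
    qed
  qed
  have x0: "x \<ge> 0" using x assms(3) by auto
  from x show False
  proof
    assume "x \<in> A - B"
    from key[OF this assms(1,2) x0 _ eq] mx show False by blast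
  next
    assume "x \<in> B - A"
    from key[OF this assms(2,1) x0 _ eq[symmetric]] mx show False by blast
  qed
qed

text \<open>The index is a rank: exactly \<open>i\<close> elements of the image exceed the value at
  \<open>i\<close>.\<close>

lemma strict_decreasing_image_inj:
  fixes s t :: "nat \<Rightarrow> real"
  assumes "\<And>i j. i < j \<Longrightarrow> j < N \<Longrightarrow> s j < s i" "\<And>i j. i < j \<Longrightarrow> j < N \<Longrightarrow> t j < t i"
    "s ` {..<N} = t ` {..<N}" "i < N"
  shows "s i = t i"
proof -
  have rank: "card {x \<in> f ` {..<N}. x > f i} = i"
    if dec: "\<And>i j. i < j \<Longrightarrow> j < N \<Longrightarrow> f j < f i" and i: "i < N" for f :: "nat \<Rightarrow> real" and i
  proof -
    have lt: "f i < f j \<longleftrightarrow> j < i" if "j < N" for j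
      using i that dec[of i j] dec[of j i] by (cases i j rule: linorder_cases) auto
    have "{x \<in> f ` {..<N}. x > f i} = f ` {..<i}" using i lt by force
    moreover have "inj_on f {..<i}"
    proof (rule inj_onI)
      fix x y assume xy: "x \<in> {..<i}" "y \<in> {..<i}" "f x = f y"
      thus "x = y" using dec[of x y] dec[of y x] i
        by (cases x y rule: linorder_cases) auto
    qed
    ultimately show ?thesis by (simp add: card_image)
  qed
  obtain j where j: "j < N" "s i = t j" using assms(3,4) by (auto simp: set_eq_iff image_iff)
  have "i = card {x \<in> s ` {..<N}. x > s i}" using rank[where f = s, OF assms(1,4)] by simp
  also have "\<dots> = card {x \<in> t ` {..<N}. x > t j}" using assms(3) j by simp
  also have "\<dots> = j" using rank[where f = t, OF assms(2) j(1)] by simp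
  finally show ?thesis using j by simp
qed

text \<open>The eigenvalues are the coefficients of positive order of the sum of the series in
  \<open>fps_heck_prod\<close>, and its constant term is \<open>N\<close> for every partition. So
  the product formula gives the set of shifted parts, which is strictly decreasing in the row and
  therefore determines every part.\<close>

lemma lax_eigenvalue_inj:
  assumes "\<alpha> > 0" "psize l \<le> N" "psize m \<le> N"
    "\<And>k. lax_eigenvalue \<alpha> N k l = lax_eigenvalue \<alpha> N k m"
  shows "l = m"
proof -
  let ?s = "jack_content \<alpha> N"
  define Y where "Y l i = Abs_fps (\<lambda>k. heck_coef \<alpha> N l k (part l i))" for l i
  have "(\<Sum>i\<in>{0..<N}. Y l i) = (\<Sum>i\<in>{0..<N}. Y m i)"
  proof (rule fps_ext)
    fix k
    show "fps_nth (\<Sum>i\<in>{0..<N}. Y l i) k = fps_nth (\<Sum>i\<in>{0..<N}. Y m i) k"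
    proof (cases k)
      case (Suc k')
      thus ?thesis using assms(4)[of k']
        by (simp add: Y_def fps_sum_nth lax_eigenvalue_def atLeast0LessThan del: heck_coef.simps)
    qed (simp add: Y_def fps_sum_nth)
  qed
  hence T: "1 - fps_X * (\<Sum>i\<in>{0..<N}. Y l i) = 1 - fps_X * (\<Sum>i\<in>{0..<N}. Y m i)" by simp
  have dec: "?s l j < ?s l i" if "i < j" "j < N" for i j l
  proof -
    have "\<alpha> * real (part l j) \<le> \<alpha> * real (part l i)"
      using part_antimono[of i j l] that assms(1) by (intro mult_left_mono) auto
    moreover have "real (N - Suc j) < real (N - Suc i)" using that by simp
    ultimately show ?thesis by linarith
  qed
  have inj: "inj_on (?s l) {..<N}" for l
  proof (rule inj_onI)
    fix x y assume "x \<in> {..<N}" "y \<in> {..<N}" "?s l x = ?s l y"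
    thus "x = y" using dec[of x y l] dec[of y x l] by (cases x y rule: linorder_cases) auto
  qed
  define F where "F l c = (\<Prod>i\<in>{0..<N}. 1 - fps_X * fps_const (?s l i + c))" for l c
  have TF: "(1 - fps_X * (\<Sum>i\<in>{0..<N}. Y l i)) * F l 0 = F l 1" for l
    using fps_heck_prod[of 0 N \<alpha> l] by (simp add: F_def Y_def)
  have "F l 1 * F m 0 = (1 - fps_X * (\<Sum>i\<in>{0..<N}. Y m i)) * F l 0 * F m 0"
    by (simp only: TF[of l, symmetric] T)
  also have "\<dots> = F m 1 * F l 0" by (simp only: TF[of m, symmetric] mult_ac)
  finally have FF: "F l 1 * F m 0 = F m 1 * F l 0" .
  have F_poly: "F l c = fps_of_poly (\<Prod>a\<in>?s l ` {..<N}. [:1, - (a + c):])" for l c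
  proof -
    have "1 - fps_X * fps_const x = fps_of_poly [:1, - x:]" for x :: real
      by (simp add: fps_of_poly_pCons fps_const_neg[symmetric] del: fps_const_neg)
    hence "F l c = (\<Prod>i\<in>{..<N}. fps_of_poly [:1, - (?s l i + c):])"
      unfolding F_def atLeast0LessThan by (simp only:)
    also have "\<dots> = (\<Prod>a\<in>?s l ` {..<N}. fps_of_poly [:1, - (a + c):])"
      by (subst prod.reindex[OF inj]) (simp only: o_def)
    finally show ?thesis by (simp only: fps_of_poly_prod)
  qed
  have "?s l ` {..<N} = ?s m ` {..<N}"
  proof (rule shifted_products_inj)
    show "(\<Prod>a\<in>?s l ` {..<N}. [:1, - (a + 1):]) * (\<Prod>b\<in>?s m ` {..<N}. [:1, - b:])
      = (\<Prod>b\<in>?s m ` {..<N}. [:1, - (b + 1):]) * (\<Prod>a\<in>?s l ` {..<N}. [:1, - a:])"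
      using FF unfolding F_poly by (simp add: fps_of_poly_mult[symmetric] fps_of_poly_eq_iff)
  qed (use assms(1) in auto)
  hence "?s l i = ?s m i" if "i < N" for i
    using that dec by (intro strict_decreasing_image_inj[of N "?s l" "?s m"])
  hence "part l i = part m i" if "i < N" for i
    using that assms(1) by simp
  moreover have "part k i = 0" if "psize k \<le> N" "i \<ge> N" for i k
    using supp_parts_psize[of k] that by (auto simp: part_def in_keys_iff subset_iff)
  ultimately have "part l i = part m i" for i using assms(2,3) by (cases "i < N") auto
  hence "parts l = parts m" by (intro poly_mapping_eqI) (simp add: part_def)
  thus ?thesis by (simp add: parts_inject)
qed

section \<open>Existence and uniqueness of Jack functions\<close>

definition msym_span :: "partition set \<Rightarrow> real mpoly set" where
  "msym_span S = {f. \<exists>c. f = (\<Sum>m\<in>S. mconst (c m) * msym m)}"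

abbreviation strictly_below :: "partition \<Rightarrow> partition set" where
  "strictly_below l \<equiv> {m. dominated m l \<and> m \<noteq> l}"

definition separating :: "real \<Rightarrow> nat \<Rightarrow> (real mpoly \<Rightarrow> real mpoly) \<Rightarrow> (partition \<Rightarrow> real) \<Rightarrow> bool" where
  "separating \<alpha> n E e \<longleftrightarrow> lin E \<and> (\<forall>f g. macdonald_form \<alpha> (E f) g = macdonald_form \<alpha> f (E g)) \<and>
    (\<forall>l. psize l = n \<longrightarrow>
      (\<exists>r\<in>msym_span (strictly_below l). E (msym l) = mconst (e l) * msym l + r)) \<and>
    inj_on e {l. psize l = n}"

text \<open>Each pair of distinct partitions is separated by some moment, and finitely many moments
  cover all pairs in degree \<open>n\<close>. Viewed as polynomials in t, the eigenvalues of the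
  combination with coefficients t^k are then pairwise distinct, so they remain distinct at every t
  outside finitely many roots.\<close>

lemma ex_separating_operator:
  assumes "\<alpha> > 0"
  shows "\<exists>E e. separating \<alpha> n E e"
proof -
  \<comment> \<open>The successor provides a variable also for \<open>n = 0\<close>, as
    \<open>lax_op_msym\<close> requires \<open>0 < N\<close>.\<close>
  define N where "N = Suc n"
  define P where "P = {l. psize l = n}"
  have finP: "finite P" by (simp add: P_def finite_psize)
  let ?ev = "\<lambda>k l. lax_eigenvalue \<alpha> N k l"
  have "\<exists>k. ?ev k (fst z) \<noteq> ?ev k (snd z)" if "z \<in> P \<times> P - Id" for z
    using lax_eigenvalue_inj[OF assms, of "fst z" N "snd z"] that by (force simp: P_def N_def)
  then obtain \<kappa> where \<kappa>: "\<And>z. z \<in> P \<times> P - Id \<Longrightarrow> ?ev (\<kappa> z) (fst z) \<noteq> ?ev (\<kappa> z) (snd z)"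
    by metis
  obtain K where K: "\<And>z. z \<in> P \<times> P - Id \<Longrightarrow> \<kappa> z \<le> K"
    using finite_nat_set_iff_bounded_le[of "\<kappa> ` (P \<times> P - Id)"] finP by auto
  define q where "q l = (\<Sum>k\<le>K. monom (?ev k l) k)" for l
  have q_coeff: "coeff (q l) k = (if k \<le> K then ?ev k l else 0)" for l k
    by (simp add: q_def coeff_sum)
  have "q (fst z) - q (snd z) \<noteq> 0" if z: "z \<in> P \<times> P - Id" for z
  proof
    assume "q (fst z) - q (snd z) = 0"
    hence "coeff (q (fst z)) (\<kappa> z) = coeff (q (snd z)) (\<kappa> z)" by simp
    thus False using \<kappa>[OF z] K[OF z] by (simp add: q_coeff)
  qed
  hence "finite (\<Union>z\<in>P \<times> P - Id. {t. poly (q (fst z) - q (snd z)) t = 0})"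
    using finP by (intro finite_UN_I poly_roots_finite) auto
  then obtain t where t: "t \<notin> (\<Union>z\<in>P \<times> P - Id. {t. poly (q (fst z) - q (snd z)) t = 0})"
    using ex_new_if_finite[OF infinite_UNIV_char_0] by blast
  define E where "E f = (\<Sum>k\<le>K. mconst (t ^ k) * lax_op \<alpha> N n k f)" for f
  define e where "e l = poly (q l) t" for l
  have "separating \<alpha> n E e"
    unfolding separating_def
  proof (intro conjI allI impI)
    show "lin E" unfolding E_def by (intro lin_sum_intro lin_basic lin_lax_op)
    have "macdonald_form \<alpha> (E f) g = macdonald_form \<alpha> g (E f)" for f g by (rule mform_sym)
    also have "macdonald_form \<alpha> g (E f) = (\<Sum>k\<le>K. t ^ k * macdonald_form \<alpha> (lax_op \<alpha> N n k f) g)" for f g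
      unfolding E_def mform_sum mform_scale by (simp only: mform_sym[of \<alpha> g])
    finally show "macdonald_form \<alpha> (E f) g = macdonald_form \<alpha> f (E g)" for f g
      unfolding E_def mform_sum mform_scale lax_op_adjoint by simp
    show "inj_on e {l. psize l = n}"
    proof (rule inj_onI)
      fix l m assume lm: "l \<in> {l. psize l = n}" "m \<in> {l. psize l = n}" "e l = e m"
      show "l = m"
      proof (rule ccontr)
        assume "l \<noteq> m"
        hence "(l, m) \<in> P \<times> P - Id" using lm by (auto simp: P_def)
        hence "poly (q l - q m) t \<noteq> 0" using t by force
        thus False using lm(3) by (simp add: e_def)
      qed
    qed
    fix l assume l: "psize l = n"
    let ?D = "{m. dominated m l \<and> m \<noteq> l}"
    have "\<forall>k. \<exists>u. lax_op \<alpha> N n k (msym l) = mconst (?ev k l) * msym l + (\<Sum>m\<in>?D. mconst (u m) * msym m)"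
      using lax_op_msym[of N l n \<alpha>] l by (auto simp: N_def)
    from choice[OF this] obtain u where "\<forall>k. lax_op \<alpha> N n k (msym l)
        = mconst (?ev k l) * msym l + (\<Sum>m\<in>?D. mconst (u k m) * msym m)" by blast
    note u = this[rule_format]
    have mconst_sum: "mconst (\<Sum>k\<le>K. c k) = (\<Sum>k\<le>K. mconst (c k))" for c :: "nat \<Rightarrow> real"
      by (induction K) (simp_all add: mconst_hom)
    have "E (msym l) = (\<Sum>k\<le>K. mconst (t ^ k * ?ev k l) * msym l + (\<Sum>m\<in>?D. mconst (t ^ k * u k m) * msym m))"
      unfolding E_def u by (simp only: distrib_left sum_distrib_left mconst_hom(4) mult.assoc)
    also have "\<dots> = (\<Sum>k\<le>K. mconst (t ^ k * ?ev k l)) * msym l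
        + (\<Sum>k\<le>K. \<Sum>m\<in>?D. mconst (t ^ k * u k m) * msym m)"
      by (simp only: sum.distrib sum_distrib_right)
    also have "(\<Sum>k\<le>K. \<Sum>m\<in>?D. mconst (t ^ k * u k m) * msym m)
        = (\<Sum>m\<in>?D. mconst (\<Sum>k\<le>K. t ^ k * u k m) * msym m)"
      unfolding mconst_sum sum_distrib_right by (rule sum.swap)
    also have "(\<Sum>k\<le>K. mconst (t ^ k * ?ev k l)) = mconst (e l)"
      unfolding mconst_sum[symmetric] e_def q_def poly_sum poly_monom by (simp only: mult.commute)
    finally show "\<exists>r\<in>msym_span ?D. E (msym l) = mconst (e l) * msym l + r"
      by (rule bexI) (auto simp: msym_span_def)
  qed
  thus ?thesis by blast
qed

section \<open>Spans of monomial functions and triangular systems\<close>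

lemma msym_span_0: "0 \<in> msym_span S"
  unfolding msym_span_def by (auto intro!: exI[of _ "\<lambda>_. 0"] simp: mconst_hom)

lemma msym_span_add: "f \<in> msym_span S \<Longrightarrow> g \<in> msym_span S \<Longrightarrow> f + g \<in> msym_span S"
proof -
  assume "f \<in> msym_span S" "g \<in> msym_span S"
  then obtain c d where "f = (\<Sum>m\<in>S. mconst (c m) * msym m)" "g = (\<Sum>m\<in>S. mconst (d m) * msym m)"
    by (auto simp: msym_span_def)
  hence "f + g = (\<Sum>m\<in>S. mconst (c m + d m) * msym m)"
    by (simp add: mconst_hom distrib_right sum.distrib)
  thus ?thesis by (auto simp: msym_span_def)
qed

lemma msym_span_scale: "f \<in> msym_span S \<Longrightarrow> mconst a * f \<in> msym_span S"
proof -
  assume "f \<in> msym_span S"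
  then obtain c where "f = (\<Sum>m\<in>S. mconst (c m) * msym m)" by (auto simp: msym_span_def)
  hence "mconst a * f = (\<Sum>m\<in>S. mconst (a * c m) * msym m)"
    by (simp add: mconst_hom sum_distrib_left mult.assoc)
  thus ?thesis by (auto simp: msym_span_def)
qed

lemma msym_span_diff: "f \<in> msym_span S \<Longrightarrow> g \<in> msym_span S \<Longrightarrow> f - g \<in> msym_span S"
  using msym_span_add[of f S "mconst (-1) * g"] msym_span_scale[of g S "-1"]
  by (simp add: mconst_hom)

lemma msym_span_mono:
  assumes "finite T" "S \<subseteq> T"
  shows "msym_span S \<subseteq> msym_span T"
proof
  fix f assume "f \<in> msym_span S"
  then obtain c where c: "f = (\<Sum>m\<in>S. mconst (c m) * msym m)" by (auto simp: msym_span_def)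
  have "(\<Sum>m\<in>T. mconst (if m \<in> S then c m else 0) * msym m)
      = (\<Sum>m\<in>S. mconst (if m \<in> S then c m else 0) * msym m)"
    using assms by (intro sum.mono_neutral_right) (auto simp: mconst_hom)
  also have "\<dots> = f" unfolding c by (intro sum.cong) auto
  finally show "f \<in> msym_span T" unfolding msym_span_def by (auto intro: sym)
qed

lemma msym_in_span:
  assumes "finite S" "m \<in> S"
  shows "msym m \<in> msym_span S"
proof -
  have "(\<Sum>k\<in>S. mconst (if k = m then 1 else 0) * msym k) = (\<Sum>k\<in>S. if k = m then msym k else 0)"
    by (intro sum.cong) (auto simp: mconst_hom)
  also have "\<dots> = msym m" using assms by simp
  finally show ?thesis unfolding msym_span_def by (auto intro: sym)
qed

lemma homog_msym_span: "(\<And>m. m \<in> S \<Longrightarrow> psize m = n) \<Longrightarrow> f \<in> msym_span S \<Longrightarrow> homog n f"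
  unfolding msym_span_def by (auto intro!: homog_sum homog_scale) (metis homog_msym)

lemma finite_strictly_below: "finite (strictly_below l)"
  by (rule finite_subset[OF _ finite_dominated[of l]]) auto

text \<open>The number of partitions strictly below serves as a height for inductions along
  dominance.\<close>

lemma card_strictly_below:
  assumes "dominated m l" "m \<noteq> l"
  shows "card (strictly_below m) < card (strictly_below l)"
proof (rule psubset_card_mono[OF finite_strictly_below])
  show "strictly_below m \<subset> strictly_below l"
    using assms dominated_trans dominated_antisym by blast
qed

text \<open>Back substitution. An element \<open>m\<close> of maximal height can be removed without
  destroying closure under dominance; its coefficient is divided by \<open>e m - x\<close>, which is
  nonzero, and the correction lies in the smaller span.\<close>

lemma solve_triangular:
  assumes "finite S" "\<And>m k. m \<in> S \<Longrightarrow> dominated k m \<Longrightarrow> k \<in> S" "lin E" "x \<notin> e ` S"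
    "\<And>l. l \<in> S \<Longrightarrow> \<exists>r\<in>msym_span (strictly_below l). E (msym l) = mconst (e l) * msym l + r"
    "h \<in> msym_span S"
  shows "\<exists>g\<in>msym_span S. E g - mconst x * g = h"
  using assms(1,2,4-6)
proof (induction "card S" arbitrary: S h)
  case 0
  hence "h = 0" by (auto simp: msym_span_def)
  thus ?case using msym_span_0 by (auto intro!: bexI[of _ 0] simp: lin_zero assms(3))
next
  case (Suc n)
  let ?c = "\<lambda>l. card (strictly_below l)"
  have "Max (?c ` S) \<in> ?c ` S" using Suc by (intro Max_in) auto
  then obtain m where m: "m \<in> S" "Max (?c ` S) = ?c m" by auto
  hence mx: "?c k \<le> ?c m" if "k \<in> S" for k
    using Max_ge[of "?c ` S" "?c k"] Suc.prems(1) that by auto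
  let ?S = "S - {m}"
  have down: "k \<in> ?S" if "j \<in> ?S" "dominated k j" for j k
    using that Suc.prems(2)[of j k] card_strictly_below[of k j] mx[of j] by auto
  have sub: "strictly_below m \<subseteq> ?S" using Suc.prems(2)[OF m(1)] by auto
  obtain c where c: "h = (\<Sum>k\<in>S. mconst (c k) * msym k)" using Suc.prems by (auto simp: msym_span_def)
  define h' where "h' = (\<Sum>k\<in>?S. mconst (c k) * msym k)"
  have h: "h = mconst (c m) * msym m + h'"
    unfolding c h'_def using Suc.prems(1) m by (simp add: sum.remove)
  have ex: "e m - x \<noteq> 0" using Suc.prems(3) m by auto
  obtain r where r: "r \<in> msym_span (strictly_below m)" "E (msym m) = mconst (e m) * msym m + r"
    using Suc.prems(4)[OF m(1)] by auto
  define a where "a = c m / (e m - x)"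
  have "a * (e m - x) = c m" using ex by (simp add: a_def)
  hence a: "a * e m - x * a = c m" by (simp add: algebra_simps)
  have "mconst a * r \<in> msym_span ?S"
    using msym_span_mono[OF _ sub] Suc.prems(1) r(1) by (intro msym_span_scale) auto
  hence "h' - mconst a * r \<in> msym_span ?S"
    by (intro msym_span_diff) (auto simp: h'_def msym_span_def)
  moreover have "n = card ?S" using Suc.hyps(2) Suc.prems(1) m by simp
  ultimately obtain g where g: "g \<in> msym_span ?S" "E g - mconst x * g = h' - mconst a * r"
    using Suc.hyps(1)[of ?S "h' - mconst a * r"] Suc.prems(1,3,4) down by blast
  have "mconst a * msym m + g \<in> msym_span S"
    using g(1) msym_span_mono[of S ?S] Suc.prems(1) m
    by (intro msym_span_add msym_span_scale msym_in_span) auto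
  moreover have "E (mconst a * msym m + g) - mconst x * (mconst a * msym m + g) = h"
  proof -
    have "E (mconst a * msym m + g) - mconst x * (mconst a * msym m + g)
      = (mconst a * mconst (e m) - mconst x * mconst a) * msym m + mconst a * r + (E g - mconst x * g)"
      unfolding lin_add[OF assms(3)] lin_scale[OF assms(3)] r(2) by (simp only: algebra_simps)
    also have "mconst a * mconst (e m) - mconst x * mconst a = mconst (c m)"
      unfolding a[symmetric] mconst_hom ..
    finally show ?thesis unfolding g(2) h by simp
  qed
  ultimately show ?case by blast
qed

lemma mform_homog_neq:
  assumes "homog n f" "homog k g" "n \<noteq> k"
  shows "macdonald_form \<alpha> f g = 0"
  unfolding macdonald_form_def
proof (rule sum.neutral, rule ballI)
  fix d assume "d \<in> supp f"
  hence "d \<notin> supp g" using assms by (auto simp: homog_def)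
  thus "coef f d * coef g d * mon_norm \<alpha> d = 0" by (simp add: in_keys_iff)
qed

text \<open>The coefficients in the definition are common to all \<open>N\<close>, so by
  \<open>expand_inj\<close> the condition becomes one identity in the power sum ring.\<close>

lemma jack_family_iff: "is_jack_family \<alpha> J \<longleftrightarrow>
  (\<forall>l. J l - msym l \<in> msym_span (strictly_below l)) \<and> (\<forall>l m. l \<noteq> m \<longrightarrow> macdonald_form \<alpha> (J l) (J m) = 0)"
proof -
  have "(\<exists>u. \<forall>N. expand N (J l) = monomial_sym N l + (\<Sum>m\<in>strictly_below l. mconst (u m) * monomial_sym N m))
    \<longleftrightarrow> J l - msym l \<in> msym_span (strictly_below l)" for l
  proof -
    have e: "expand N (msym l + (\<Sum>m\<in>strictly_below l. mconst (u m) * msym m))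
       = monomial_sym N l + (\<Sum>m\<in>strictly_below l. mconst (u m) * monomial_sym N m)" for u N
      by (simp add: lin_add[OF lin_expand] lin_sum[OF lin_expand] lin_scale[OF lin_expand] expand_msym)
    have "(\<forall>N. expand N (J l) = monomial_sym N l + (\<Sum>m\<in>strictly_below l. mconst (u m) * monomial_sym N m))
      \<longleftrightarrow> J l = msym l + (\<Sum>m\<in>strictly_below l. mconst (u m) * msym m)" for u
      unfolding e[symmetric] by (rule iffI, rule expand_inj, blast, simp)
    thus ?thesis by (simp add: msym_span_def diff_eq_eq add.commute)
  qed
  thus ?thesis by (simp add: is_jack_family_def)
qed

lemma strictly_below_psize: "m \<in> strictly_below l \<Longrightarrow> psize m = psize l"
  by (simp add: dominated_def)

lemma homog_jack:
  assumes "is_jack_family \<alpha> J"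
  shows "homog (psize l) (J l)"
proof -
  have "homog (psize l) (J l - msym l)"
    using assms by (intro homog_msym_span[of "strictly_below l"]) (auto simp: jack_family_iff dominated_def)
  from homog_add[OF this homog_msym] show ?thesis by simp
qed

text \<open>The eigenvector is \<open>msym l + g\<close>, where \<open>g\<close> solves the
  triangular system strictly below \<open>l\<close> that cancels the remainder \<open>r\<close>;
  injectivity of the eigenvalues makes this system solvable. Self-adjointness gives orthogonality
  within a degree, the grading between degrees.\<close>

lemma ex_jack_family:
  assumes "\<alpha> > 0"
  shows "\<exists>J. is_jack_family \<alpha> J"
proof -
  have "\<forall>n. \<exists>z. separating \<alpha> n (fst z) (snd z)"
    using ex_separating_operator[OF assms] by simp
  from choice[OF this] obtain z where z: "\<forall>n. separating \<alpha> n (fst (z n)) (snd (z n))" by blast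
  define E e where "E n = fst (z n)" and "e n = snd (z n)" for n
  have sep: "separating \<alpha> n (E n) (e n)" for n using z by (simp add: E_def e_def)
  have lin: "lin (E n)" and adj: "macdonald_form \<alpha> (E n f) g = macdonald_form \<alpha> f (E n g)"
    and inj: "inj_on (e n) {l. psize l = n}" for n f g
    using sep[of n] unfolding separating_def by blast+
  have tri': "\<exists>r\<in>msym_span (strictly_below l). E n (msym l) = mconst (e n l) * msym l + r"
    if "psize l = n" for n l
    using sep[of n] that unfolding separating_def by blast
  have "\<exists>J. J - msym l \<in> msym_span (strictly_below l) \<and> E (psize l) J = mconst (e (psize l) l) * J" for l
  proof -
    let ?n = "psize l"
    obtain r where r: "r \<in> msym_span (strictly_below l)" "E ?n (msym l) = mconst (e ?n l) * msym l + r"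
      using tri' by blast
    have "\<exists>g\<in>msym_span (strictly_below l). E ?n g - mconst (e ?n l) * g = 0 - r"
    proof (rule solve_triangular[where e = "e ?n"])
      show "k \<in> strictly_below l" if "m \<in> strictly_below l" "dominated k m" for m k
        using that dominated_trans dominated_antisym by blast
      show "e ?n l \<notin> e ?n ` strictly_below l"
      proof
        assume "e ?n l \<in> e ?n ` strictly_below l"
        then obtain m where m: "m \<in> strictly_below l" "e ?n l = e ?n m" by auto
        hence "l = m" using inj_onD[OF inj m(2)] strictly_below_psize by simp
        thus False using m by simp
      qed
      show "0 - r \<in> msym_span (strictly_below l)" using r(1) msym_span_0 by (intro msym_span_diff)
      show "\<exists>r\<in>msym_span (strictly_below m). E ?n (msym m) = mconst (e ?n m) * msym m + r"
        if "m \<in> strictly_below l" for m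
        using that strictly_below_psize by (intro tri')
    qed (auto simp: finite_strictly_below lin)
    then obtain g where g: "g \<in> msym_span (strictly_below l)" "E ?n g - mconst (e ?n l) * g = 0 - r"
      by auto
    have "E ?n (msym l + g) - mconst (e ?n l) * (msym l + g) = r + (E ?n g - mconst (e ?n l) * g)"
      unfolding lin_add[OF lin] r(2) by (simp add: algebra_simps)
    hence "E ?n (msym l + g) = mconst (e ?n l) * (msym l + g)" unfolding g(2) by simp
    thus ?thesis using g(1) by (intro exI[of _ "msym l + g"]) simp
  qed
  then obtain J where J: "\<And>l. J l - msym l \<in> msym_span (strictly_below l)"
    "\<And>l. E (psize l) (J l) = mconst (e (psize l) l) * J l" by metis
  have hom: "homog (psize l) (J l)" for l
  proof -
    have "homog (psize l) (J l - msym l)"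
      by (rule homog_msym_span[OF _ J(1)]) (rule strictly_below_psize)
    from homog_add[OF this homog_msym] show ?thesis by simp
  qed
  have "macdonald_form \<alpha> (J l) (J m) = 0" if "l \<noteq> m" for l m
  proof (cases "psize l = psize m")
    case True
    let ?n = "psize m"
    have "e ?n l * macdonald_form \<alpha> (J l) (J m) = macdonald_form \<alpha> (J m) (E ?n (J l))"
      unfolding J(2)[of l, unfolded True] mform_scale by (subst mform_sym) (rule refl)
    also have "\<dots> = macdonald_form \<alpha> (J l) (E ?n (J m))"
      by (subst mform_sym) (rule adj)
    also have "\<dots> = e ?n m * macdonald_form \<alpha> (J l) (J m)"
      using J(2)[of m] by (simp add: mform_scale)
    finally have "(e ?n l - e ?n m) * macdonald_form \<alpha> (J l) (J m) = 0" by (simp add: algebra_simps)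
    moreover have "e ?n l \<noteq> e ?n m" using inj_onD[OF inj[of ?n], of l m] True that by auto
    ultimately show ?thesis by simp
  next
    case False
    thus ?thesis by (rule mform_homog_neq[OF hom hom])
  qed
  thus ?thesis using J(1) by (auto simp: jack_family_iff)
qed

text \<open>On a set closed downwards, triangularity passes orthogonality from the family to the
  monomial functions. Thus \<open>f\<close> is orthogonal to itself, and the form is positive
  definite.\<close>

lemma jack_family_orthogonal_eq_0:
  assumes "\<alpha> > 0" "is_jack_family \<alpha> J" "\<And>m k. m \<in> S \<Longrightarrow> dominated k m \<Longrightarrow> k \<in> S"
    "f \<in> msym_span S" "\<And>k. k \<in> S \<Longrightarrow> macdonald_form \<alpha> f (J k) = 0"
  shows "f = 0"
proof -
  have m: "macdonald_form \<alpha> f (msym k) = 0" if "k \<in> S" for k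
    using that
  proof (induction "card (strictly_below k)" arbitrary: k rule: less_induct)
    case less
    have "J k - msym k \<in> msym_span (strictly_below k)" using assms(2) by (simp add: jack_family_iff)
    then obtain u where u: "J k - msym k = (\<Sum>m\<in>strictly_below k. mconst (u m) * msym m)"
      by (auto simp: msym_span_def)
    have "macdonald_form \<alpha> f (msym m) = 0" if "m \<in> strictly_below k" for m
      using that less.hyps[of m] card_strictly_below assms(3)[OF less.prems] by auto
    hence "macdonald_form \<alpha> f (J k - msym k) = 0" unfolding u mform_sum mform_scale by simp
    thus ?case using assms(5)[OF less.prems] by (simp add: mform_diff)
  qed
  obtain c where c: "f = (\<Sum>m\<in>S. mconst (c m) * msym m)" using assms(4) by (auto simp: msym_span_def)
  have "macdonald_form \<alpha> f f = (\<Sum>k\<in>S. c k * macdonald_form \<alpha> f (msym k))"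
    by (subst (2) c) (simp only: mform_sum mform_scale)
  hence "macdonald_form \<alpha> f f = 0" using m by simp
  thus ?thesis using mform_pos[OF assms(1)] by force
qed

text \<open>The leading terms cancel in the difference, which lies strictly below \<open>l\<close>.
  There both families agree by induction, and the difference is orthogonal to them.\<close>

lemma jack_family_unique:
  assumes "\<alpha> > 0" "is_jack_family \<alpha> J" "is_jack_family \<alpha> J'"
  shows "J = J'"
proof
  fix l
  show "J l = J' l"
  proof (induction "card (strictly_below l)" arbitrary: l rule: less_induct)
    case less
    let ?S = "strictly_below l"
    have IH: "J k = J' k" if "k \<in> ?S" for k using less card_strictly_below that by auto
    have "J l - J' l = 0"
    proof (rule jack_family_orthogonal_eq_0[OF assms(1,2), of ?S])
      show "k \<in> ?S" if "m \<in> ?S" "dominated k m" for m k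
        using that dominated_trans dominated_antisym by blast
      have "(J l - msym l) - (J' l - msym l) \<in> msym_span ?S"
        using assms(2,3) unfolding jack_family_iff by (intro msym_span_diff[of "J l - msym l" _ "J' l - msym l"]) blast+
      thus "J l - J' l \<in> msym_span ?S" by simp
      fix k assume k: "k \<in> ?S"
      have "macdonald_form \<alpha> (J k) (J l) = 0" "macdonald_form \<alpha> (J' k) (J' l) = 0"
        using k assms(2,3) by (auto simp: jack_family_iff)
      hence "macdonald_form \<alpha> (J k) (J l - J' l) = 0" using IH[OF k] by (simp add: mform_diff)
      thus "macdonald_form \<alpha> (J l - J' l) (J k) = 0" by (subst mform_sym)
    qed
    thus ?case by simp
  qed
qed

lemma macdonald_jack: "\<alpha> > 0 \<Longrightarrow> is_jack_family \<alpha> (macdonald_jack \<alpha>)"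
  unfolding macdonald_jack_def
  by (rule theI'[of "is_jack_family \<alpha>"], rule ex_ex1I, erule ex_jack_family, erule (2) jack_family_unique)

lemma jack_nonzero:
  assumes "\<alpha> > 0"
  shows "macdonald_jack \<alpha> l \<noteq> 0"
proof
  assume 0: "macdonald_jack \<alpha> l = 0"
  let ?N = "psize l"
  obtain u where u: "\<forall>N. expand N (macdonald_jack \<alpha> l)
      = monomial_sym N l + (\<Sum>m\<in>strictly_below l. mconst (u m) * monomial_sym N m)"
    using macdonald_jack[OF assms] unfolding is_jack_family_def by blast
  have "monomial_sym ?N l + (\<Sum>m\<in>strictly_below l. mconst (u m) * monomial_sym ?N m) = 0"
    unfolding u[rule_format, symmetric] 0 by (rule lin_zero[OF lin_expand])
  hence "coef (monomial_sym ?N l + (\<Sum>m\<in>strictly_below l. mconst (u m) * monomial_sym ?N m)) (parts l) = 0"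
    by (simp only: lookup_zero)
  moreover have "coef (monomial_sym ?N l + (\<Sum>m\<in>strictly_below l. mconst (u m) * monomial_sym ?N m)) (parts l)
    = 1 + (\<Sum>m\<in>strictly_below l. 0)"
    unfolding lookup_add lookup_sum using supp_parts_psize[of l]
    by (intro arg_cong2[of _ _ _ _ "(+)"] sum.cong refl) (auto simp: coef_monomial_sym shape_parts_inj)
  ultimately show False by simp
qed

section \<open>Completeness\<close>

text \<open>The column orthogonality dual to the orthogonality of the family: expand the monomial
  \<open>d\<close> in the Jack basis and compare coefficients at \<open>d'\<close>. The residue
  \<open>g\<close> of the expansion is orthogonal to the basis, hence zero.\<close>

lemma jack_completeness:
  assumes "\<alpha> > 0" "wt d = n" "wt d' = n"
  defines "J \<equiv> macdonald_jack \<alpha>"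
  shows "(\<Sum>l | psize l = n. coef (J l) d * coef (J l) d' / macdonald_form \<alpha> (J l) (J l))
    = (if d = d' then 1 / mon_norm \<alpha> d else 0)"
proof -
  let ?P = "{l. psize l = n}" and ?nl = "\<lambda>l. macdonald_form \<alpha> (J l) (J l)"
  have fam: "is_jack_family \<alpha> J" unfolding J_def by (rule macdonald_jack[OF assms(1)])
  have nl: "?nl l > 0" for l
    unfolding J_def using assms(1) by (intro mform_pos jack_nonzero)
  have homJ: "homog n (J l)" if "psize l = n" for l using homog_jack[OF fam, of l] that by simp
  define c where "c l = coef (J l) d * mon_norm \<alpha> d / ?nl l" for l
  define g where "g = mon d - (\<Sum>l\<in>?P. mconst (c l) * J l)"
  have mJ: "macdonald_form \<alpha> (J k) (mon d) = coef (J k) d * mon_norm \<alpha> d" for k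
  proof -
    have "macdonald_form \<alpha> (mon d) (J k) = coef (J k) d * mon_norm \<alpha> d"
      by (simp add: macdonald_form_def)
    thus ?thesis by (subst mform_sym)
  qed
  have "g = 0"
  proof (rule jack_family_orthogonal_eq_0[OF assms(1) fam, of ?P])
    show "k \<in> ?P" if "m \<in> ?P" "dominated k m" for m k using that by (simp add: dominated_def)
    have "homog n g" unfolding g_def
      using assms(2) homJ by (intro homog_diff homog_mon homog_sum homog_scale) auto
    from eq_sum_msym[OF this order.refl] show "g \<in> msym_span ?P"
      unfolding msym_span_def by (intro CollectI exI)
    fix k assume k: "k \<in> ?P"
    have "macdonald_form \<alpha> (J k) g = coef (J k) d * mon_norm \<alpha> d - (\<Sum>l\<in>?P. c l * macdonald_form \<alpha> (J k) (J l))"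
      by (simp only: g_def mform_diff mform_sum mform_scale mJ)
    also have "(\<Sum>l\<in>?P. c l * macdonald_form \<alpha> (J k) (J l)) = (\<Sum>l\<in>?P. if l = k then c k * ?nl k else 0)"
      using fam by (intro sum.cong refl) (auto simp: jack_family_iff)
    also have "\<dots> = coef (J k) d * mon_norm \<alpha> d"
      using k finite_psize[of n] nl[of k] by (simp add: c_def)
    finally show "macdonald_form \<alpha> g (J k) = 0" by (subst mform_sym) simp
  qed
  hence "coef (mon d) d' = coef (\<Sum>l\<in>?P. mconst (c l) * J l) d'" by (simp add: g_def)
  also have "\<dots> = (\<Sum>l\<in>?P. c l * coef (J l) d')" by (simp add: lookup_sum)
  also have "\<dots> = mon_norm \<alpha> d * (\<Sum>l\<in>?P. coef (J l) d * coef (J l) d' / ?nl l)"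
    unfolding sum_distrib_left by (intro sum.cong refl) (simp add: c_def)
  finally show ?thesis using mon_norm_pos[OF assms(1), of d] by (auto simp: coef_single field_simps split: if_splits)
qed

section \<open>Jack polynomials in the Hermitian normalization\<close>

lemma eps_pair:
  assumes "h > 0"
  shows "eps2 e h < 0 \<and> 0 < eps1 e h \<and> eps1 e h + eps2 e h = e \<and> - (eps1 e h * eps2 e h) = h"
proof -
  let ?P = "\<lambda>p :: real \<times> real. snd p < 0 \<and> 0 < fst p \<and> fst p + snd p = e \<and> - (fst p * snd p) = h"
  define s where "s = sqrt (e\<^sup>2 + 4 * h)"
  have s2: "s\<^sup>2 = e\<^sup>2 + 4 * h" using assms by (simp add: s_def)
  have s: "\<bar>e\<bar> < s" unfolding s_def using assms by (intro real_less_rsqrt) simp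
  have "?P ((e + s) / 2, (e - s) / 2)"
    using s s2 by (auto simp: field_simps power2_eq_square)
  moreover have "p = q" if p: "?P p" and q: "?P q" for p q
  proof -
    \<comment> \<open>Both pairs have the same sum and product, so \<open>fst p\<close> is a root of
      the quadratic with roots \<open>fst q\<close> and \<open>snd q\<close>; the signs exclude the
      latter.\<close>
    have "(fst p - fst q) * (fst p - snd q) = (fst p)\<^sup>2 - (fst q + snd q) * fst p + fst q * snd q"
      by (simp add: algebra_simps power2_eq_square)
    also have "\<dots> = (fst p)\<^sup>2 - (fst p + snd p) * fst p + fst p * snd p"
      using p q by (metis neg_equal_iff_equal)
    also have "\<dots> = 0" by (simp add: algebra_simps power2_eq_square)
    finally have "fst p = fst q" using p q by auto
    thus ?thesis using p q by (auto simp: prod_eq_iff)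
  qed
  ultimately have "\<exists>!p. ?P p" by blast
  hence "?P (THE p. ?P p)" by (rule theI')
  moreover have "eps_pair e h = (THE p. ?P p)"
    unfolding eps_pair_def by (simp add: case_prod_unfold)
  ultimately show ?thesis by simp
qed

lemma exp_eval_scaled_mvar:
  "exp_eval (\<lambda>j. mconst a * mvar j) d = mconst (a ^ deg d) * (Poly_Mapping.single d 1 :: complex mpoly)"
proof (induction d rule: exponent_induct)
  case zero
  show ?case by (simp add: mconst_hom)
next
  case (add d j)
  thus ?case
    by (simp add: exp_eval_add esum_add mconst_def mvar_def mult_single mult.commute add.commute)
qed

lemma coef_jack_poly:
  "coef (jack_poly e h l) d = complex_of_real
     (coef (macdonald_jack (eps1 e h / (- eps2 e h)) l) d * (1 / (- eps2 e h)) ^ deg d)"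
proof -
  let ?J = "macdonald_jack (eps1 e h / (- eps2 e h)) l" and ?a = "complex_of_real (1 / (- eps2 e h))"
  have "coef (jack_poly e h l) d = (\<Sum>x\<in>supp ?J. if x = d then complex_of_real (coef ?J d) * ?a ^ deg d else 0)"
    unfolding jack_poly_def msubst_eq exp_eval_scaled_mvar lookup_sum coef_mconst_mult
    by (intro sum.cong refl) (simp add: coef_single)
  thus ?thesis by (simp add: in_keys_iff)
qed

text \<open>A power sum monomial with \<open>deg d\<close> factors picks up that power of the
  scaling factor. This matches Macdonald's norms with the Hermitian ones.\<close>

lemma mon_norm_scale: "mon_norm (h * a\<^sup>2) d = mon_norm h d * (a ^ deg d)\<^sup>2"
proof -
  have "a ^ deg d = (\<Prod>j\<in>supp d. a ^ coef d j)"
    by (simp add: esum_def power_sum)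
  hence "mon_norm h d * (a ^ deg d)\<^sup>2
    = (\<Prod>j\<in>supp d. (h * real (Suc j)) ^ coef d j * fact (coef d j) * (a ^ coef d j)\<^sup>2)"
    by (simp add: mon_norm_def prod.distrib prod_power_distrib)
  also have "\<dots> = mon_norm (h * a\<^sup>2) d"
    unfolding mon_norm_def
    by (intro prod.cong refl) (simp add: power_mult_distrib power_mult[symmetric] mult_ac)
  finally show ?thesis by simp
qed

text \<open>Independent Poisson weights without the normalizing exponential, which enters the
  measure as one global factor.\<close>

definition pois :: "(nat \<Rightarrow> real) \<Rightarrow> (nat \<Rightarrow>\<^sub>0 nat) \<Rightarrow> real" where
  "pois r d = (\<Prod>j\<in>supp d. r j ^ coef d j / fact (coef d j))"

lemma jack_prob_nonneg: "jack_prob e h V l \<ge> 0"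
  by (simp add: jack_prob_def)

text \<open>The square is a double sum over power sum monomials. Summation over the partitions first
  leaves the diagonal by \<open>jack_completeness\<close>, and there the powers of the scaling
  factor cancel against those in the norm, so that \<open>e\<close> disappears.\<close>

lemma sum_jack_prob:
  fixes V :: "nat \<Rightarrow> complex"
  assumes "h > 0"
  shows "(\<Sum>l | psize l = n. jack_prob e h V l)
    = (\<Sum>d | wt d = n. pois (\<lambda>j. (cmod (V (Suc j)))\<^sup>2 / (h * real (Suc j))) d)
      * exp (- (1 / h) * suminf (\<lambda>k. (cmod (V (Suc k)))\<^sup>2 / real (Suc k)))"
proof -
  define a where "a = 1 / (- eps2 e h)"
  define \<alpha> where "\<alpha> = eps1 e h / (- eps2 e h)"
  define J where "J = macdonald_jack \<alpha>"
  define W where "W = exp_eval (\<lambda>j. V (Suc j))"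
  let ?D = "{d. wt d = n}" and ?nl = "\<lambda>l. macdonald_form \<alpha> (J l) (J l)"
  note eps = eps_pair[OF assms, of e]
  have \<alpha>: "\<alpha> > 0" using eps unfolding \<alpha>_def by (intro divide_pos_pos) auto
  have ne: "eps2 e h \<noteq> 0" using eps by auto
  have "h * a\<^sup>2 = - (eps1 e h * eps2 e h) * a\<^sup>2" using eps by simp
  also have "\<dots> = \<alpha>" by (simp add: a_def \<alpha>_def power2_eq_square ne)
  finally have ha: "mon_norm \<alpha> d = mon_norm h d * (a ^ deg d)\<^sup>2" for d
    using mon_norm_scale[of h a d] by simp
  have cj: "coef (jack_poly e h l) d = complex_of_real (coef (J l) d * a ^ deg d)" for l d
    by (simp only: coef_jack_poly J_def \<alpha>_def a_def)
  have nz: "a \<noteq> 0" using eps by (simp add: a_def)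
  have supp: "supp (jack_poly e h l) = supp (J l)" for l
    using nz by (auto simp: in_keys_iff cj)
  have "herm h (jack_poly e h l) (jack_poly e h l) = complex_of_real (?nl l)" for l
    unfolding herm_def macdonald_form_def supp cj of_real_sum
    by (intro sum.cong refl) (simp add: ha power2_eq_square mult_ac)
  hence hn: "herm_norm h (jack_poly e h l) = sqrt (?nl l)" for l by (simp add: herm_norm_def)
  have nl: "?nl l > 0" for l unfolding J_def using \<alpha> by (intro mform_pos jack_nonzero)
  define b where "b l d = coef (J l) d * a ^ deg d / sqrt (?nl l)" for l d
  have cn: "coef (jack_poly_norm e h l) d = complex_of_real (b l d)" for l d
    unfolding jack_poly_norm_def coef_mconst_mult cj hn by (simp add: b_def)
  have ev: "msubst (\<lambda>c. c) (\<lambda>j. V (Suc j)) (jack_poly_norm e h l) = (\<Sum>d\<in>?D. complex_of_real (b l d) * W d)"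
    if "psize l = n" for l
  proof -
    have "supp (jack_poly_norm e h l) \<subseteq> supp (J l)" by (auto simp: in_keys_iff cn b_def)
    also have "supp (J l) \<subseteq> ?D"
      using homog_jack[OF macdonald_jack[OF \<alpha>], of l] that by (auto simp: homog_def J_def)
    finally have "supp (jack_poly_norm e h l) \<subseteq> ?D" .
    hence "(\<Sum>d\<in>supp (jack_poly_norm e h l). coef (jack_poly_norm e h l) d * W d)
      = (\<Sum>d\<in>?D. coef (jack_poly_norm e h l) d * W d)"
      using finite_wt by (intro sum.mono_neutral_left) (auto simp: in_keys_iff)
    thus ?thesis by (simp add: msubst_eq W_def cn)
  qed
  have sq: "complex_of_real ((cmod (\<Sum>d\<in>?D. complex_of_real (b l d) * W d))\<^sup>2)
     = (\<Sum>d\<in>?D. \<Sum>d'\<in>?D. complex_of_real (b l d * b l d') * (W d * cnj (W d')))" for l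
    unfolding complex_norm_square cnj_sum sum_product by (intro sum.cong refl) (simp add: mult_ac)
  have orth: "(\<Sum>l | psize l = n. b l d * b l d') = (if d = d' then 1 / mon_norm h d else 0)"
    if "d \<in> ?D" "d' \<in> ?D" for d d'
  proof -
    have "b l d * b l d' = a ^ deg d * a ^ deg d' * (coef (J l) d * coef (J l) d' / ?nl l)" for l
    proof -
      have "sqrt (?nl l) * sqrt (?nl l) = ?nl l" using nl[of l] by simp
      thus ?thesis by (simp add: b_def)
    qed
    hence "(\<Sum>l | psize l = n. b l d * b l d')
      = a ^ deg d * a ^ deg d' * (\<Sum>l | psize l = n. coef (J l) d * coef (J l) d' / ?nl l)"
      by (simp add: sum_distrib_left)
    also have "\<dots> = a ^ deg d * a ^ deg d' * (if d = d' then 1 / mon_norm \<alpha> d else 0)"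
      using jack_completeness[OF \<alpha>, of d n d'] that unfolding J_def by simp
    also have "\<dots> = (if d = d' then 1 / mon_norm h d else 0)"
      using nz by (simp add: ha power2_eq_square)
    finally show ?thesis .
  qed
  have "complex_of_real (\<Sum>l | psize l = n. (cmod (\<Sum>d\<in>?D. complex_of_real (b l d) * W d))\<^sup>2)
    = (\<Sum>l | psize l = n. \<Sum>d\<in>?D. \<Sum>d'\<in>?D. complex_of_real (b l d * b l d') * (W d * cnj (W d')))"
    by (simp only: of_real_sum sq)
  also have "\<dots> = (\<Sum>d\<in>?D. \<Sum>d'\<in>?D. \<Sum>l | psize l = n. complex_of_real (b l d * b l d') * (W d * cnj (W d')))"
    by (subst sum.swap, intro sum.cong refl, rule sum.swap)
  also have "\<dots> = (\<Sum>d\<in>?D. \<Sum>d'\<in>?D. if d' = d then complex_of_real (1 / mon_norm h d) * (W d * cnj (W d)) else 0)"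
  proof (intro sum.cong refl)
    fix d d' assume d: "d \<in> ?D" "d' \<in> ?D"
    have "(\<Sum>l | psize l = n. complex_of_real (b l d * b l d') * (W d * cnj (W d')))
      = complex_of_real (\<Sum>l | psize l = n. b l d * b l d') * (W d * cnj (W d'))"
      by (simp only: of_real_sum sum_distrib_right)
    thus "(\<Sum>l | psize l = n. complex_of_real (b l d * b l d') * (W d * cnj (W d')))
      = (if d' = d then complex_of_real (1 / mon_norm h d) * (W d * cnj (W d)) else 0)"
      unfolding orth[OF d] by auto
  qed
  also have "\<dots> = (\<Sum>d\<in>?D. complex_of_real ((cmod (W d))\<^sup>2 / mon_norm h d))"
  proof (intro sum.cong refl)
    fix d assume "d \<in> ?D"
    hence "(\<Sum>d'\<in>?D. if d' = d then complex_of_real (1 / mon_norm h d) * (W d * cnj (W d)) else 0)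
      = complex_of_real (1 / mon_norm h d) * (W d * cnj (W d))" using finite_wt[of n] by simp
    thus "(\<Sum>d'\<in>?D. if d' = d then complex_of_real (1 / mon_norm h d) * (W d * cnj (W d)) else 0)
      = complex_of_real ((cmod (W d))\<^sup>2 / mon_norm h d)"
      by (simp add: complex_norm_square[symmetric])
  qed
  also have "\<dots> = complex_of_real (\<Sum>d\<in>?D. (cmod (W d))\<^sup>2 / mon_norm h d)" by (simp only: of_real_sum)
  finally have main: "(\<Sum>l | psize l = n. (cmod (\<Sum>d\<in>?D. complex_of_real (b l d) * W d))\<^sup>2)
    = (\<Sum>d\<in>?D. (cmod (W d))\<^sup>2 / mon_norm h d)" by (simp only: of_real_eq_iff)
  have pois: "(cmod (W d))\<^sup>2 / mon_norm h d = pois (\<lambda>j. (cmod (V (Suc j)))\<^sup>2 / (h * real (Suc j))) d" for d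
  proof -
    have "(cmod (W d))\<^sup>2 = (\<Prod>j\<in>supp d. cmod (V (Suc j)) ^ coef d j)\<^sup>2"
      by (simp add: W_def exp_eval_def norm_power flip: prod_norm)
    also have "\<dots> = (\<Prod>j\<in>supp d. ((cmod (V (Suc j)))\<^sup>2) ^ coef d j)"
      unfolding prod_power_distrib by (intro prod.cong refl) (simp add: power_mult[symmetric] mult.commute)
    finally have "(cmod (W d))\<^sup>2 = (\<Prod>j\<in>supp d. ((cmod (V (Suc j)))\<^sup>2) ^ coef d j)" .
    thus ?thesis unfolding mon_norm_def pois_def
      by (simp only: power_divide divide_divide_eq_left prod_dividef)
  qed
  have "(\<Sum>l | psize l = n. jack_prob e h V l)
    = (\<Sum>l | psize l = n. (cmod (\<Sum>d\<in>?D. complex_of_real (b l d) * W d))\<^sup>2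
        * exp (- (1 / h) * suminf (\<lambda>k. (cmod (V (Suc k)))\<^sup>2 / real (Suc k))))"
    unfolding jack_prob_def by (intro sum.cong refl) (simp only: ev mem_Collect_eq)
  thus ?thesis by (simp only: sum_distrib_right[symmetric] main pois)
qed

section \<open>Poisson sums\<close>

lemma pois_superset: "finite S \<Longrightarrow> supp d \<subseteq> S \<Longrightarrow> pois r d = (\<Prod>j\<in>S. r j ^ coef d j / fact (coef d j))"
  unfolding pois_def by (intro prod.mono_neutral_left) (auto simp: in_keys_iff)

lemma pois_nonneg: "(\<And>j. r j \<ge> 0) \<Longrightarrow> pois r d \<ge> 0"
  unfolding pois_def by (intro prod_nonneg) auto

lemma pois_add_single:
  assumes "coef d k = 0"
  shows "pois r (d + Poly_Mapping.single k m) = pois r d * (r k ^ m / fact m)"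
proof -
  let ?S = "insert k (supp d)"
  have k: "k \<notin> supp d" using assms by (simp add: in_keys_iff)
  have other: "coef (d + Poly_Mapping.single k m) j = coef d j" if "j \<in> supp d" for j
    using that k by (auto simp: lookup_add coef_single)
  have "pois r (d + Poly_Mapping.single k m)
      = (\<Prod>j\<in>?S. r j ^ coef (d + Poly_Mapping.single k m) j / fact (coef (d + Poly_Mapping.single k m) j))"
    by (rule pois_superset) (auto simp: supp_add_exp)
  also have "\<dots> = r k ^ m / fact m * (\<Prod>j\<in>supp d. r j ^ coef d j / fact (coef d j))"
    using k by (simp add: other) (simp add: lookup_add assms)
  finally show ?thesis by (simp add: pois_def mult.commute)
qed

lemma pois_add_unit: "real (Suc (coef d k)) * pois r (d + unit_exp k) = r k * pois r d"
proof -
  let ?m = "coef d k"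
  define e where "e = d - Poly_Mapping.single k ?m"
  have e: "coef e k = 0" by (simp add: e_def lookup_minus)
  have d: "d = e + Poly_Mapping.single k ?m"
    by (intro poly_mapping_eqI) (auto simp: e_def lookup_add lookup_minus coef_single)
  have "d + unit_exp k = e + Poly_Mapping.single k (Suc ?m)"
    by (intro poly_mapping_eqI) (auto simp: e_def lookup_add lookup_minus coef_single)
  hence "pois r (d + unit_exp k) = pois r e * (r k ^ Suc ?m / fact (Suc ?m))"
    using pois_add_single[OF e] by simp
  moreover have "pois r d = pois r e * (r k ^ ?m / fact ?m)"
    using pois_add_single[OF e, of r ?m] d by simp
  moreover have "real (Suc ?m) * (r k ^ Suc ?m / fact (Suc ?m)) = r k * (r k ^ ?m / fact ?m)"
    by (simp del: of_nat_Suc)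
  ultimately show ?thesis by (metis mult.left_commute)
qed

section \<open>Total mass and mean of the Poisson weights\<close>

lemma nn_integral_exp_series:
  assumes "x \<ge> 0"
  shows "(\<integral>\<^sup>+ m. ennreal (x ^ m / fact m) \<partial>count_space UNIV) = ennreal (exp x)"
proof -
  have "(\<lambda>m. x ^ m / fact m) sums exp x"
    using exp_converges[of x] by (simp add: divide_inverse mult.commute)
  hence "(suminf (\<lambda>m. ennreal (x ^ m / fact m))) = ennreal (exp x)"
    using assms by (intro suminf_ennreal_eq) auto
  thus ?thesis by (simp add: nn_integral_count_space_nat)
qed

text \<open>An exponent supported below \<open>Suc K\<close> is a pair of one supported below
  \<open>K\<close> and the multiplicity at \<open>K\<close>; the weight factors accordingly, and the
  last factor sums to an exponential.\<close>

lemma nn_integral_pois_finite: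
  assumes "\<And>j. r j \<ge> 0"
  shows "(\<integral>\<^sup>+ d. ennreal (pois r d) * indicator {d. supp d \<subseteq> {..<K}} d \<partial>count_space UNIV)
    = ennreal (exp (\<Sum>j<K. r j))"
proof (induction K)
  case 0
  have "{d :: nat \<Rightarrow>\<^sub>0 nat. supp d \<subseteq> {..<0}} = {0}" by auto
  thus ?case by (simp add: nn_integral_count_space_indicator[symmetric] nn_integral_count_space_finite pois_def)
next
  case (Suc K)
  let ?A = "{d :: nat \<Rightarrow>\<^sub>0 nat. supp d \<subseteq> {..<K}}" and ?B = "{d :: nat \<Rightarrow>\<^sub>0 nat. supp d \<subseteq> {..<Suc K}}"
  let ?g = "\<lambda>z :: (nat \<Rightarrow>\<^sub>0 nat) \<times> nat. fst z + Poly_Mapping.single K (snd z)"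
  have bij: "bij_betw ?g (?A \<times> UNIV) ?B"
  proof (rule bij_betwI[where g = "\<lambda>d :: nat \<Rightarrow>\<^sub>0 nat. (d - Poly_Mapping.single K (coef d K), coef d K)"])
    show "?g \<in> ?A \<times> UNIV \<rightarrow> ?B" by (auto simp: supp_add_exp split: if_splits)
    show "(\<lambda>d. (d - Poly_Mapping.single K (coef d K), coef d K)) \<in> ?B \<rightarrow> ?A \<times> UNIV"
      by (auto simp: in_keys_iff lookup_minus coef_single subset_iff less_Suc_eq split: if_splits) metis
    show "(?g z - Poly_Mapping.single K (coef (?g z) K), coef (?g z) K) = z" if "z \<in> ?A \<times> UNIV" for z
    proof -
      have "coef (fst z) K = 0" using that by (auto simp: in_keys_iff subset_iff)
      thus ?thesis by (auto simp: prod_eq_iff lookup_add)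
    qed
    show "?g (d - Poly_Mapping.single K (coef d K), coef d K) = d" if "d \<in> ?B" for d
      by (intro poly_mapping_eqI) (auto simp: lookup_add lookup_minus coef_single)
  qed
  let ?q = "\<lambda>m. ennreal (r K ^ m / fact m)"
  have "(\<integral>\<^sup>+ d. ennreal (pois r d) * indicator ?B d \<partial>count_space UNIV) = (\<integral>\<^sup>+ d. ennreal (pois r d) \<partial>count_space ?B)"
    by (simp add: nn_integral_count_space_indicator)
  also have "\<dots> = (\<integral>\<^sup>+ z. ennreal (pois r (?g z)) \<partial>count_space (?A \<times> UNIV))"
    by (rule nn_integral_bij_count_space[OF bij, symmetric])
  also have "\<dots> = (\<integral>\<^sup>+ z. ennreal (pois r (?g z)) * indicator (?A \<times> UNIV) z \<partial>count_space UNIV)"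
    by (simp add: nn_integral_count_space_indicator)
  also have "\<dots> = (\<integral>\<^sup>+ z. ennreal (pois r (fst z)) * indicator ?A (fst z) * ?q (snd z) \<partial>count_space UNIV)"
  proof (intro nn_integral_cong)
    fix z :: "(nat \<Rightarrow>\<^sub>0 nat) \<times> nat"
    show "ennreal (pois r (?g z)) * indicator (?A \<times> UNIV) z
      = ennreal (pois r (fst z)) * indicator ?A (fst z) * ?q (snd z)"
    proof (cases "fst z \<in> ?A")
      case True
      hence "coef (fst z) K = 0" by (auto simp: in_keys_iff subset_iff)
      hence "pois r (?g z) = pois r (fst z) * (r K ^ snd z / fact (snd z))" by (rule pois_add_single)
      hence "ennreal (pois r (?g z)) = ennreal (pois r (fst z)) * ?q (snd z)"
        by (simp add: pois_nonneg assms flip: ennreal_mult)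
      thus ?thesis using True by (simp add: indicator_def mem_Times_iff)
    qed (simp add: indicator_def mem_Times_iff)
  qed
  also have "\<dots> = (\<integral>\<^sup>+ d. \<integral>\<^sup>+ m. ennreal (pois r d) * indicator ?A d * ?q m \<partial>count_space UNIV \<partial>count_space UNIV)"
    using nn_integral_fst_count_space[of "\<lambda>z. ennreal (pois r (fst z)) * indicator ?A (fst z) * ?q (snd z)"] by simp
  also have "\<dots> = (\<integral>\<^sup>+ d. ennreal (pois r d) * indicator ?A d * ennreal (exp (r K)) \<partial>count_space UNIV)"
    using nn_integral_exp_series[OF assms] by (simp add: nn_integral_cmult)
  also have "\<dots> = ennreal (exp (\<Sum>j<K. r j)) * ennreal (exp (r K))"
    unfolding Suc[symmetric] by (rule nn_integral_multc) simp
  also have "\<dots> = ennreal (exp (\<Sum>j<Suc K. r j))" by (simp add: exp_add ennreal_mult)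
  finally show ?case .
qed

text \<open>Every exponent has finite support, so the bounded sums exhaust all exponents
  monotonically as \<open>K\<close> grows.\<close>

lemma nn_integral_pois:
  assumes "\<And>j. r j \<ge> 0" "summable r"
  shows "(\<integral>\<^sup>+ d. ennreal (pois r d) \<partial>count_space UNIV) = ennreal (exp (suminf r))"
proof -
  let ?f = "\<lambda>K d. ennreal (pois r d) * indicator {d. supp d \<subseteq> {..<K}} d"
  have sup: "(SUP K. ?f K d) = ennreal (pois r d)" for d
  proof (rule antisym)
    show "(SUP K. ?f K d) \<le> ennreal (pois r d)" by (intro SUP_least) (auto simp: indicator_def)
    obtain K where "supp d \<subseteq> {..<K}" using finite_nat_iff_bounded[of "supp d"] by auto
    hence "ennreal (pois r d) = ?f K d" by simp
    also have "\<dots> \<le> (SUP K. ?f K d)" by (rule SUP_upper) simp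
    finally show "ennreal (pois r d) \<le> (SUP K. ?f K d)" .
  qed
  have inc: "incseq ?f"
    by (intro incseq_SucI le_funI mult_left_mono) (auto simp: indicator_def)
  have "(\<integral>\<^sup>+ d. ennreal (pois r d) \<partial>count_space UNIV) = (\<integral>\<^sup>+ d. (SUP K. ?f K d) \<partial>count_space UNIV)"
    by (simp only: sup)
  also have "\<dots> = (SUP K. \<integral>\<^sup>+ d. ?f K d \<partial>count_space UNIV)"
    by (rule nn_integral_monotone_convergence_SUP[OF inc]) simp
  also have "\<dots> = (SUP K. ennreal (exp (\<Sum>j<K. r j)))"
    by (simp only: nn_integral_pois_finite[OF assms(1)])
  also have "\<dots> = ennreal (exp (suminf r))"
  proof (rule LIMSEQ_unique)
    show "(\<lambda>K. ennreal (exp (\<Sum>j<K. r j))) \<longlonglongrightarrow> (SUP K. ennreal (exp (\<Sum>j<K. r j)))"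
      using assms(1) by (intro LIMSEQ_SUP incseq_SucI ennreal_leI) simp
    show "(\<lambda>K. ennreal (exp (\<Sum>j<K. r j))) \<longlonglongrightarrow> ennreal (exp (suminf r))"
      using assms(2) by (intro tendsto_ennrealI tendsto_exp summable_LIMSEQ)
  qed
  finally show ?thesis .
qed

text \<open>The usual computation of a Poisson mean: terms with multiplicity 0 vanish, and on the
  others a shift by one trades the multiplicity for the factor \<open>r k\<close>.\<close>

lemma nn_integral_coef_pois:
  assumes "\<And>j. r j \<ge> 0"
  shows "(\<integral>\<^sup>+ d. ennreal (real (coef d k) * pois r d) \<partial>count_space UNIV)
    = ennreal (r k) * (\<integral>\<^sup>+ d. ennreal (pois r d) \<partial>count_space UNIV)"
proof -
  let ?B = "{d :: nat \<Rightarrow>\<^sub>0 nat. coef d k \<noteq> 0}" and ?f = "\<lambda>d. ennreal (real (coef d k) * pois r d)"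
  have bij: "bij_betw (\<lambda>d. d + unit_exp k) UNIV ?B"
  proof (rule bij_betwI[where g = "\<lambda>d. d - unit_exp k"])
    show "d - unit_exp k + unit_exp k = d" if "d \<in> ?B" for d
      using that by (intro poly_mapping_eqI) (auto simp: lookup_add lookup_minus coef_single)
  qed (auto simp: lookup_add)
  have "(\<integral>\<^sup>+ d. ?f d \<partial>count_space UNIV) = (\<integral>\<^sup>+ d. ?f d * indicator ?B d \<partial>count_space UNIV)"
    by (intro nn_integral_cong) (auto simp: indicator_def)
  also have "\<dots> = (\<integral>\<^sup>+ d. ?f d \<partial>count_space ?B)"
    by (simp add: nn_integral_count_space_indicator)
  also have "\<dots> = (\<integral>\<^sup>+ d. ?f (d + unit_exp k) \<partial>count_space UNIV)"
    by (rule nn_integral_bij_count_space[OF bij, symmetric])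
  also have "\<dots> = (\<integral>\<^sup>+ d. ennreal (r k) * ennreal (pois r d) \<partial>count_space UNIV)"
  proof (intro nn_integral_cong)
    fix d
    have "real (coef (d + unit_exp k) k) * pois r (d + unit_exp k) = r k * pois r d"
      using pois_add_unit[of d k r] by (simp add: lookup_add)
    thus "?f (d + unit_exp k) = ennreal (r k) * ennreal (pois r d)"
      using assms by (simp add: ennreal_mult pois_nonneg)
  qed
  also have "\<dots> = ennreal (r k) * (\<integral>\<^sup>+ d. ennreal (pois r d) \<partial>count_space UNIV)"
    by (rule nn_integral_cmult) simp
  finally show ?thesis .
qed

text \<open>The weight is a series of multiplicities, integrated term by term. The series of means
  may diverge; the exchange remains valid for extended nonnegative values.\<close>

lemma nn_integral_wt_pois:
  assumes "\<And>j. r j \<ge> 0" "summable r"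
  shows "(\<integral>\<^sup>+ d. ennreal (real (wt d) * pois r d) \<partial>count_space UNIV)
    = (suminf (\<lambda>j. ennreal (real (Suc j) * r j))) * ennreal (exp (suminf r))"
proof -
  have pn: "pois r d \<ge> 0" for d using assms(1) by (rule pois_nonneg)
  have "ennreal (real (wt d) * pois r d) = (suminf (\<lambda>j. ennreal (real (Suc j)) * ennreal (real (coef d j) * pois r d)))" for d
  proof -
    have "(suminf (\<lambda>j. ennreal (real (Suc j)) * ennreal (real (coef d j) * pois r d)))
      = (\<Sum>j\<in>supp d. ennreal (real (Suc j)) * ennreal (real (coef d j) * pois r d))"
      by (intro suminf_finite) (auto simp: in_keys_iff)
    also have "\<dots> = (\<Sum>j\<in>supp d. ennreal (real (Suc j * coef d j) * pois r d))"
      unfolding of_nat_mult mult.assoc by (intro sum.cong refl ennreal_mult[symmetric]) (use pn in auto)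
    also have "\<dots> = ennreal (\<Sum>j\<in>supp d. real (Suc j * coef d j) * pois r d)"
      using pn by (intro sum_ennreal) simp
    also have "(\<Sum>j\<in>supp d. real (Suc j * coef d j) * pois r d) = real (wt d) * pois r d"
      unfolding esum_def of_nat_sum sum_distrib_right ..
    finally show ?thesis by simp
  qed
  hence "(\<integral>\<^sup>+ d. ennreal (real (wt d) * pois r d) \<partial>count_space UNIV)
    = (suminf (\<lambda>j. \<integral>\<^sup>+ d. ennreal (real (Suc j)) * ennreal (real (coef d j) * pois r d) \<partial>count_space UNIV))"
    by (simp add: nn_integral_suminf)
  also have "\<dots> = (suminf (\<lambda>j. ennreal (real (Suc j) * r j) * ennreal (exp (suminf r))))"
    using assms by (simp add: nn_integral_cmult nn_integral_coef_pois nn_integral_pois ennreal_mult mult.assoc)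
  finally show ?thesis by simp
qed

text \<open>Partitions and power sum exponents are compared degree by degree, since their weights
  agree only after summation over a whole degree.\<close>

lemma nn_integral_fibres:
  fixes f :: "'a \<Rightarrow> ennreal" and s :: "'a \<Rightarrow> nat"
  assumes "\<And>n. finite {x. s x = n}"
  shows "(\<integral>\<^sup>+ x. f x \<partial>count_space UNIV) = (suminf (\<lambda>n. \<Sum>x | s x = n. f x))"
proof -
  have "f x = (suminf (\<lambda>n. f x * indicator {x. s x = n} x))" for x
  proof -
    have "(suminf (\<lambda>n. f x * indicator {x. s x = n} x)) = (\<Sum>n\<in>{s x}. f x * indicator {x. s x = n} x)"
      by (intro suminf_finite) auto
    thus ?thesis by simp
  qed
  hence "(\<integral>\<^sup>+ x. f x \<partial>count_space UNIV) = (\<integral>\<^sup>+ x. (suminf (\<lambda>n. f x * indicator {x. s x = n} x)) \<partial>count_space UNIV)"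
    by simp
  also have "\<dots> = (suminf (\<lambda>n. \<integral>\<^sup>+ x. f x * indicator {x. s x = n} x \<partial>count_space UNIV))"
    by (rule nn_integral_suminf) simp
  also have "\<dots> = (suminf (\<lambda>n. \<integral>\<^sup>+ x. f x \<partial>count_space {x. s x = n}))"
    by (simp add: nn_integral_count_space_indicator)
  also have "\<dots> = (suminf (\<lambda>n. \<Sum>x | s x = n. f x))"
    using assms by (simp add: nn_integral_count_space_finite)
  finally show ?thesis .
qed

text \<open>The arbitrary function \<open>w\<close> of the size covers both applications: the
  constant 1 for the total mass, the identity for the expectation.\<close>

lemma nn_integral_jack_prob:
  fixes V :: "nat \<Rightarrow> complex" and w :: "nat \<Rightarrow> real"
  assumes "h > 0" "summable (\<lambda>k. (cmod (V (Suc k)))\<^sup>2 / real (Suc k))" "\<And>n. w n \<ge> 0"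
  defines "r \<equiv> \<lambda>j. (cmod (V (Suc j)))\<^sup>2 / (h * real (Suc j))"
  shows "(\<integral>\<^sup>+ l. ennreal (w (psize l) * jack_prob e h V l) \<partial>count_space UNIV)
    = (\<integral>\<^sup>+ d. ennreal (w (wt d) * pois r d) \<partial>count_space UNIV) * ennreal (exp (- suminf r))"
proof -
  let ?s = "\<lambda>k. (cmod (V (Suc k)))\<^sup>2 / real (Suc k)"
  have r: "r = (\<lambda>j. (1 / h) * ?s j)" by (simp add: r_def)

  have sr: "- (1 / h) * suminf ?s = - suminf r"
    unfolding r using suminf_mult[OF assms(2), of "1 / h"] by simp
  have r0: "r j \<ge> 0" for j using assms(1) by (simp add: r_def)
  let ?c = "ennreal (exp (- suminf r))"
  have *: "(\<Sum>l | psize l = n. ennreal (w (psize l) * jack_prob e h V l))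
     = (\<Sum>d | wt d = n. ennreal (w (wt d) * pois r d)) * ?c" for n
  proof -
    have "(\<Sum>l | psize l = n. ennreal (w (psize l) * jack_prob e h V l))
      = ennreal (w n * (\<Sum>l | psize l = n. jack_prob e h V l))"
      using assms(3) jack_prob_nonneg by (subst sum_ennreal) (simp_all add: sum_distrib_left)
    also have "w n * (\<Sum>l | psize l = n. jack_prob e h V l) = (\<Sum>d | wt d = n. w (wt d) * pois r d) * exp (- suminf r)"
      unfolding sum_jack_prob[OF assms(1)] sr r_def[symmetric] by (simp add: sum_distrib_left mult.assoc)
    also have "ennreal \<dots> = (\<Sum>d | wt d = n. ennreal (w (wt d) * pois r d)) * ?c"
      using assms(3) pois_nonneg[OF r0] by (subst sum_ennreal) (simp_all add: ennreal_mult sum_nonneg)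
    finally show ?thesis .
  qed
  have "(\<integral>\<^sup>+ l. ennreal (w (psize l) * jack_prob e h V l) \<partial>count_space UNIV)
    = (suminf (\<lambda>n. (\<Sum>d | wt d = n. ennreal (w (wt d) * pois r d)) * ?c))"
    unfolding nn_integral_fibres[of psize, OF finite_psize] * ..
  also have "\<dots> = (suminf (\<lambda>n. \<Sum>d | wt d = n. ennreal (w (wt d) * pois r d))) * ?c" by simp
  also have "(suminf (\<lambda>n. \<Sum>d | wt d = n. ennreal (w (wt d) * pois r d)))
    = (\<integral>\<^sup>+ d. ennreal (w (wt d) * pois r d) \<partial>count_space UNIV)"
    by (rule nn_integral_fibres[of wt, OF finite_wt, symmetric])
  finally show ?thesis .
qed

theorem proposition1p3p1:
  fixes eps_bar hbar :: real and V :: "nat \<Rightarrow> complex"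
  assumes "hbar > 0"
    and "summable (\<lambda>k. (cmod (V (Suc k)))\<^sup>2 / real (Suc k))"
  shows "(\<integral>\<^sup>+ l. ennreal (real (psize l)) \<partial>measure_pmf (jack_measure eps_bar hbar V)) =
         ennreal (1 / hbar) * suminf (\<lambda>k. ennreal ((cmod (V (Suc k)))\<^sup>2))"
proof -
  let ?p = "jack_prob eps_bar hbar V"
  define r where "r j = (cmod (V (Suc j)))\<^sup>2 / (hbar * real (Suc j))" for j
  have J: "(\<integral>\<^sup>+ l. ennreal (w (psize l) * ?p l) \<partial>count_space UNIV)
    = (\<integral>\<^sup>+ d. ennreal (w (wt d) * pois r d) \<partial>count_space UNIV) * ennreal (exp (- suminf r))"
    if "\<And>n. w n \<ge> 0" for w
    unfolding r_def using that by (rule nn_integral_jack_prob[OF assms])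
  have "summable (\<lambda>k. 1 / hbar * ((cmod (V (Suc k)))\<^sup>2 / real (Suc k)))"
    by (rule summable_mult[OF assms(2)])
  hence sr: "summable r" by (simp add: r_def[abs_def])
  have r0: "r j \<ge> 0" for j using assms(1) by (simp add: r_def)
  have E: "ennreal (exp (suminf r)) * ennreal (exp (- suminf r)) = 1"
    by (simp add: exp_minus flip: ennreal_mult)
  \<comment> \<open>Total mass 1 is what makes \<open>embed_pmf\<close> return a measure with the
    weights \<open>?p\<close>.\<close>
  have "(\<integral>\<^sup>+ l. ennreal (?p l) \<partial>count_space UNIV) = 1"
    using J[of "\<lambda>_. 1"] nn_integral_pois[OF r0 sr] E by simp
  hence pmf: "pmf (jack_measure eps_bar hbar V) l = ?p l" for l
    unfolding jack_measure_def by (intro pmf_embed_pmf jack_prob_nonneg) simp_all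
  have "(\<integral>\<^sup>+ l. ennreal (real (psize l)) \<partial>measure_pmf (jack_measure eps_bar hbar V))
    = (\<integral>\<^sup>+ l. ennreal (real (psize l) * ?p l) \<partial>count_space UNIV)"
    by (simp add: nn_integral_measure_pmf pmf ennreal_mult jack_prob_nonneg mult.commute)
  also have "\<dots> = (suminf (\<lambda>j. ennreal (real (Suc j) * r j))) * (ennreal (exp (suminf r)) * ennreal (exp (- suminf r)))"
    using J[of real] nn_integral_wt_pois[OF r0 sr] by (simp add: mult.assoc)
  also have "\<dots> = (suminf (\<lambda>j. ennreal (1 / hbar) * ennreal ((cmod (V (Suc j)))\<^sup>2)))"
  proof -
    have "ennreal (real (Suc j) * r j) = ennreal (1 / hbar) * ennreal ((cmod (V (Suc j)))\<^sup>2)" for j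
    proof -
      have "real (Suc j) * r j = 1 / hbar * (cmod (V (Suc j)))\<^sup>2" by (simp add: r_def del: of_nat_Suc)
      thus ?thesis using assms(1) by (simp flip: ennreal_mult)
    qed
    thus ?thesis by (simp add: E)
  qed
  finally show ?thesis by simp
qed

end
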